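(* Let $d\ge 1$ and $0<\alpha<1$. There is a constant $C=C(d,\alpha)>0$ such that the following holds. Let $u\colon\mathbb{R}^d\to\mathbb{R}$ be a compactly supported Lebesgue integrable function. The $d$-current $\llbracket u\rrbracket$ is $\alpha$-fractional if and only if $u\in W^{1-\alpha,1}_c(\mathbb{R}^d)$, in which case $$\frac1C\,\tilde{\mathbf F}^\alpha(\llbracket u\rrbracket)\le \|u\|_{W^{1-\alpha,1}(\mathbb{R}^d)}\le C\,\tilde{\mathbf F}^\alpha(\llbracket u\rrbracket).$$
   Context: Currents: a (compactly supported) $m$-current $T$ in $\mathbb{R}^d$ is a continuous linear functional on $C^\infty(\mathbb{R}^d;\wedge^m\mathbb{R}^d)$ (smooth $m$-forms with the usual topology); $\partial T(\omega)=T(d\omega)$ for $m\ge1$. Covectors carry the comass norm and $\|\omega\|_\infty$ is the supremum of the comass. $\mathbf M(T)=\sup\{T(\omega):\|\omega\|_\infty\le1\}$; $\mathbf N(T)=\mathbf M(T)+\mathbf M(\partial T)$ for $m\ge1$, $\mathbf N=\mathbf M$ for $m=0$; $T$ is normal if $\mathbf N(T)<\infty$. For normal $T$, the flat norm is $\mathbf F(T)=\sup\{T(\omega):\max\{\|\omega\|_\infty,\|d\omega\|_\infty\}\le1\}$. $T$ is flat if it is the weak limit of an $\mathbf F$-Cauchy sequence $(T_n)$ of normal currents with $\bigcup_n\operatorname{spt}T_n$ relatively compact; then $\mathbf F(T)=\lim\mathbf F(T_n)$. A flat $m$-current $T$ is $\alpha$-fractional if it admits an $\alpha$-fractional decomposition,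 i.e. a sequence $(T_k)_{k\ge0}$ of normal $m$-currents, all supported in a common compact set, with $\sum_k\mathbf N(T_k)^{1-\alpha}\mathbf F(T_k)^\alpha<\infty$ and $T=\sum_kT_k$ ($\mathbf F$-convergent series). For an $\alpha$-fractional $d$-current $T$ in $\mathbb{R}^d$, $$\tilde{\mathbf F}^\alpha(T)=\inf\sum_{k=0}^\infty\mathbf M(\partial T_k)^{1-\alpha}\mathbf M(T_k)^\alpha,$$ the infimum being over all $\alpha$-fractional decompositions of $T$. For $u\in L^1_c(\mathbb{R}^d)$, $\llbracket u\rrbracket$ is the $d$-current $f\,dx_1\wedge\dots\wedge dx_d\mapsto\int uf\,dx$. For $u\in L^1(\mathbb{R}^d)$, $$\|u\|_{W^{1-\alpha,1}(\mathbb{R}^d)}=\int_{\mathbb{R}^d}\int_{\mathbb{R}^d}\frac{|u(x)-u(y)|}{|x-y|^{d+1-\alpha}}\,dx\,dy,$$ and $W^{1-\alpha,1}_c(\mathbb{R}^d)$ is the space of compactly supported integrable $u$ for which this is finite. *)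

theory Defs
  imports "HOL-Analysis.Analysis"
begin

section \<open>Smooth differential forms\<close>

text \<open>
  An $m$-covector is an alternating $m$-linear functional on lists of $m$ vectors. It is set to
  zero on lists of any other length, so that equality of covectors is equality of functions.
\<close>

definition covector :: "nat \<Rightarrow> ('a::euclidean_space list \<Rightarrow> real) \<Rightarrow> bool" where
  "covector m \<phi> \<longleftrightarrow>
     (\<forall>vs. length vs \<noteq> m \<longrightarrow> \<phi> vs = 0) \<and>
     (\<forall>vs i. length vs = m \<longrightarrow> i < m \<longrightarrow> linear (\<lambda>v. \<phi> (vs[i := v]))) \<and>
     (\<forall>vs i j. length vs = m \<longrightarrow> i < m \<longrightarrow> j < m \<longrightarrow> i \<noteq> j \<longrightarrow> vs ! i = vs ! j \<longrightarrow> \<phi> vs = 0)"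

definition orthonormal_list :: "'a::euclidean_space list \<Rightarrow> bool" where
  "orthonormal_list vs \<longleftrightarrow>
     (\<forall>i<length vs. \<forall>j<length vs. vs ! i \<bullet> vs ! j = (if i = j then 1 else 0))"

text \<open>
  The comass is the supremum over unit simple $m$-vectors, which are exactly the wedge products of
  orthonormal families. For an $m$-covector only lists of length $m$ contribute.
\<close>

definition comass :: "('a::euclidean_space list \<Rightarrow> real) \<Rightarrow> ennreal" where
  "comass \<phi> = (SUP vs\<in>{vs. orthonormal_list vs}. ennreal \<bar>\<phi> vs\<bar>)"

fun iter_deriv :: "'a::euclidean_space list \<Rightarrow> ('a \<Rightarrow> real) \<Rightarrow> 'a \<Rightarrow> real" where
  "iter_deriv [] f = f"
| "iter_deriv (u # us) f = iter_deriv us (\<lambda>x. frechet_derivative f (at x) u)"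

definition smooth :: "('a::euclidean_space \<Rightarrow> real) \<Rightarrow> bool" where
  "smooth f \<longleftrightarrow> (\<forall>us x. iter_deriv us f differentiable (at x))"

type_synonym 'a form = "'a \<Rightarrow> 'a list \<Rightarrow> real"

definition smooth_forms :: "nat \<Rightarrow> 'a::euclidean_space form set" where
  "smooth_forms m = {\<omega>. (\<forall>x. covector m (\<omega> x)) \<and> (\<forall>vs. smooth (\<lambda>x. \<omega> x vs))}"

text \<open>Uniform convergence on compact sets of all iterated derivatives of all coefficients.\<close>

definition form_topology :: "nat \<Rightarrow> 'a::euclidean_space form topology" where
  "form_topology m = topology_generated_by
     {{\<eta> \<in> smooth_forms m. \<forall>x\<in>K.
         \<bar>iter_deriv us (\<lambda>y. \<eta> y vs) x - iter_deriv us (\<lambda>y. \<omega> y vs) x\<bar> < \<epsilon>} |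
       \<omega> K us vs \<epsilon>. \<omega> \<in> smooth_forms m \<and> compact K \<and> 0 < \<epsilon>}"

text \<open>
  $d\omega(x)(v_0,\dots,v_m) = \sum_i (-1)^i\, D_{v_i}\omega(x)(v_0,\dots,\widehat{v_i},\dots,v_m)$;
  the degree is determined by the lengths of the lists on which \<open>\<omega>\<close> is nonzero.
\<close>

definition ext_deriv :: "'a::euclidean_space form \<Rightarrow> 'a form" where
  "ext_deriv \<omega> x vs =
     (\<Sum>i<length vs. (-1) ^ i *
        frechet_derivative (\<lambda>y. \<omega> y (take i vs @ drop (Suc i) vs)) (at x) (vs ! i))"

definition form_norm :: "'a::euclidean_space form \<Rightarrow> ennreal" where
  "form_norm \<omega> = (SUP x. comass (\<omega> x))"

definition form_support :: "'a::euclidean_space form \<Rightarrow> 'a set" where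
  "form_support \<omega> = closure {x. \<exists>vs. \<omega> x vs \<noteq> 0}"


section \<open>Currents\<close>

text \<open>Only the values of a current on smooth \<open>m\<close>-forms are meaningful.\<close>

type_synonym 'a current = "'a form \<Rightarrow> real"

definition current :: "nat \<Rightarrow> 'a::euclidean_space current \<Rightarrow> bool" where
  "current m T \<longleftrightarrow>
     (\<forall>\<omega>\<in>smooth_forms m. \<forall>\<eta>\<in>smooth_forms m. T (\<lambda>x vs. \<omega> x vs + \<eta> x vs) = T \<omega> + T \<eta>) \<and>
     (\<forall>c. \<forall>\<omega>\<in>smooth_forms m. T (\<lambda>x vs. c * \<omega> x vs) = c * T \<omega>) \<and>
     continuous_map (form_topology m) euclideanreal T"

definition boundary :: "'a::euclidean_space current \<Rightarrow> 'a current" where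
  "boundary T \<omega> = T (ext_deriv \<omega>)"

definition current_support :: "nat \<Rightarrow> 'a::euclidean_space current \<Rightarrow> 'a set" where
  "current_support m T =
     - \<Union>{U. open U \<and> (\<forall>\<omega>\<in>smooth_forms m. form_support \<omega> \<subseteq> U \<longrightarrow> T \<omega> = 0)}"

text \<open>
  The function \<open>ennreal\<close> truncates negative values to \<open>0\<close>; this does not affect the
  suprema below, since the zero form is always admissible.
\<close>

definition mass :: "nat \<Rightarrow> 'a::euclidean_space current \<Rightarrow> ennreal" where
  "mass m T = (SUP \<omega>\<in>{\<omega> \<in> smooth_forms m. form_norm \<omega> \<le> 1}. ennreal (T \<omega>))"

definition normal_mass :: "nat \<Rightarrow> 'a::euclidean_space current \<Rightarrow> ennreal" where
  "normal_mass m T = (if m = 0 then mass m T else mass m T + mass (m - 1) (boundary T))"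

definition normal_current :: "nat \<Rightarrow> 'a::euclidean_space current \<Rightarrow> bool" where
  "normal_current m T \<longleftrightarrow> current m T \<and> normal_mass m T < \<infinity>"

definition flat_norm :: "nat \<Rightarrow> 'a::euclidean_space current \<Rightarrow> ennreal" where
  "flat_norm m T =
     (SUP \<omega>\<in>{\<omega> \<in> smooth_forms m. max (form_norm \<omega>) (form_norm (ext_deriv \<omega>)) \<le> 1}. ennreal (T \<omega>))"

definition flat_approx :: "nat \<Rightarrow> (nat \<Rightarrow> 'a::euclidean_space current) \<Rightarrow> 'a current \<Rightarrow> bool" where
  "flat_approx m S T \<longleftrightarrow>
     (\<forall>n. normal_current m (S n)) \<and>
     compact (closure (\<Union>n. current_support m (S n))) \<and>
     (\<forall>\<epsilon>>0. \<exists>N. \<forall>n\<ge>N. \<forall>k\<ge>N. flat_norm m (\<lambda>\<omega>. S n \<omega> - S k \<omega>) < \<epsilon>) \<and>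
     (\<forall>\<omega>\<in>smooth_forms m. (\<lambda>n. S n \<omega>) \<longlonglongrightarrow> T \<omega>)"

definition flat_current :: "nat \<Rightarrow> 'a::euclidean_space current \<Rightarrow> bool" where
  "flat_current m T \<longleftrightarrow> current m T \<and> (\<exists>S. flat_approx m S T)"

text \<open>
  The flat norm of a flat current is the limit of the flat norms of approximating normal
  currents. The supremum that defines \<^const>\<open>flat_norm\<close> has this value.
\<close>

lemma flat_norm_flat_approx:
  assumes "flat_approx m S T"
  shows "(\<lambda>n. flat_norm m (S n)) \<longlonglongrightarrow> flat_norm m T"
proof -
  define A :: "'a form set" where
    "A = {\<omega> \<in> smooth_forms m. max (form_norm \<omega>) (form_norm (ext_deriv \<omega>)) \<le> 1}"
  have fn: "flat_norm m R = (SUP \<omega>\<in>A. ennreal (R \<omega>))" for R :: "'a current"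
    by (simp add: flat_norm_def A_def)
  have close: "\<exists>N. \<forall>n\<ge>N. \<forall>\<omega>\<in>A. \<bar>S n \<omega> - T \<omega>\<bar> \<le> e" if e: "0 < e" for e :: real
  proof -
    obtain N where N: "\<And>n k. n \<ge> N \<Longrightarrow> k \<ge> N \<Longrightarrow> flat_norm m (\<lambda>\<omega>. S n \<omega> - S k \<omega>) < ennreal e"
      using assms e unfolding flat_approx_def by (metis ennreal_less_zero_iff)
    have *: "S n \<omega> - S k \<omega> \<le> e" if "n \<ge> N" "k \<ge> N" "\<omega> \<in> A" for n k \<omega>
    proof -
      have "ennreal (S n \<omega> - S k \<omega>) \<le> flat_norm m (\<lambda>\<omega>. S n \<omega> - S k \<omega>)"
        unfolding fn by (rule SUP_upper) (use that in auto)
      also have "\<dots> \<le> ennreal e" using N that by (simp add: less_imp_le)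
      finally show ?thesis using e by (simp add: ennreal_le_iff)
    qed
    have "\<bar>S n \<omega> - T \<omega>\<bar> \<le> e" if n: "n \<ge> N" and w: "\<omega> \<in> A" for n \<omega>
    proof -
      have lim: "(\<lambda>k. S k \<omega>) \<longlonglongrightarrow> T \<omega>"
        using assms w unfolding flat_approx_def A_def by auto
      have "(\<lambda>k. \<bar>S n \<omega> - S k \<omega>\<bar>) \<longlonglongrightarrow> \<bar>S n \<omega> - T \<omega>\<bar>"
        by (intro tendsto_intros lim)
      moreover have "\<forall>k\<ge>N. \<bar>S n \<omega> - S k \<omega>\<bar> \<le> e"
        using *[OF n _ w] *[OF _ n w] by (simp add: abs_le_iff)
      ultimately show ?thesis by (meson LIMSEQ_le_const2)
    qed
    then show ?thesis by blast
  qed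
  have le: "flat_norm m R \<le> flat_norm m R' + ennreal e"
    if "0 < e" "\<And>\<omega>. \<omega> \<in> A \<Longrightarrow> \<bar>R \<omega> - R' \<omega>\<bar> \<le> e" for R R' :: "'a current" and e
    unfolding fn[of R]
  proof (rule SUP_least)
    fix \<omega> assume w: "\<omega> \<in> A"
    have "ennreal (R \<omega>) \<le> ennreal (max 0 (R' \<omega>) + e)"
      using that(2)[OF w] by (intro ennreal_leI) auto
    also have "\<dots> = ennreal (R' \<omega>) + ennreal e"
      using that(1) by (simp add: ennreal_plus max_def ennreal_neg)
    also have "\<dots> \<le> flat_norm m R' + ennreal e"
      unfolding fn by (intro add_right_mono SUP_upper w)
    finally show "ennreal (R \<omega>) \<le> flat_norm m R' + ennreal e" .
  qed
  have ev: "\<forall>\<^sub>F n in sequentially. flat_norm m (S n) \<le> flat_norm m T + ennreal e \<and>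
      flat_norm m T \<le> flat_norm m (S n) + ennreal e" if e: "0 < e" for e
  proof -
    obtain N where N: "\<And>n \<omega>. n \<ge> N \<Longrightarrow> \<omega> \<in> A \<Longrightarrow> \<bar>S n \<omega> - T \<omega>\<bar> \<le> e" using close[OF e] by blast
    show ?thesis
      unfolding eventually_sequentially
    proof (intro exI allI impI conjI)
      fix n assume n: "N \<le> n"
      show "flat_norm m (S n) \<le> flat_norm m T + ennreal e" by (rule le[OF e N[OF n]])
      show "flat_norm m T \<le> flat_norm m (S n) + ennreal e"
        by (rule le[OF e]) (use N[OF n] in \<open>simp add: abs_minus_commute\<close>)
    qed
  qed
  show ?thesis
  proof (cases "flat_norm m T = \<infinity>")
    case True
    have "\<forall>\<^sub>F n in sequentially. flat_norm m (S n) = \<infinity>"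
      using ev[of 1] True by (auto elim!: eventually_mono simp: top_unique ennreal_add_eq_top)
    then show ?thesis using True by (simp add: tendsto_eventually)
  next
    case False
    then obtain t where t: "0 \<le> t" "flat_norm m T = ennreal t"
      by (metis ennreal_cases infinity_ennreal_def)
    define f where "f n = enn2real (flat_norm m (S n))" for n
    have ev': "\<forall>\<^sub>F n in sequentially. flat_norm m (S n) = ennreal (f n) \<and> \<bar>f n - t\<bar> \<le> e"
      if e: "0 < e" for e
      using ev[OF e]
    proof eventually_elim
      case (elim n)
      then have "flat_norm m (S n) \<le> ennreal (t + e)" using t e by (simp add: ennreal_plus)
      then have "flat_norm m (S n) < \<infinity>" by (rule order.strict_trans1) simp
      then have fn: "flat_norm m (S n) = ennreal (f n)" "0 \<le> f n" by (simp_all add: f_def)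
      have "ennreal (f n) \<le> ennreal (t + e)" "ennreal t \<le> ennreal (f n + e)"
        using elim t e fn by (simp_all add: ennreal_plus)
      then have "f n \<le> t + e" "t \<le> f n + e" using t e fn by (simp_all del: ennreal_plus)
      then show ?case using fn by auto
    qed
    have "f \<longlonglongrightarrow> t"
    proof (rule tendstoI)
      fix e :: real assume "0 < e"
      then show "\<forall>\<^sub>F n in sequentially. dist (f n) t < e"
        using ev'[of "e / 2"] by (auto elim!: eventually_mono simp: dist_real_def)
    qed
    then have "(\<lambda>n. ennreal (f n)) \<longlonglongrightarrow> flat_norm m T" using t by simp
    moreover have "\<forall>\<^sub>F n in sequentially. ennreal (f n) = flat_norm m (S n)"
      using ev'[of 1] by (auto elim: eventually_mono)
    ultimately show ?thesis by (rule Lim_transform_eventually)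
  qed
qed


section \<open>Fractional currents\<close>

definition fractional_decomposition ::
    "nat \<Rightarrow> real \<Rightarrow> 'a::euclidean_space current \<Rightarrow> (nat \<Rightarrow> 'a current) \<Rightarrow> bool" where
  "fractional_decomposition m \<alpha> T S \<longleftrightarrow>
     (\<forall>k. normal_current m (S k)) \<and>
     (\<exists>K. compact K \<and> (\<forall>k. current_support m (S k) \<subseteq> K)) \<and>
     summable (\<lambda>k. enn2real (normal_mass m (S k)) powr (1 - \<alpha>) *
                   enn2real (flat_norm m (S k)) powr \<alpha>) \<and>
     (\<lambda>n. flat_norm m (\<lambda>\<omega>. T \<omega> - (\<Sum>k<n. S k \<omega>))) \<longlonglongrightarrow> 0"

definition fractional_current :: "nat \<Rightarrow> real \<Rightarrow> 'a::euclidean_space current \<Rightarrow> bool" where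
  "fractional_current m \<alpha> T \<longleftrightarrow> flat_current m T \<and> (\<exists>S. fractional_decomposition m \<alpha> T S)"

text \<open>For top-dimensional currents only; every mass below is finite because each \<open>S k\<close> is normal.\<close>

definition frac_norm :: "real \<Rightarrow> 'a::euclidean_space current \<Rightarrow> ennreal" where
  "frac_norm \<alpha> T =
     (INF S\<in>{S. fractional_decomposition DIM('a) \<alpha> T S}.
        \<Sum>k. ennreal (enn2real (mass (DIM('a) - 1) (boundary (S k))) powr (1 - \<alpha>) *
                     enn2real (mass DIM('a) (S k)) powr \<alpha>))"


section \<open>Integrable functions as top-dimensional currents\<close>

text \<open>
  The linear order on the index type fixes the orientation. The coefficient $f$ of
  $f\,dx_1\wedge\dots\wedge dx_d$ is the value of the form on the ordered standard basis.
\<close>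

definition std_basis :: "(real ^ 'n::{finite,linorder}) list" where
  "std_basis = map (\<lambda>i. axis i 1) (sorted_list_of_set UNIV)"

definition fun_current :: "(real ^ 'n::{finite,linorder} \<Rightarrow> real) \<Rightarrow> (real ^ 'n::{finite,linorder}) current" where
  "fun_current u \<omega> = (LINT x|lebesgue. u x * \<omega> x std_basis)"

text \<open>Supports of integrable functions are understood up to null sets.\<close>

definition compactly_supported :: "('a::euclidean_space \<Rightarrow> real) \<Rightarrow> bool" where
  "compactly_supported u \<longleftrightarrow> (\<exists>K. compact K \<and> (AE x in lebesgue. x \<notin> K \<longrightarrow> u x = 0))"

definition sobolev_norm :: "real \<Rightarrow> ('a::euclidean_space \<Rightarrow> real) \<Rightarrow> ennreal" where
  "sobolev_norm \<alpha> u =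
     (\<integral>\<^sup>+ x. \<integral>\<^sup>+ y. ennreal (\<bar>u x - u y\<bar> / norm (x - y) powr (real DIM('a) + 1 - \<alpha>))
        \<partial>lebesgue \<partial>lebesgue)"

definition sobolev_c :: "real \<Rightarrow> ('a::euclidean_space \<Rightarrow> real) set" where
  "sobolev_c \<alpha> = {u. integrable lebesgue u \<and> compactly_supported u \<and> sobolev_norm \<alpha> u < \<infinity>}"

end

theory Submission
  imports Defs
begin

text \<open>
  Write \<open>D h = \<integral> \<bar>v (x - h) - v x\<bar> dx\<close> for a Borel version \<open>v\<close> of \<open>u\<close>, so that the Sobolev norm is
  \<open>\<integral> D h / \<bar>h\<bar>\<^sup>s dh\<close> with \<open>s = d + 1 - \<alpha>\<close>. On top-dimensional currents the flat norm is the mass.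

  For a normal current \<open>S\<close>, translation by \<open>h\<close> changes \<open>S\<close> in mass by at most a constant times
  \<open>min (2 M(S)) (\<bar>h\<bar> M(\<partial>S))\<close>, because the translation difference of a top-dimensional form has a
  primitive of comass at most a constant times \<open>\<bar>h\<bar>\<close>. Summing over a decomposition and integrating
  against \<open>\<bar>h\<bar>\<close> to the power \<open>-s\<close> turns each minimum into a multiple of
  \<open>M(\<partial>S)\<close> to the power \<open>1 - \<alpha>\<close> times \<open>M(S)\<close> to the power \<open>\<alpha>\<close>.

  Conversely, mollify at the scales \<open>R / 2^k\<close> and telescope. At scale \<open>r\<close> the mass of the error is
  controlled by the average of \<open>D\<close> over the ball of radius \<open>r\<close>, and the mass of the boundary by that
  average divided by \<open>r\<close>; the resulting series is a dyadic version of the Sobolev integral. The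
  coarsest piece is not controlled by the Sobolev norm, but its contribution vanishes as \<open>R\<close> tends
  to infinity.
\<close>

section \<open>Smooth functions\<close>

text \<open>No mollified function is ever formed. Mollification acts on test functions:
  \<open>smear r f\<close> averages, over \<open>z\<close> in the unit ball, the pairing of
  \<open>v\<close> with \<open>f\<close> translated by \<open>r\<close> times \<open>z\<close>. The
  kernel only has to be continuously differentiable with a derivative that can be written down,
  hence the polynomial \<open>bump0\<close>. The boundary estimate integrates by parts in
  \<open>z\<close>. Subtracting the constant \<open>pairing f 0\<close> beforehand changes no
  derivative and leaves only differences of pairings, which \<open>osc\<close> bounds; this is what
  replaces \<open>L1\<close> by the oscillation. A decomposition has to be summable with the full
  normal mass, whereas \<open>frac_norm\<close> counts the boundary mass only. The two are therefore
  estimated separately: the summability bound carries a factor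
  \<open>(1 + R) powr (1 - \<alpha>)\<close>, the bound for \<open>frac_norm\<close> has no such
  factor, and this is why \<open>R\<close> can be sent to infinity. The comass is a supremum over
  the whole space, so the duality that recovers an L1 norm needs smooth test functions bounded by 1
  everywhere.\<close>

lemma smooth_differentiable: "smooth f \<Longrightarrow> f differentiable (at x)"
  unfolding smooth_def using iter_deriv.simps(1)[of f] by (elim allE[of _ "[]"]) simp

lemma smooth_frechet_derivative: "smooth f \<Longrightarrow> smooth (\<lambda>x. frechet_derivative f (at x) u)"
  unfolding smooth_def
proof (intro allI)
  fix us x assume "\<forall>us x. iter_deriv us f differentiable (at x)"
  then have "iter_deriv (u # us) f differentiable (at x)" by blast
  then show "iter_deriv us (\<lambda>x. frechet_derivative f (at x) u) differentiable (at x)" by simp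
qed

lemma smooth_has_derivative:
  "smooth f \<Longrightarrow> (f has_derivative frechet_derivative f (at x)) (at x)"
  using smooth_differentiable frechet_derivative_works by blast

text \<open>\<open>iter_deriv\<close> differentiates along the head of the list and continues with
  the result, so induction on the list works once the function is generalised. Smoothness is then
  shown by exhibiting a class of differentiable functions that is stable under directional
  derivatives.\<close>

lemma smooth_coinduct:
  assumes "P f" and diff: "\<And>f x. P f \<Longrightarrow> f differentiable (at x)"
    and deriv: "\<And>f u. P f \<Longrightarrow> P (\<lambda>x. frechet_derivative f (at x) u)"
  shows "smooth f"
proof -
  have "iter_deriv us f differentiable (at x)" if "P f" for us f x
    using that
  proof (induction us arbitrary: f)
    case Nil then show ?case using diff by simp
  next
    case (Cons u us)
    show ?case unfolding iter_deriv.simps by (rule Cons.IH[OF deriv[OF Cons.prems]])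
  qed
  then show ?thesis using \<open>P f\<close> unfolding smooth_def by blast
qed

lemma smooth_continuous_on: "smooth f \<Longrightarrow> continuous_on S f"
  by (simp add: continuous_at_imp_continuous_on differentiable_imp_continuous_within
      smooth_differentiable)

lemma smooth_borel_measurable: "smooth f \<Longrightarrow> f \<in> borel_measurable borel"
  by (simp add: borel_measurable_continuous_onI smooth_continuous_on)

lemma smooth_bounded_linear:
  fixes f :: "'a::euclidean_space \<Rightarrow> real"
  assumes "bounded_linear f"
  shows "smooth (\<lambda>x. f x + c)"
proof -
  \<comment> \<open>The class of affine functions is stable: the derivative in direction
    \<open>u\<close> is the constant \<open>f u\<close>, affine with zero linear part.\<close>
  define P where "P g \<longleftrightarrow> (\<exists>(f :: 'a \<Rightarrow> real) c. bounded_linear f \<and> g = (\<lambda>x. f x + c))" for g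
  have deriv: "((\<lambda>x. f x + c) has_derivative f) (at x)" if "bounded_linear f" for f :: "'a \<Rightarrow> real" and c x
    using that by (auto intro!: derivative_eq_intros bounded_linear.has_derivative[OF that])
  show ?thesis
  proof (rule smooth_coinduct[of P])
    show "P (\<lambda>x. f x + c)" using assms P_def by blast
    show "g differentiable (at x)" if "P g" for g x
      using that deriv unfolding P_def differentiable_def by blast
    show "P (\<lambda>x. frechet_derivative g (at x) u)" if "P g" for g u
    proof -
      obtain f c where f: "bounded_linear f" "g = (\<lambda>x. f x + c)" using \<open>P g\<close> unfolding P_def by blast
      then have "(\<lambda>x. frechet_derivative g (at x) u) = (\<lambda>x. (\<lambda>x. 0) x + f u)"
        using frechet_derivative_at[OF deriv[OF f(1), of c], symmetric] by simp
      then show ?thesis unfolding P_def by (intro exI[of _ "\<lambda>x. 0"] exI[of _ "f u"]) simp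
    qed
  qed
qed

lemma smooth_const: "smooth (\<lambda>x. c)"
  using smooth_bounded_linear[OF bounded_linear_zero, of c] by simp

text \<open>The product rule turns a product into a sum of products, so products of smooth functions
  alone are not stable under derivatives; this closure is. \<open>cos\<close> is included because
  the chain rule for \<open>sin\<close> produces it.\<close>

inductive smooth_closure :: "('a::euclidean_space \<Rightarrow> real) \<Rightarrow> bool" where
  base: "smooth f \<Longrightarrow> smooth_closure f"
| add: "smooth_closure f \<Longrightarrow> smooth_closure g \<Longrightarrow> smooth_closure (\<lambda>x. f x + g x)"
| mult: "smooth_closure f \<Longrightarrow> smooth_closure g \<Longrightarrow> smooth_closure (\<lambda>x. f x * g x)"
| sin: "smooth_closure f \<Longrightarrow> smooth_closure (\<lambda>x. sin (f x))"
| cos: "smooth_closure f \<Longrightarrow> smooth_closure (\<lambda>x. cos (f x))"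

lemma smooth_closure_deriv:
  assumes "smooth_closure f"
  shows "(\<forall>x. f differentiable (at x)) \<and> (\<forall>u. smooth_closure (\<lambda>x. frechet_derivative f (at x) u))"
  using assms
proof induction
  case (base f)
  then show ?case
    by (simp add: smooth_closure.base smooth_differentiable smooth_frechet_derivative)
next
  case (add f g)
  then have d: "((\<lambda>x. f x + g x) has_derivative
      (\<lambda>u. frechet_derivative f (at x) u + frechet_derivative g (at x) u)) (at x)" for x
    by (auto intro!: derivative_eq_intros simp: frechet_derivative_works)
  show ?case
    unfolding frechet_derivative_at[OF d, symmetric]
    by (intro conjI allI differentiableI[OF d] smooth_closure.add) (use add in auto)
next
  case (mult f g)
  then have d: "((\<lambda>x. f x * g x) has_derivative
      (\<lambda>u. f x * frechet_derivative g (at x) u + frechet_derivative f (at x) u * g x)) (at x)" for x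
    by (auto intro!: derivative_eq_intros simp: frechet_derivative_works)
  show ?case
    unfolding frechet_derivative_at[OF d, symmetric]
    by (intro conjI allI differentiableI[OF d] smooth_closure.mult smooth_closure.add) (use mult in auto)
next
  case (sin f)
  then have d: "((\<lambda>x. sin (f x)) has_derivative
      (\<lambda>u. cos (f x) * frechet_derivative f (at x) u)) (at x)" for x
    by (auto intro!: derivative_eq_intros simp: frechet_derivative_works)
  show ?case
    unfolding frechet_derivative_at[OF d, symmetric]
    by (intro conjI allI differentiableI[OF d] smooth_closure.mult smooth_closure.cos) (use sin in auto)
next
  case (cos f)
  then have d: "((\<lambda>x. cos (f x)) has_derivative
      (\<lambda>u. (- 1) * (sin (f x) * frechet_derivative f (at x) u))) (at x)" for x
    by (auto intro!: derivative_eq_intros simp: frechet_derivative_works)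
  show ?case
    unfolding frechet_derivative_at[OF d, symmetric]
    by (intro conjI allI differentiableI[OF d] smooth_closure.mult smooth_closure.sin smooth_closure.base[OF smooth_const]) (use cos in auto)
qed

lemma smooth_closure_smooth: "smooth_closure f \<Longrightarrow> smooth f"
  by (rule smooth_coinduct[of smooth_closure]) (auto dest: smooth_closure_deriv)

lemma smooth_add: "smooth f \<Longrightarrow> smooth g \<Longrightarrow> smooth (\<lambda>x. f x + g x)"
  by (rule smooth_closure_smooth[OF smooth_closure.add]) (auto intro: smooth_closure.base)

lemma smooth_mult: "smooth f \<Longrightarrow> smooth g \<Longrightarrow> smooth (\<lambda>x. f x * g x)"
  by (rule smooth_closure_smooth[OF smooth_closure.mult]) (auto intro: smooth_closure.base)

lemma smooth_sin: "smooth f \<Longrightarrow> smooth (\<lambda>x. sin (f x))"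
  by (rule smooth_closure_smooth[OF smooth_closure.sin]) (auto intro: smooth_closure.base)

lemma smooth_real_polynomial_function:
  "real_polynomial_function p \<Longrightarrow> smooth p"
proof (induction rule: real_polynomial_function.induct)
  case (linear f) then show ?case using smooth_bounded_linear[of f 0] by simp
qed (auto intro: smooth_const smooth_add smooth_mult)

section \<open>Translates and averages over segments\<close>

lemma smooth_translate_deriv:
  assumes "smooth f"
  shows "((\<lambda>x. f (x + h)) has_derivative frechet_derivative f (at (x + h))) (at x)"
  by (rule has_derivative_in_compose2[where g=f and t=UNIV and f="\<lambda>x. x + h" and f'="\<lambda>u. u", simplified])
     (auto intro!: derivative_eq_intros smooth_has_derivative assms)

lemma smooth_translate:
  fixes f :: "'a::euclidean_space \<Rightarrow> real"
  assumes "smooth f"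
  shows "smooth (\<lambda>x. f (x + h))"
proof (rule smooth_coinduct[of "\<lambda>g. \<exists>f. smooth f \<and> g = (\<lambda>x. f (x + h))"])
  fix g :: "'a \<Rightarrow> real" and u
  assume "\<exists>f. smooth f \<and> g = (\<lambda>x. f (x + h))"
  then obtain f where f: "smooth f" and g: "g = (\<lambda>x. f (x + h))" by blast
  note d = smooth_translate_deriv[OF f, of h]
  show "g differentiable (at x)" for x using d unfolding g differentiable_def by blast
  have "(\<lambda>x. frechet_derivative g (at x) u) = (\<lambda>x. frechet_derivative f (at (x + h)) u)"
    unfolding g using frechet_derivative_at[OF d] by metis
  then show "\<exists>f. smooth f \<and> (\<lambda>x. frechet_derivative g (at x) u) = (\<lambda>x. f (x + h))"
    using smooth_frechet_derivative[OF f] by (intro exI[of _ "\<lambda>x. frechet_derivative f (at x) u"]) auto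
qed (use assms in blast)

lemma smooth_segment_integral_deriv:
  fixes f :: "'a::euclidean_space \<Rightarrow> real"
  assumes f: "smooth f"
  shows "((\<lambda>x. integral {0..1} (\<lambda>t. f (x + t *\<^sub>R h))) has_derivative
     (\<lambda>u. integral {0..1} (\<lambda>t. frechet_derivative f (at (x + t *\<^sub>R h)) u))) (at x)"
proof -
  \<comment> \<open>The Leibniz rule takes the derivative as a bounded linear map depending
    continuously on \<open>(x, t)\<close>. It is assembled from the partial derivatives, each of
    which is smooth and hence continuous.\<close>
  define fx :: "'a \<Rightarrow> real \<Rightarrow> 'a \<Rightarrow>\<^sub>L real" where
    "fx x t = (\<Sum>b\<in>Basis. frechet_derivative f (at (x + t *\<^sub>R h)) b *\<^sub>R blinfun_inner_left b)" for x t
  have lin: "linear (frechet_derivative f (at y))" for y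
    by (simp add: f linear_frechet_derivative smooth_differentiable)
  have fx: "blinfun_apply (fx x t) = frechet_derivative f (at (x + t *\<^sub>R h))" for x t
  proof
    fix u
    have "frechet_derivative f (at (x + t *\<^sub>R h)) u
        = frechet_derivative f (at (x + t *\<^sub>R h)) (\<Sum>b\<in>Basis. (u \<bullet> b) *\<^sub>R b)"
      by (simp add: euclidean_representation)
    also have "\<dots> = (\<Sum>b\<in>Basis. (u \<bullet> b) * frechet_derivative f (at (x + t *\<^sub>R h)) b)"
      by (simp add: linear_sum[OF lin] linear_cmul[OF lin])
    finally show "blinfun_apply (fx x t) u = frechet_derivative f (at (x + t *\<^sub>R h)) u"
      unfolding fx_def
      by (simp add: blinfun.sum_left blinfun.scaleR_left inner_commute mult.commute)
  qed
  have cont: "continuous_on S (\<lambda>p. frechet_derivative f (at (fst p + snd p *\<^sub>R h)) b)" for S b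
    by (rule continuous_on_compose2[OF smooth_continuous_on[OF smooth_frechet_derivative[OF f]]])
       (auto intro!: continuous_intros)
  have main: "((\<lambda>x. integral (cbox 0 1) (\<lambda>t. f (x + t *\<^sub>R h))) has_derivative
      integral (cbox 0 1) (fx x)) (at x within UNIV)"
  proof (rule leibniz_rule)
    show "((\<lambda>x. f (x + t *\<^sub>R h)) has_derivative blinfun_apply (fx x t)) (at x within UNIV)" for x t
      using smooth_translate_deriv[OF f] by (simp add: fx)
    show "(\<lambda>t. f (x + t *\<^sub>R h)) integrable_on cbox 0 1" for x
      by (intro integrable_continuous continuous_on_compose2[OF smooth_continuous_on[OF f]])
         (auto intro!: continuous_intros)
    show "continuous_on (UNIV \<times> cbox 0 1) (\<lambda>(x, t). fx x t)"
      unfolding fx_def case_prod_beta by (intro continuous_intros cont)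
  qed auto
  have "integral (cbox 0 1) (fx x) u = integral {0..1} (\<lambda>t. fx x t u)" for u
  proof -
    have "fx x integrable_on cbox 0 1"
      unfolding fx_def
      by (intro integrable_continuous continuous_intros
         continuous_on_compose2[OF smooth_continuous_on[OF smooth_frechet_derivative[OF f]]]) auto
    then show ?thesis
      by (simp add: blinfun_apply_integral)
  qed
  then have "blinfun_apply (integral {0..1} (fx x)) =
      (\<lambda>u. integral {0..1} (\<lambda>t. frechet_derivative f (at (x + t *\<^sub>R h)) u))"
    by (simp add: fx fun_eq_iff)
  then show ?thesis using main by simp
qed

lemma smooth_segment_integral:
  fixes f :: "'a::euclidean_space \<Rightarrow> real"
  assumes "smooth f"
  shows "smooth (\<lambda>x. integral {0..1} (\<lambda>t. f (x + t *\<^sub>R h)))"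
proof (rule smooth_coinduct[of "\<lambda>g. \<exists>f. smooth f \<and> g = (\<lambda>x. integral {0..1} (\<lambda>t. f (x + t *\<^sub>R h)))"])
  fix g :: "'a \<Rightarrow> real" and u
  assume "\<exists>f. smooth f \<and> g = (\<lambda>x. integral {0..1} (\<lambda>t. f (x + t *\<^sub>R h)))"
  then obtain f where f: "smooth f" and g: "g = (\<lambda>x. integral {0..1} (\<lambda>t. f (x + t *\<^sub>R h)))" by blast
  note d = smooth_segment_integral_deriv[OF f, of h]
  show "g differentiable (at x)" for x using d unfolding g differentiable_def by blast
  have "(\<lambda>x. frechet_derivative g (at x) u) =
      (\<lambda>x. integral {0..1} (\<lambda>t. frechet_derivative f (at (x + t *\<^sub>R h)) u))"
    unfolding g using frechet_derivative_at[OF d] by metis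
  then show "\<exists>f. smooth f \<and> (\<lambda>x. frechet_derivative g (at x) u) = (\<lambda>x. integral {0..1} (\<lambda>t. f (x + t *\<^sub>R h)))"
    using smooth_frechet_derivative[OF f] by (intro exI[of _ "\<lambda>x. frechet_derivative f (at x) u"]) auto
qed (use assms in blast)

text \<open>In the direction \<open>h\<close> itself the differentiated integrand is the
  \<open>t\<close>-derivative of \<open>f (x + t *\<^sub>R h)\<close>, so the fundamental theorem of
  calculus evaluates the integral. The segment average is thus a primitive, along \<open>h\<close>,
  of the translation difference.\<close>

lemma segment_integral_deriv_direction:
  fixes f :: "'a::euclidean_space \<Rightarrow> real"
  assumes f: "smooth f"
  shows "frechet_derivative (\<lambda>x. integral {0..1} (\<lambda>t. f (x + t *\<^sub>R h))) (at x) h = f (x + h) - f x"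
proof -
  have "((\<lambda>t. frechet_derivative f (at (x + t *\<^sub>R h)) h) has_integral
     f (x + 1 *\<^sub>R h) - f (x + 0 *\<^sub>R h)) {0..1}"
  proof (rule fundamental_theorem_of_calculus)
    fix t :: real
    have "((\<lambda>t. f (x + t *\<^sub>R h)) has_derivative (\<lambda>s. frechet_derivative f (at (x + t *\<^sub>R h)) (s *\<^sub>R h))) (at t)"
      by (rule has_derivative_in_compose2[where g=f and t=UNIV and f="\<lambda>t. x + t *\<^sub>R h" and f'="\<lambda>s. s *\<^sub>R h", simplified])
         (auto intro!: derivative_eq_intros smooth_has_derivative f)
    moreover have "frechet_derivative f (at y) (s *\<^sub>R h) = s *\<^sub>R frechet_derivative f (at y) h" for s y
      by (simp add: f linear_cmul linear_frechet_derivative smooth_differentiable)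
    ultimately show "((\<lambda>t. f (x + t *\<^sub>R h)) has_vector_derivative frechet_derivative f (at (x + t *\<^sub>R h)) h) (at t within {0..1})"
      unfolding has_vector_derivative_def by (simp add: has_derivative_at_withinI)
  qed auto
  then show ?thesis
    unfolding frechet_derivative_at[OF smooth_segment_integral_deriv[OF f], symmetric]
    by (simp add: integral_unique)
qed

section \<open>Covectors and the determinant\<close>

lemma covector_linear:
  "covector m \<phi> \<Longrightarrow> length vs = m \<Longrightarrow> i < m \<Longrightarrow> linear (\<lambda>v. \<phi> (vs[i := v]))"
  unfolding covector_def by blast

lemma covector_equal_entries:
  "covector m \<phi> \<Longrightarrow> i < length vs \<Longrightarrow> j < length vs \<Longrightarrow> i \<noteq> j \<Longrightarrow> vs ! i = vs ! j \<Longrightarrow> \<phi> vs = 0"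
  unfolding covector_def by metis

lemma covector_wrong_length: "covector m \<phi> \<Longrightarrow> length vs \<noteq> m \<Longrightarrow> \<phi> vs = 0"
  unfolding covector_def by blast

text \<open>Polarisation: with the sum of both entries in both slots the value is zero, and
  expanding it leaves the two mixed terms.\<close>

lemma covector_swap:
  assumes c: "covector m \<phi>" and len: "length vs = m" and ij: "i < m" "j < m" "i \<noteq> j"
  shows "\<phi> (vs[i := vs ! j, j := vs ! i]) = - \<phi> vs"
proof -
  define g where "g x y = \<phi> (vs[i := x, j := y])" for x y
  have lin2: "linear (g x)" for x
    unfolding g_def using covector_linear[OF c, of "vs[i := x]" j] len ij by simp
  have lin1: "linear (\<lambda>x. g x y)" for y
    unfolding g_def list_update_swap[OF ij(3)]
    using covector_linear[OF c, of "vs[j := y]" i] len ij by simp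
  have diag: "g x x = 0" for x
    unfolding g_def by (rule covector_equal_entries[OF c, of i _ j]) (use len ij in auto)
  have "g (vs ! i + vs ! j) (vs ! i + vs ! j) =
      g (vs ! i) (vs ! i) + g (vs ! i) (vs ! j) + (g (vs ! j) (vs ! i) + g (vs ! j) (vs ! j))"
    by (simp add: linear_add[OF lin2] linear_add[OF lin1])
  then have "g (vs ! j) (vs ! i) = - g (vs ! i) (vs ! j)" by (simp add: diag)
  then show ?thesis by (simp add: g_def)
qed

text \<open>The vector \<open>h\<close> passes the entries of \<open>xs\<close> one at a time, each
  transposition costing a sign. These signs are the ones in \<open>ext_deriv\<close>.\<close>

lemma covector_move_to_front:
  assumes c: "covector m \<phi>"
  shows "length xs + length ys + 1 = m \<Longrightarrow> \<phi> (h # xs @ ys) = (-1) ^ length xs * \<phi> (xs @ h # ys)"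
proof (induction xs arbitrary: ys rule: rev_induct)
  case Nil then show ?case by simp
next
  case (snoc x xs)
  have "\<phi> (h # (xs @ [x]) @ ys) = (-1) ^ length xs * \<phi> (xs @ h # x # ys)"
    using snoc.IH[of "x # ys"] snoc.prems by simp
  also have "\<phi> (xs @ h # x # ys) = - \<phi> (xs @ x # h # ys)"
    using covector_swap[OF c, of "xs @ x # h # ys" "length xs" "Suc (length xs)"] snoc.prems
    by (simp add: nth_append list_update_append)
  finally show ?case by simp
qed

text \<open>Independent entries without repetition would be as many as the dimension and would span.
  The conclusion speaks of positions and not of elements, so that a repeated entry also counts as a
  dependence.\<close>

lemma not_spanning_list_dependent:
  fixes vs :: "'a::euclidean_space list"
  assumes len: "length vs = DIM('a)" and span: "span (set vs) \<noteq> UNIV"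
  shows "\<exists>j<length vs. vs ! j \<in> span ((!) vs ` ({..<length vs} - {j}))"
proof (rule ccontr)
  assume neg: "\<not> ?thesis"
  have inj: "vs ! i \<noteq> vs ! j" if "i < length vs" "j < length vs" "i \<noteq> j" for i j
    using neg that by (metis DiffI imageI lessThan_iff singletonD span_base)
  then have dist: "distinct vs" by (simp add: distinct_conv_nth)
  have "independent (set vs)"
    unfolding dependent_def
  proof
    assume "\<exists>a\<in>set vs. a \<in> span (set vs - {a})"
    then obtain j where j: "j < length vs" "vs ! j \<in> span (set vs - {vs ! j})"
      by (metis in_set_conv_nth)
    have "set vs - {vs ! j} \<subseteq> (!) vs ` ({..<length vs} - {j})"
      by (auto simp: in_set_conv_nth)
    then show False using neg j span_mono by blast
  qed
  then have "UNIV \<subseteq> span (set vs)"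
    using card_eq_dim[of "set vs" UNIV] len distinct_card[OF dist] by simp
  then show False using span by auto
qed

text \<open>Cramer's rule. When the list does not span, both sides vanish by alternation.\<close>

lemma covector_cramer:
  fixes vs :: "'a::euclidean_space list"
  assumes c: "covector DIM('a) \<phi>" and len: "length vs = DIM('a)" and l: "linear l"
  shows "(\<Sum>i<DIM('a). l (vs ! i) * \<phi> (vs[i := h])) = l h * \<phi> vs"
proof (cases "span (set vs) = UNIV")
  case True
  \<comment> \<open>The defect of the identity is linear in \<open>h\<close>. At
    \<open>h = vs ! j\<close> every summand except \<open>i = j\<close> repeats an entry, so the
    defect vanishes on the entries and hence on their span.\<close>
  define g where "g h = (\<Sum>i<DIM('a). l (vs ! i) * \<phi> (vs[i := h])) - l h * \<phi> vs" for h
  have lin: "linear g"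
  proof (rule linearI)
    show "g (x + y) = g x + g y" for x y
      unfolding g_def using linear_add[OF covector_linear[OF c len]] linear_add[OF l]
      by (simp add: sum.distrib algebra_simps)
    show "g (r *\<^sub>R x) = r *\<^sub>R g x" for r x
      unfolding g_def using linear_cmul[OF covector_linear[OF c len]] linear_cmul[OF l]
      by (simp add: sum_distrib_left algebra_simps)
  qed
  have "g (vs ! j) = 0" if j: "j < DIM('a)" for j
  proof -
    have "l (vs ! i) * \<phi> (vs[i := vs ! j]) = (if i = j then l (vs ! j) * \<phi> vs else 0)"
      if "i < DIM('a)" for i
      using covector_equal_entries[OF c, of i "vs[i := vs ! j]" j] that j len by auto
    then have "(\<Sum>i<DIM('a). l (vs ! i) * \<phi> (vs[i := vs ! j])) =
        (\<Sum>i<DIM('a). if i = j then l (vs ! j) * \<phi> vs else 0)"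
      by (intro sum.cong) auto
    then show ?thesis unfolding g_def using j by simp
  qed
  then have "g x = 0" if "x \<in> set vs" for x using that len by (metis in_set_conv_nth)
  then have "g h = 0" using linear_eq_0_on_span[OF lin, of "set vs"] True by auto
  then show ?thesis by (simp add: g_def)
next
  case False
  then obtain j where j: "j < DIM('a)" "vs ! j \<in> span ((!) vs ` ({..<DIM('a)} - {j}))"
    using not_spanning_list_dependent len by metis
  \<comment> \<open>The \<open>j\<close>-th entry is now the variable: \<open>g\<close> is linear in
    it and \<open>g (vs ! j)\<close> is the left-hand side. Since \<open>vs ! j\<close> lies in the
    span of the other entries, it suffices that \<open>g\<close> vanishes at each of those.\<close>
  define g where "g v = (\<Sum>i<DIM('a). l (vs[j := v] ! i) * \<phi> (vs[j := v, i := h]))" for v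
  have summand: "linear (\<lambda>v. l (vs[j := v] ! i) * \<phi> (vs[j := v, i := h]))" if i: "i < DIM('a)" for i
  proof (cases "i = j")
    case True
    then have "(\<lambda>v. l (vs[j := v] ! i) * \<phi> (vs[j := v, i := h])) = (\<lambda>v. l v * \<phi> (vs[j := h]))"
      using i len by simp
    then show ?thesis
      using l by (simp add: linear_iff algebra_simps)
  next
    case F: False
    have "linear (\<lambda>v. \<phi> (vs[i := h, j := v]))" using covector_linear[OF c, of "vs[i := h]"] len j by simp
    then show ?thesis
      unfolding list_update_swap[OF F[symmetric]]
      using F i len by (simp add: linear_iff algebra_simps)
  qed
  have lin: "linear g" unfolding g_def by (rule linear_compose_sum) (use summand in auto)
  have "g (vs ! m) = 0" if m: "m < DIM('a)" "m \<noteq> j" for m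
  proof -
    let ?w = "vs[j := vs ! m]"
    \<comment> \<open>The entries \<open>j\<close> and \<open>m\<close> of \<open>?w\<close>
      coincide, so only the summands that overwrite one of them survive, and these two cancel by a
      swap.\<close>
    have "l (?w ! i) * \<phi> (?w[i := h]) = 0" if "i < DIM('a)" "i \<notin> {j, m}" for i
      using covector_equal_entries[OF c, of j "?w[i := h]" m] that m j len by auto
    then have "g (vs ! m) = (\<Sum>i\<in>{j, m}. l (?w ! i) * \<phi> (?w[i := h]))"
      unfolding g_def by (intro sum.mono_neutral_right) (use m j in auto)
    also have "\<dots> = l (vs ! m) * (\<phi> (?w[j := h]) + \<phi> (?w[m := h]))"
      using m j len by (simp add: algebra_simps)
    also have "\<phi> (?w[m := h]) = - \<phi> (?w[j := h])"
      using covector_swap[OF c, of "?w[j := h]" j m] m j len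
      by (simp add: list_update_swap[of j m])
    finally show ?thesis by simp
  qed
  then have "g (vs ! j) = 0"
    using linear_eq_0_on_span[OF lin _ j(2)] by auto
  moreover have "\<phi> vs = 0"
  proof -
    have "linear (\<lambda>v. \<phi> (vs[j := v]))" using covector_linear[OF c len j(1)] .
    moreover have "\<phi> (vs[j := vs ! m]) = 0" if "m < DIM('a)" "m \<noteq> j" for m
      using covector_equal_entries[OF c, of j "vs[j := vs ! m]" m] that j len by auto
    ultimately have "\<phi> (vs[j := vs ! j]) = 0"
      by (intro linear_eq_0_on_span[of "\<lambda>v. \<phi> (vs[j := v])", OF _ _ j(2)]) auto
    then show ?thesis by simp
  qed
  ultimately show ?thesis by (simp add: g_def)
qed

lemma covector_contract:
  assumes c: "covector (Suc m) \<phi>"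
  shows "covector m (\<lambda>vs. \<phi> (h # vs))"
  unfolding covector_def
proof (intro conjI allI impI)
  show "\<phi> (h # vs) = 0" if "length vs \<noteq> m" for vs
    using covector_wrong_length[OF c] that by simp
  show "linear (\<lambda>v. \<phi> (h # vs[i := v]))" if "length vs = m" "i < m" for vs i
    using covector_linear[OF c, of "h # vs" "Suc i"] that by simp
  show "\<phi> (h # vs) = 0" if "length vs = m" "i < m" "j < m" "i \<noteq> j" "vs ! i = vs ! j" for vs i j
    using covector_equal_entries[OF c, of "Suc i" "h # vs" "Suc j"] that by simp
qed

text \<open>Moving \<open>h\<close> into slot \<open>i\<close> cancels the sign of the
  \<open>i\<close>-th summand, and what is left is the sum in Cramer's rule for the derivative of
  \<open>g\<close>. This is Cartan's formula for a constant vector field: a top-degree form is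
  closed, so the exterior derivative of its contraction is its Lie derivative.\<close>

lemma ext_deriv_contract:
  fixes \<phi> :: "'a::euclidean_space list \<Rightarrow> real"
  assumes c: "covector DIM('a) \<phi>" and g: "g differentiable (at x)"
  shows "ext_deriv (\<lambda>x vs. g x * \<phi> (h # vs)) x vs = frechet_derivative g (at x) h * \<phi> vs"
proof -
  let ?g' = "frechet_derivative g (at x)"
  have deriv: "frechet_derivative (\<lambda>y. g y * k) (at x) = (\<lambda>u. ?g' u * k)" for k
    by (rule frechet_derivative_at[symmetric])
      (use g in \<open>auto intro!: derivative_eq_intros simp: frechet_derivative_works[symmetric]\<close>)
  have lin: "linear ?g'" using g by (rule linear_frechet_derivative)
  show ?thesis
  proof (cases "length vs = DIM('a)")
    case True
    have "\<phi> (h # take i vs @ drop (Suc i) vs) = (-1) ^ i * \<phi> (vs[i := h])" if "i < DIM('a)" for i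
      using covector_move_to_front[OF c, of "take i vs" "drop (Suc i) vs" h] that True
      by (simp add: upd_conv_take_nth_drop)
    then have "ext_deriv (\<lambda>x vs. g x * \<phi> (h # vs)) x vs =
        (\<Sum>i<DIM('a). (-1) ^ i * (?g' (vs ! i) * ((-1) ^ i * \<phi> (vs[i := h]))))"
      unfolding ext_deriv_def deriv True by (intro sum.cong) auto
    also have "\<dots> = (\<Sum>i<DIM('a). ?g' (vs ! i) * \<phi> (vs[i := h]))"
      by (intro sum.cong) (auto simp: power_add[symmetric] mult.left_commute)
    finally show ?thesis using covector_cramer[OF c True lin] by simp
  next
    case False
    then have "\<phi> (h # take i vs @ drop (Suc i) vs) = 0" if "i < length vs" for i
      using that by (intro covector_wrong_length[OF c]) auto
    then show ?thesis
      unfolding ext_deriv_def deriv using covector_wrong_length[OF c False] by simp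
  qed
qed

section \<open>The determinant as a top-degree covector\<close>

definition list_index :: "'n::{finite,linorder} \<Rightarrow> nat" where
  "list_index = inv_into {..<CARD('n)} ((!) (sorted_list_of_set UNIV))"

lemma bij_betw_sorted_nth:
  "bij_betw ((!) (sorted_list_of_set (UNIV :: 'n::{finite,linorder} set))) {..<CARD('n)} UNIV"
  by (rule bij_betw_nth) auto

lemma nth_list_index [simp]:
  "sorted_list_of_set UNIV ! list_index i = (i :: 'n::{finite,linorder})"
  using bij_betw_inv_into_right[OF bij_betw_sorted_nth, of i] by (simp add: list_index_def)

lemma list_index_nth [simp]:
  "k < CARD('n) \<Longrightarrow> list_index (sorted_list_of_set UNIV ! k :: 'n::{finite,linorder}) = k"
  using bij_betw_inv_into_left[OF bij_betw_sorted_nth, of k] by (simp add: list_index_def)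

lemma list_index_less [simp]: "list_index (i :: 'n::{finite,linorder}) < CARD('n)"
  using bij_betw_inv_into[OF bij_betw_sorted_nth[where 'n='n]]
  by (auto simp: list_index_def bij_betw_def)

text \<open>The volume form on the ordered coordinates: the list supplies the rows of the matrix, in
  increasing order of the index type. The value 0 on other lengths is what \<open>covector\<close>
  demands.\<close>

definition det_form :: "(real ^ 'n::{finite,linorder}) list \<Rightarrow> real" where
  "det_form vs = (if length vs = CARD('n) then det (\<chi> i. vs ! list_index i) else 0)"

lemma covector_det_form: "covector CARD('n) (det_form :: (real ^ 'n::{finite,linorder}) list \<Rightarrow> real)"
  unfolding covector_def
proof (intro conjI allI impI)
  fix vs :: "(real, 'n) vec list" and k
  assume len: "length vs = CARD('n)" and k: "k < CARD('n)"
  let ?k = "sorted_list_of_set UNIV ! k :: 'n"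
  have row: "(vs[k := v]) ! list_index i = (if i = ?k then v else vs ! list_index i)" for v i
  proof (cases "i = ?k")
    case False
    then have "k \<noteq> list_index i" using nth_list_index[of i] by auto
    then show ?thesis using False by simp
  qed (use k len in simp)
  show "linear (\<lambda>v. det_form (vs[k := v]))"
    by (rule linearI)
      (simp_all add: det_form_def len row det_row_add det_row_mul scalar_mult_eq_scaleR[symmetric])
next
  fix vs :: "(real, 'n) vec list" and i j
  assume *: "length vs = CARD('n)" "i < CARD('n)" "j < CARD('n)" "i \<noteq> j" "vs ! i = vs ! j"
  let ?i = "sorted_list_of_set UNIV ! i :: 'n" and ?j = "sorted_list_of_set UNIV ! j :: 'n"
  have "?i \<noteq> ?j" using * list_index_nth by metis
  then have "det (\<chi> i. vs ! list_index i) = 0"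
    by (rule det_identical_rows) (use * in \<open>simp add: row_def\<close>)
  then show "det_form vs = 0" by (simp add: det_form_def)
qed (auto simp: det_form_def)

lemma length_std_basis [simp]: "length (std_basis :: (real ^ 'n::{finite,linorder}) list) = CARD('n)"
  by (simp add: std_basis_def)

lemma det_form_std_basis [simp]: "det_form (std_basis :: (real ^ 'n::{finite,linorder}) list) = 1"
proof -
  have "(\<chi> i. std_basis ! list_index i) = (mat 1 :: ((real, 'n) vec, 'n) vec)"
    by (simp add: std_basis_def vec_eq_iff mat_def axis_def)
  then show ?thesis by (simp add: det_form_def)
qed

text \<open>Leibniz expansion: one summand per permutation, each a product of entries of modulus at
  most 1. All factors \<open>fact CARD('n)\<close> below originate here.\<close>

lemma abs_det_form_le:
  fixes vs :: "(real ^ 'n::{finite,linorder}) list"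
  assumes "\<And>v. v \<in> set vs \<Longrightarrow> norm v \<le> 1"
  shows "\<bar>det_form vs\<bar> \<le> fact CARD('n)"
proof (cases "length vs = CARD('n)")
  case True
  let ?A = "(\<chi> i. vs ! list_index i) :: ((real, 'n) vec, 'n) vec"
  have entry: "\<bar>?A $ i $ j\<bar> \<le> 1" for i j
    using component_le_norm_cart[of "vs ! list_index i" j] assms[of "vs ! list_index i"] True
    by (simp add: order_trans)
  have "\<bar>det ?A\<bar> \<le> (\<Sum>p | p permutes (UNIV :: 'n set). \<bar>of_int (sign p) * (\<Prod>i\<in>UNIV. ?A $ i $ p i)\<bar>)"
    unfolding det_def by (rule sum_abs)
  also have "\<dots> \<le> (\<Sum>p | p permutes (UNIV :: 'n set). 1)"
    by (intro sum_mono) (auto simp: abs_mult abs_prod sign_def intro!: prod_le_1 entry[simplified])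
  also have "\<dots> = fact CARD('n)" by (simp add: card_permutations[OF refl])
  finally show ?thesis by (simp add: det_form_def True)
qed (simp add: det_form_def)

lemma orthonormal_list_norm: "orthonormal_list vs \<Longrightarrow> v \<in> set vs \<Longrightarrow> norm v = 1"
  unfolding orthonormal_list_def by (metis in_set_conv_nth norm_eq_1)

lemma abs_det_form_contract_le:
  fixes vs :: "(real ^ 'n::{finite,linorder}) list"
  assumes "orthonormal_list vs"
  shows "\<bar>det_form (h # vs)\<bar> \<le> fact CARD('n) * norm h"
proof (cases "length (h # vs) = CARD('n)")
  case True
  have lin: "linear (\<lambda>v. det_form (v # vs))"
    using covector_linear[OF covector_det_form True, of 0] by simp
  have "det_form (h # vs) = norm h * det_form ((h /\<^sub>R norm h) # vs)"
    using linear_cmul[OF lin, of "norm h" "h /\<^sub>R norm h"] linear_0[OF lin]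
    by (cases "h = 0") auto
  moreover have "\<bar>det_form ((h /\<^sub>R norm h) # vs)\<bar> \<le> fact CARD('n)"
    by (rule abs_det_form_le) (auto simp: orthonormal_list_norm[OF assms] divide_simps)
  ultimately show ?thesis by (simp add: abs_mult mult_left_mono mult.commute)
qed (use covector_wrong_length[OF covector_det_form, of "h # vs"] in auto)

section \<open>Forms, comass and translation of top-dimensional currents\<close>

lemma smooth_formsD:
  assumes "\<omega> \<in> smooth_forms m"
  shows "covector m (\<omega> x)" "smooth (\<lambda>x. \<omega> x vs)"
  using assms unfolding smooth_forms_def by auto

lemma covector_scale: "covector m \<phi> \<Longrightarrow> covector m (\<lambda>vs. k * \<phi> vs)"
  unfolding covector_def linear_iff by (simp add: algebra_simps)

lemma smooth_forms_product:
  "smooth g \<Longrightarrow> covector m \<phi> \<Longrightarrow> (\<lambda>x vs. g x * \<phi> vs) \<in> smooth_forms m"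
  unfolding smooth_forms_def by (auto intro: covector_scale smooth_mult smooth_const)

lemma smooth_forms_scale: "\<omega> \<in> smooth_forms m \<Longrightarrow> (\<lambda>x vs. k * \<omega> x vs) \<in> smooth_forms m"
  unfolding smooth_forms_def by (auto intro: covector_scale smooth_mult smooth_const)

section \<open>Comass and mass estimates\<close>

lemma form_norm_leI:
  assumes "\<And>x vs. orthonormal_list vs \<Longrightarrow> \<bar>\<omega> x vs\<bar> \<le> c"
  shows "form_norm \<omega> \<le> ennreal c"
  unfolding form_norm_def comass_def by (intro SUP_least ennreal_leI) (use assms in auto)

lemma form_norm_leD:
  assumes "form_norm \<omega> \<le> ennreal c" "orthonormal_list vs" "0 \<le> c"
  shows "\<bar>\<omega> x vs\<bar> \<le> c"
proof -
  have "ennreal \<bar>\<omega> x vs\<bar> \<le> comass (\<omega> x)"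
    unfolding comass_def by (rule SUP_upper) (use assms in auto)
  also have "\<dots> \<le> form_norm \<omega>" unfolding form_norm_def by (rule SUP_upper) auto
  finally show ?thesis using assms by (meson ennreal_le_iff order_trans)
qed

lemma orthonormal_list_length_le:
  fixes vs :: "'a::euclidean_space list"
  assumes "orthonormal_list vs"
  shows "length vs \<le> DIM('a)"
proof -
  have nth: "vs ! i \<bullet> vs ! j = (if i = j then 1 else 0)" if "i < length vs" "j < length vs" for i j
    using assms that unfolding orthonormal_list_def by blast
  have dist: "distinct vs"
    unfolding distinct_conv_nth using nth by (metis zero_neq_one)
  have "pairwise orthogonal (set vs)"
    unfolding pairwise_def orthogonal_def using nth by (metis in_set_conv_nth)
  moreover have "0 \<notin> set vs" using orthonormal_list_norm[OF assms] by fastforce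
  ultimately have "independent (set vs)" by (rule pairwise_orthogonal_independent)
  then show ?thesis using independent_bound distinct_card[OF dist] by metis
qed

text \<open>The comass sees only orthonormal lists, and these have at most \<open>DIM('a)\<close>
  entries. On such a list \<open>ext_deriv\<close> evaluates the form at shorter lists, where a
  top-degree covector is zero, so the constraint on the exterior derivative is void.\<close>

lemma flat_norm_top:
  fixes T :: "'a::euclidean_space current"
  shows "flat_norm DIM('a) T = mass DIM('a) T"
proof -
  have "form_norm (ext_deriv \<omega>) = 0" if w: "\<omega> \<in> smooth_forms DIM('a)" for \<omega> :: "'a form"
  proof -
    have "form_norm (ext_deriv \<omega>) \<le> ennreal 0"
    proof (rule form_norm_leI)
      fix x and vs :: "'a list" assume o: "orthonormal_list vs"
      have "\<omega> y (take i vs @ drop (Suc i) vs) = 0" if "i < length vs" for i y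
        using orthonormal_list_length_le[OF o] that
        by (intro covector_wrong_length[OF smooth_formsD(1)[OF w]]) auto
      then show "\<bar>ext_deriv \<omega> x vs\<bar> \<le> 0"
        unfolding ext_deriv_def by simp
    qed
    then show ?thesis by simp
  qed
  then have "{\<omega> \<in> smooth_forms DIM('a). max (form_norm \<omega>) (form_norm (ext_deriv \<omega>)) \<le> 1}
      = {\<omega> \<in> smooth_forms DIM('a) :: 'a form set. form_norm \<omega> \<le> 1}"
    by auto
  then show ?thesis unfolding flat_norm_def mass_def by auto
qed

lemma mass_leI:
  assumes "\<And>\<omega>. \<omega> \<in> smooth_forms m \<Longrightarrow> (\<And>x vs. orthonormal_list vs \<Longrightarrow> \<bar>\<omega> x vs\<bar> \<le> 1) \<Longrightarrow> T \<omega> \<le> c"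
  shows "mass m T \<le> ennreal c"
  unfolding mass_def
proof (intro SUP_least ennreal_leI)
  fix \<omega> :: "'a form" assume w: "\<omega> \<in> {\<omega> \<in> smooth_forms m. form_norm \<omega> \<le> 1}"
  show "T \<omega> \<le> c"
    by (rule assms) (use w form_norm_leD[of \<omega> 1] in auto)
qed

text \<open>Scaling the form by \<open>1 / c\<close> and by \<open>- 1 / c\<close> brings it into
  the unit comass ball, and the two signs give the absolute value. Homogeneity is asked for at this
  one form, so that boundaries and remainders of series are covered. Finiteness matters because
  \<open>enn2real\<close> sends infinity to 0.\<close>

lemma mass_bound:
  assumes w: "\<omega> \<in> smooth_forms m" and hom: "\<And>k. T (\<lambda>x vs. k * \<omega> x vs) = k * T \<omega>"
    and fin: "mass m T < \<infinity>"
    and bound: "\<And>x vs. orthonormal_list vs \<Longrightarrow> \<bar>\<omega> x vs\<bar> \<le> c" and c: "0 < c"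
  shows "\<bar>T \<omega>\<bar> \<le> c * enn2real (mass m T)"
proof -
  have *: "k * T \<omega> \<le> enn2real (mass m T)" if k: "\<bar>k\<bar> = 1 / c" for k
  proof -
    have "\<bar>k * \<omega> x vs\<bar> \<le> 1" if "orthonormal_list vs" for x vs
      using mult_left_mono[OF bound[OF that, of x], of "\<bar>k\<bar>"] c k by (simp add: abs_mult)
    then have "form_norm (\<lambda>x vs. k * \<omega> x vs) \<le> 1"
      using form_norm_leI[of "\<lambda>x vs. k * \<omega> x vs" 1] by simp
    then have "ennreal (T (\<lambda>x vs. k * \<omega> x vs)) \<le> mass m T"
      unfolding mass_def by (intro SUP_upper) (use smooth_forms_scale[OF w] in auto)
    also have "\<dots> = ennreal (enn2real (mass m T))" using fin by simp
    finally show ?thesis unfolding hom by (simp add: ennreal_le_iff)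
  qed
  from *[of "1 / c"] *[of "- 1 / c"] c show ?thesis by (simp add: divide_simps abs_le_iff mult.commute)
qed

lemma orthonormal_std_basis:
  "orthonormal_list (std_basis :: (real ^ 'n::{finite,linorder}) list)"
proof -
  have "sorted_list_of_set (UNIV :: 'n set) ! i = sorted_list_of_set UNIV ! j \<longleftrightarrow> i = j"
    if "i < CARD('n)" "j < CARD('n)" for i j
    using list_index_nth[of i] list_index_nth[of j] that by metis
  then show ?thesis
    unfolding orthonormal_list_def by (simp add: std_basis_def inner_axis_axis)
qed

lemma orthonormal_list_remove:
  assumes "orthonormal_list vs"
  shows "orthonormal_list (take k vs @ drop (Suc k) vs)"
proof (cases "k < length vs")
  case True
  have "(take k vs @ drop (Suc k) vs) ! i = vs ! (if i < k then i else Suc i)"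
    if "i < length vs - 1" for i
    using that True by (auto simp: nth_append min_def)
  then show ?thesis
    using assms True unfolding orthonormal_list_def by (auto simp: min_def)
qed (use assms in simp)

text \<open>For a top-dimensional current the translation difference of a form is exact, with the
  contraction of the form by \<open>h\<close>, averaged over the segment from \<open>x\<close> to \<open>x + h\<close>, as primitive.\<close>

lemma normal_current_translation_bound:
  fixes S :: "(real ^ 'n::{finite,linorder}) current"
  assumes S: "normal_current CARD('n) S" and f: "smooth f" and f1: "\<And>x. \<bar>f x\<bar> \<le> 1"
  shows "\<bar>S (\<lambda>x vs. f (x + h) * det_form vs) - S (\<lambda>x vs. f x * det_form vs)\<bar>
     \<le> fact CARD('n) * min (2 * enn2real (mass CARD('n) S))
          (norm h * enn2real (mass (CARD('n) - 1) (boundary S)))"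
proof -
  let ?d = "CARD('n)"
  have cur: "current ?d S" and mass: "mass ?d S < \<infinity>" and bmass: "mass (?d - 1) (boundary S) < \<infinity>"
    using S unfolding normal_current_def normal_mass_def by (auto simp: less_top)
  have hom: "S (\<lambda>x vs. k * \<omega> x vs) = k * S \<omega>" if "\<omega> \<in> smooth_forms ?d" for k \<omega>
    using cur that unfolding current_def by blast
  have add: "S (\<lambda>x vs. \<omega> x vs + \<eta> x vs) = S \<omega> + S \<eta>" if "\<omega> \<in> smooth_forms ?d" "\<eta> \<in> smooth_forms ?d" for \<omega> \<eta>
    using cur that unfolding current_def by blast
  define top :: "((real, 'n) vec \<Rightarrow> real) \<Rightarrow> (real, 'n) vec form"
    where "top g = (\<lambda>x vs. g x * det_form vs)" for g
  have top: "top g \<in> smooth_forms ?d" if "smooth g" for g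
    unfolding top_def using that covector_det_form by (rule smooth_forms_product)
  have top_bound: "\<bar>S (top g)\<bar> \<le> fact ?d * enn2real (mass ?d S)"
    if g: "smooth g" and g1: "\<And>x. \<bar>g x\<bar> \<le> 1" for g
  proof (rule mass_bound[OF top[OF g] hom[OF top[OF g]] mass])
    fix x and vs :: "(real, 'n) vec list" assume "orthonormal_list vs"
    then have "\<bar>det_form vs\<bar> \<le> fact ?d"
      by (intro abs_det_form_le) (simp add: orthonormal_list_norm)
    then show "\<bar>top g x vs\<bar> \<le> fact ?d"
      using mult_mono[OF g1[of x], of "\<bar>det_form vs\<bar>" "fact ?d"] by (simp add: top_def abs_mult)
  qed simp
  define fh where "fh x = f (x + h)" for x
  have fh: "smooth fh" unfolding fh_def by (rule smooth_translate[OF f])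
  have "\<bar>S (top fh) - S (top f)\<bar> \<le> \<bar>S (top fh)\<bar> + \<bar>S (top f)\<bar>" by (rule abs_triangle_ineq4)
  also have "\<dots> \<le> fact ?d * (2 * enn2real (mass ?d S))"
    using top_bound[OF fh] top_bound[OF f f1] f1 by (simp add: fh_def)
  finally have bound1: "\<bar>S (top fh) - S (top f)\<bar> \<le> fact ?d * (2 * enn2real (mass ?d S))" .
  have bound2: "\<bar>S (top fh) - S (top f)\<bar> \<le> fact ?d * (norm h * enn2real (mass (?d - 1) (boundary S)))"
  \<comment> \<open>\<open>mass_bound\<close> wants a positive comass bound, here
    \<open>fact ?d * norm h\<close>.\<close>
  proof (cases "h = 0")
    case True
    then have "fh = f" by (simp add: fh_def fun_eq_iff)
    then show ?thesis by simp
  next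
    case False
    define g where "g x = integral {0..1} (\<lambda>t. f (x + t *\<^sub>R h))" for x
    have g: "smooth g" unfolding g_def by (rule smooth_segment_integral[OF f])
    define \<eta> where "\<eta> = (\<lambda>x vs. g x * det_form (h # vs))"
    have "covector (?d - 1) (\<lambda>vs. det_form (h # vs))"
      by (rule covector_contract) (use covector_det_form in simp)
    then have eta: "\<eta> \<in> smooth_forms (?d - 1)"
      unfolding \<eta>_def by (rule smooth_forms_product[OF g])
    define \<delta> where "\<delta> x = fh x + (-1) * f x" for x
    have dsm: "smooth \<delta>" unfolding \<delta>_def by (intro smooth_add fh smooth_mult smooth_const f)
    have dtop: "S (top \<delta>) = S (top fh) - S (top f)"
    proof -
      have "top \<delta> = (\<lambda>x vs. top fh x vs + (-1) * top f x vs)"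
        by (simp add: top_def \<delta>_def algebra_simps)
      moreover have "S (\<lambda>x vs. top fh x vs + (-1) * top f x vs) = S (top fh) + (-1) * S (top f)"
        using add[OF top[OF fh] smooth_forms_scale[OF top[OF f], of "-1"]] hom[OF top[OF f], of "-1"]
        by simp
      ultimately show ?thesis by simp
    qed
    have "frechet_derivative g (at x) h = \<delta> x" for x
      unfolding g_def \<delta>_def fh_def using segment_integral_deriv_direction[OF f] by simp
    \<comment> \<open>A scalar \<open>k\<close> is carried along in order to obtain the homogeneity
      of \<open>boundary S\<close> at \<open>\<eta>\<close>, which \<open>mass_bound\<close> asks
      for: it comes from that of \<open>S\<close> at the top-degree form
      \<open>top \<delta>\<close>.\<close>
    moreover have "frechet_derivative (\<lambda>x. k * g x) (at x) h = k * frechet_derivative g (at x) h" for k x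
      by (subst frechet_derivative_at[of _ "\<lambda>u. k * frechet_derivative g (at x) u", symmetric])
         (auto intro!: derivative_eq_intros smooth_has_derivative g)
    moreover have "smooth (\<lambda>x. k * g x)" for k by (intro smooth_mult smooth_const g)
    ultimately have ext: "ext_deriv (\<lambda>x vs. (k * g x) * det_form (h # vs)) x vs = k * top \<delta> x vs" for k x vs
      using ext_deriv_contract[of det_form "\<lambda>x. k * g x" x h vs] covector_det_form[where 'n='n]
      by (simp add: smooth_differentiable[OF g] top_def mult.assoc)
    then have "ext_deriv (\<lambda>x vs. (k * g x) * det_form (h # vs)) = (\<lambda>x vs. k * top \<delta> x vs)" for k
      by (simp add: fun_eq_iff)
    then have bd: "boundary S (\<lambda>x vs. k * \<eta> x vs) = k * S (top \<delta>)" for k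
      using hom[OF top[OF dsm]] by (simp add: boundary_def \<eta>_def mult.assoc)
    have bd1: "boundary S \<eta> = S (top \<delta>)" using bd[of 1] by simp
    have "\<bar>boundary S \<eta>\<bar> \<le> (fact ?d * norm h) * enn2real (mass (?d - 1) (boundary S))"
    proof (rule mass_bound[OF eta _ bmass])
      show "boundary S (\<lambda>x vs. k * \<eta> x vs) = k * boundary S \<eta>" for k by (simp add: bd bd1)
      fix x and vs :: "(real, 'n) vec list" assume o: "orthonormal_list vs"
      have cont: "continuous_on {0..1} (\<lambda>t. f (x + t *\<^sub>R h))"
        by (rule continuous_on_compose2[OF smooth_continuous_on[OF f]]) (auto intro!: continuous_intros)
      have "norm (g x) \<le> integral {0..1 :: real} (\<lambda>t. 1 :: real)"
        unfolding g_def
        by (rule Henstock_Kurzweil_Integration.integral_norm_bound_integral)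
           (use f1 integrable_continuous_interval[OF cont] in auto)
      then show "\<bar>\<eta> x vs\<bar> \<le> fact ?d * norm h"
        using mult_mono[of "\<bar>g x\<bar>" 1 "\<bar>det_form (h # vs)\<bar>" "fact ?d * norm h"]
          abs_det_form_contract_le[OF o, of h]
        by (simp add: \<eta>_def abs_mult)
    qed (use False in simp)
    then show ?thesis unfolding bd1 dtop by (simp add: mult.assoc)
  qed
  show ?thesis using bound1 bound2 by (simp add: top_def fh_def min_def)
qed

section \<open>Translation differences and the Sobolev seminorm\<close>

lemma nn_integral_lborel_affine:
  fixes f :: "'a::euclidean_space \<Rightarrow> ennreal"
  assumes [measurable]: "f \<in> borel_measurable borel" and c: "c \<noteq> 0"
  shows "(\<integral>\<^sup>+x. f x \<partial>lborel) = ennreal (\<bar>c\<bar> ^ DIM('a)) * (\<integral>\<^sup>+x. f (t + c *\<^sub>R x) \<partial>lborel)"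
  by (subst lborel_affine[OF c, of t])
     (simp add: nn_integral_density nn_integral_distr nn_integral_cmult)

lemma lborel_distr_translate: "distr lborel borel (\<lambda>x. x + h) = (lborel :: 'a::euclidean_space measure)"
  using lborel_distr_plus[of h] unfolding add.commute[of h] .

lemma integral_lborel_translate:
  fixes f :: "'a::euclidean_space \<Rightarrow> real"
  assumes [measurable]: "f \<in> borel_measurable borel"
  shows "(\<integral>x. f (x + h) \<partial>lborel) = (\<integral>x. f x \<partial>lborel)"
  using integral_distr[of "\<lambda>x. x + h" lborel borel f] by (simp add: lborel_distr_translate)

lemma integrable_lborel_translate:
  fixes f :: "'a::euclidean_space \<Rightarrow> real"
  assumes [measurable]: "f \<in> borel_measurable borel" and "integrable lborel f"
  shows "integrable lborel (\<lambda>x. f (x + h))"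
  using integrable_distr_eq[of "\<lambda>x. x + h" lborel borel f] assms by (simp add: lborel_distr_translate)

section \<open>Recovering an L1 norm from smooth test functions\<close>

lemma abs_sin_diff_le: "\<bar>sin x - sin y\<bar> \<le> \<bar>x - y\<bar>" for x y :: real
proof -
  have "\<bar>sin x - sin y\<bar> = 2 * (\<bar>sin ((x - y) / 2)\<bar> * \<bar>cos ((x + y) / 2)\<bar>)"
    by (simp add: sin_diff_sin abs_mult)
  also have "\<dots> \<le> 2 * (\<bar>(x - y) / 2\<bar> * 1)"
    by (intro mult_left_mono mult_mono abs_sin_x_le_abs_x) auto
  finally show ?thesis by simp
qed

text \<open>Approximating \<open>arcsin \<circ> g\<close> by a polynomial \<open>p\<close> makes \<open>sin \<circ> p\<close> smooth, close to \<open>g\<close> on \<open>K\<close>, and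
  bounded by \<open>1\<close> on the whole space.\<close>

lemma smooth_unit_approximation:
  fixes g :: "'a::euclidean_space \<Rightarrow> real"
  assumes K: "compact K" and g: "continuous_on K g" "\<And>x. \<bar>g x\<bar> \<le> 1" and e: "0 < e"
  shows "\<exists>f. smooth f \<and> (\<forall>x. \<bar>f x\<bar> \<le> 1) \<and> (\<forall>x\<in>K. \<bar>f x - g x\<bar> < e)"
proof -
  have "continuous_on K (\<lambda>x. arcsin (g x))"
    by (intro continuous_on_arcsin g) (use g(2) in \<open>auto simp: abs_le_iff minus_le_iff\<close>)
  then obtain p where p: "real_polynomial_function p" "\<And>x. x \<in> K \<Longrightarrow> \<bar>arcsin (g x) - p x\<bar> < e"
    using Stone_Weierstrass_real_polynomial_function[OF K _ e] by metis
  have "\<bar>sin (p x) - g x\<bar> < e" if "x \<in> K" for x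
  proof -
    have "g x = sin (arcsin (g x))" using g(2)[of x] by (simp add: abs_le_iff)
    then have "\<bar>sin (p x) - g x\<bar> \<le> \<bar>arcsin (g x) - p x\<bar>"
      using abs_sin_diff_le[of "p x" "arcsin (g x)"] by (simp add: abs_minus_commute)
    then show ?thesis using p(2)[OF that] by linarith
  qed
  then show ?thesis
    using smooth_sin[OF smooth_real_polynomial_function[OF p(1)]] by (intro exI[of _ "\<lambda>x. sin (p x)"]) auto
qed

text \<open>The optimal test function is \<open>sgn \<circ> w\<close>. Being measurable, it is
  almost everywhere a limit of continuous functions, and these are replaced by smooth ones bounded
  by 1; dominated convergence with majorant \<open>\<bar>w\<bar>\<close> passes to the
  limit.\<close>

lemma integral_abs_le_smooth_dual:
  fixes w :: "'a::euclidean_space \<Rightarrow> real"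
  assumes w [measurable]: "w \<in> borel_measurable borel" and int: "integrable lborel w"
    and bound: "\<And>f. smooth f \<Longrightarrow> (\<And>x. \<bar>f x\<bar> \<le> 1) \<Longrightarrow> (\<integral>x. w x * f x \<partial>lborel) \<le> c"
  shows "(\<integral>x. \<bar>w x\<bar> \<partial>lborel) \<le> c"
proof -
  have "(\<lambda>x. sgn (w x)) \<in> borel_measurable lborel" by measurable
  then have "(\<lambda>x. sgn (w x)) \<in> borel_measurable lebesgue" by (rule measurable_completion)
  then have "(\<lambda>x. sgn (w x)) measurable_on UNIV"
    by (simp add: lebesgue_measurable_imp_measurable_on)
  then obtain N g where N: "negligible N" and g: "\<And>n. continuous_on UNIV (g n)"
    and lim: "\<And>x. x \<notin> N \<Longrightarrow> (\<lambda>n. g n x) \<longlonglongrightarrow> sgn (w x)"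
    unfolding measurable_on_def by auto
  \<comment> \<open>Clipping to the interval from -1 to 1 does not disturb a limit that lies in it.
    The smooth approximation is close only on the ball of radius \<open>n\<close>, which eventually
    contains any given point.\<close>
  define c' where "c' n x = max (-1) (min 1 (g n x))" for n x
  have "\<exists>f. smooth f \<and> (\<forall>x. \<bar>f x\<bar> \<le> 1) \<and> (\<forall>x\<in>cball 0 (real n). \<bar>f x - c' n x\<bar> < 1 / real (Suc n))" for n
    unfolding c'_def
    by (intro smooth_unit_approximation continuous_intros continuous_on_subset[OF g]) auto
  then obtain f where f: "\<And>n. smooth (f n)" "\<And>n x. \<bar>f n x\<bar> \<le> 1"
    and close: "\<And>n x. x \<in> cball 0 (real n) \<Longrightarrow> \<bar>f n x - c' n x\<bar> < 1 / real (Suc n)"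
    by metis
  have flim: "(\<lambda>n. f n x) \<longlonglongrightarrow> sgn (w x)" if "x \<notin> N" for x
  proof -
    have "(\<lambda>n. c' n x) \<longlonglongrightarrow> max (-1) (min 1 (sgn (w x)))"
      unfolding c'_def by (intro tendsto_intros lim that)
    moreover have "max (-1) (min 1 (sgn (w x))) = sgn (w x)" by (simp add: sgn_if)
    moreover have "(\<lambda>n. f n x - c' n x) \<longlonglongrightarrow> 0"
    proof (rule Lim_null_comparison)
      obtain m :: nat where "norm x \<le> real m" using real_arch_simple by blast
      then show "\<forall>\<^sub>F n in sequentially. norm (f n x - c' n x) \<le> 1 / real (Suc n)"
        using close[of x] by (intro eventually_sequentiallyI[of m]) (auto intro: less_imp_le)
      show "(\<lambda>n. 1 / real (Suc n)) \<longlonglongrightarrow> 0" using LIMSEQ_inverse_real_of_nat by (simp add: inverse_eq_divide)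
    qed
    ultimately show ?thesis using tendsto_add by fastforce
  qed
  have "AE x in lborel. x \<notin> N"
    using N by (metis AE_completion_iff AE_not_in negligible_iff_null_sets)
  then have "(\<lambda>n. \<integral>x. w x * f n x \<partial>lborel) \<longlonglongrightarrow> (\<integral>x. w x * sgn (w x) \<partial>lborel)"
  proof (intro integral_dominated_convergence[where w="\<lambda>x. \<bar>w x\<bar>"])
    show "(\<lambda>x. w x * f n x) \<in> borel_measurable lborel" for n
      using smooth_borel_measurable[OF f(1)] by measurable
    show "AE x in lborel. norm (w x * f n x) \<le> \<bar>w x\<bar>" for n
      using f(2) by (auto simp: abs_mult intro!: mult_left_le)
    assume "AE x in lborel. x \<notin> N"
    then show "AE x in lborel. (\<lambda>n. w x * f n x) \<longlonglongrightarrow> w x * sgn (w x)"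
      by eventually_elim (intro tendsto_intros flim)
  qed (use int in auto)
  then have "(\<integral>x. w x * sgn (w x) \<partial>lborel) \<le> c"
    by (rule LIMSEQ_le_const2) (use bound f in auto)
  then show ?thesis by (simp add: abs_sgn)
qed

section \<open>The Sobolev seminorm as an integral over translations\<close>

definition shift_diff :: "('a::euclidean_space \<Rightarrow> real) \<Rightarrow> 'a \<Rightarrow> ennreal" where
  "shift_diff v h = (\<integral>\<^sup>+x. ennreal \<bar>v (x - h) - v x\<bar> \<partial>lborel)"

lemma borel_measurable_shift_diff [measurable]:
  assumes [measurable]: "v \<in> borel_measurable borel"
  shows "shift_diff v \<in> borel_measurable borel"
proof -
  have "(\<lambda>h. \<integral>\<^sup>+x. ennreal \<bar>v (x - h) - v x\<bar> \<partial>lborel) \<in> borel_measurable lborel"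
    by (intro lborel.borel_measurable_nn_integral) measurable
  then show ?thesis unfolding shift_diff_def[abs_def] by simp
qed

text \<open>Substitute \<open>y = x - h\<close> in the inner integral and exchange the integrals.
  The Borel version \<open>v\<close> supplies the joint measurability that Tonelli's theorem
  requires; for almost every \<open>x\<close> replacing \<open>u\<close> by \<open>v\<close> changes
  the inner integrand only on a null set.\<close>

lemma sobolev_norm_eq_shift_diff:
  fixes u v :: "'a::euclidean_space \<Rightarrow> real"
  assumes v [measurable]: "v \<in> borel_measurable borel" and uv: "AE x in lebesgue. u x = v x"
  shows "sobolev_norm \<alpha> u =
    (\<integral>\<^sup>+h. shift_diff v h * ennreal (1 / norm h powr (real DIM('a) + 1 - \<alpha>)) \<partial>lborel)"
proof -
  define s where "s = real DIM('a) + 1 - \<alpha>"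
  have uv': "AE x in lborel. u x = v x" using uv by (simp add: AE_completion_iff)
  have "sobolev_norm \<alpha> u =
      (\<integral>\<^sup>+x. \<integral>\<^sup>+y. ennreal (\<bar>u x - u y\<bar> / norm (x - y) powr s) \<partial>lborel \<partial>lborel)"
    unfolding sobolev_norm_def s_def nn_integral_completion by simp
  also have "\<dots> = (\<integral>\<^sup>+x. \<integral>\<^sup>+y. ennreal (\<bar>v x - v y\<bar> / norm (x - y) powr s) \<partial>lborel \<partial>lborel)"
  proof (rule nn_integral_cong_AE)
    show "AE x in lborel. (\<integral>\<^sup>+y. ennreal (\<bar>u x - u y\<bar> / norm (x - y) powr s) \<partial>lborel) =
        (\<integral>\<^sup>+y. ennreal (\<bar>v x - v y\<bar> / norm (x - y) powr s) \<partial>lborel)"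
      using uv'
    proof eventually_elim
      case (elim x)
      show ?case
        by (rule nn_integral_cong_AE) (use uv' in eventually_elim, simp add: elim)
    qed
  qed
  also have "\<dots> = (\<integral>\<^sup>+x. \<integral>\<^sup>+h. ennreal (\<bar>v (x - h) - v x\<bar> / norm h powr s) \<partial>lborel \<partial>lborel)"
  proof (rule nn_integral_cong)
    fix x :: 'a
    show "(\<integral>\<^sup>+y. ennreal (\<bar>v x - v y\<bar> / norm (x - y) powr s) \<partial>lborel) =
        (\<integral>\<^sup>+h. ennreal (\<bar>v (x - h) - v x\<bar> / norm h powr s) \<partial>lborel)"
      by (subst nn_integral_lborel_affine[where c="-1" and t=x]) (simp_all add: abs_minus_commute)
  qed
  also have "\<dots> = (\<integral>\<^sup>+h. \<integral>\<^sup>+x. ennreal (\<bar>v (x - h) - v x\<bar> / norm h powr s) \<partial>lborel \<partial>lborel)"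
    by (rule lborel_pair.Fubini') measurable
  also have "\<dots> = (\<integral>\<^sup>+h. shift_diff v h * ennreal (1 / norm h powr s) \<partial>lborel)"
  proof (rule nn_integral_cong)
    fix h :: 'a
    have "(\<integral>\<^sup>+x. ennreal (\<bar>v (x - h) - v x\<bar> / norm h powr s) \<partial>lborel)
        = (\<integral>\<^sup>+x. ennreal \<bar>v (x - h) - v x\<bar> * ennreal (1 / norm h powr s) \<partial>lborel)"
      by (intro nn_integral_cong) (simp add: ennreal_mult[symmetric])
    then show "(\<integral>\<^sup>+x. ennreal (\<bar>v (x - h) - v x\<bar> / norm h powr s) \<partial>lborel)
        = shift_diff v h * ennreal (1 / norm h powr s)"
      unfolding shift_diff_def by (simp add: nn_integral_multc)
  qed
  finally show ?thesis by (simp add: s_def)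
qed

section \<open>Finiteness and scaling of the kernel integral\<close>

lemma dyadic_interval:
  assumes "1 \<le> (x :: real)"
  shows "\<exists>j. 2 ^ j \<le> x \<and> x < 2 ^ Suc j"
proof -
  obtain n0 where "x < 2 ^ n0" using real_arch_pow[of 2 x] by auto
  then have least: "x < 2 ^ (LEAST n. x < 2 ^ n)" by (rule LeastI)
  have "(LEAST n. x < 2 ^ n) \<noteq> 0" using least assms by (metis not_le power_0)
  then obtain j where j: "(LEAST n. x < 2 ^ n) = Suc j" using not0_implies_Suc by blast
  have "\<not> x < 2 ^ j" using not_less_Least[of j "\<lambda>n. x < 2 ^ n"] j by simp
  then show ?thesis using least j by (intro exI[of _ j]) auto
qed

text \<open>Near 0 the integrand is of order \<open>\<alpha> - d\<close>, integrable because
  \<open>0 < \<alpha>\<close>; at infinity it is of order \<open>\<alpha> - 1 - d\<close>,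
  integrable because \<open>\<alpha> < 1\<close>. On each dyadic annulus it is dominated by a
  constant on the enclosing ball, \<open>A j\<close> inside the unit ball and \<open>B j\<close>
  outside. The integrals are geometric with ratios \<open>2 powr (- \<alpha>)\<close> and
  \<open>2 powr (\<alpha> - 1)\<close>.\<close>

lemma kernel_integral_finite:
  assumes "0 < \<alpha>" "\<alpha> < 1"
  shows "(\<integral>\<^sup>+h. ennreal (min 2 (norm h) / norm h powr (real DIM('a) + 1 - \<alpha>)) \<partial>(lborel :: 'a::euclidean_space measure)) < \<infinity>"
proof -
  define d where "d = DIM('a)"
  define s where "s = real d + 1 - \<alpha>"
  have "1 \<le> real d" using DIM_positive[where 'a='a] by (simp add: d_def)
  then have s: "1 < s" "s - 1 = real d - \<alpha>" using assms by (auto simp: s_def)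
  define A :: "nat \<Rightarrow> 'a \<Rightarrow> ennreal"
    where "A j h = ennreal ((2 ^ Suc j) powr (s - 1)) * indicator (cball 0 (1 / 2 ^ j)) h" for j h
  define B :: "nat \<Rightarrow> 'a \<Rightarrow> ennreal"
    where "B j h = ennreal (2 * (2 ^ j) powr (- s)) * indicator (cball 0 (2 ^ Suc j)) h" for j h
  have pointwise: "ennreal (min 2 (norm h) / norm h powr s) \<le> (\<Sum>j. A j h + B j h)" for h :: 'a
  proof -
    have "\<exists>j. ennreal (min 2 (norm h) / norm h powr s) \<le> A j h + B j h"
    proof (cases "h = 0")
      case False
      then have h0: "0 < norm h" by simp
      show ?thesis
      proof (cases "norm h \<le> 1")
        case True
        then obtain j where j: "2 ^ j \<le> 1 / norm h" "1 / norm h < 2 ^ Suc j"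
          using dyadic_interval[of "1 / norm h"] h0 by auto
        have "min 2 (norm h) / norm h powr s = norm h powr (1 - s)"
          using True h0 by (simp add: powr_diff)
        also have "\<dots> = (1 / norm h) powr (s - 1)"
          using h0 by (simp add: powr_divide powr_minus_divide[symmetric])
        also have "\<dots> \<le> (2 ^ Suc j) powr (s - 1)"
          using j h0 s by (intro powr_mono2) auto
        finally have "ennreal (min 2 (norm h) / norm h powr s) \<le> ennreal ((2 ^ Suc j) powr (s - 1))"
          by (rule ennreal_leI)
        moreover have "h \<in> cball 0 (1 / 2 ^ j)" using j h0 by (simp add: field_simps)
        ultimately show ?thesis unfolding A_def by (intro exI[of _ j]) (simp add: add_increasing2)
      next
        case False
        then obtain j where j: "2 ^ j \<le> norm h" "norm h < 2 ^ Suc j"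
          using dyadic_interval[of "norm h"] by auto
        have "min 2 (norm h) / norm h powr s \<le> 2 * norm h powr (- s)"
          by (simp add: powr_minus_divide divide_right_mono)
        also have "\<dots> \<le> 2 * (2 ^ j) powr (- s)"
          using j s by (intro mult_left_mono powr_mono2') auto
        finally have "ennreal (min 2 (norm h) / norm h powr s) \<le> ennreal (2 * (2 ^ j) powr (- s))"
          by (rule ennreal_leI)
        moreover have "h \<in> cball 0 (2 ^ Suc j)" using j by simp
        ultimately show ?thesis unfolding B_def by (intro exI[of _ j]) (simp add: add_increasing)
      qed
    qed auto
    then obtain j where "ennreal (min 2 (norm h) / norm h powr s) \<le> A j h + B j h" by blast
    also have "\<dots> \<le> (\<Sum>j. A j h + B j h)"
      using sum_le_suminf[of "\<lambda>j. A j h + B j h" "{j}"] by simp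
    finally show ?thesis .
  qed
  define V where "V = unit_ball_vol (real d)"
  have V: "0 \<le> V" by (simp add: V_def)
  have intA: "(\<integral>\<^sup>+h. A j h \<partial>lborel) = ennreal (V * 2 powr (s - 1) * (2 powr (- \<alpha>)) ^ j)" for j
  proof -
    have "(\<integral>\<^sup>+h. A j h \<partial>lborel) = ennreal ((2 ^ Suc j) powr (s - 1)) * ennreal (V * (1 / 2 ^ j) ^ d)"
      unfolding A_def by (subst nn_integral_cmult_indicator) (auto simp: emeasure_cball V_def d_def)
    also have "\<dots> = ennreal ((2 ^ Suc j) powr (s - 1) * (V * (1 / 2 ^ j) ^ d))"
      using V by (simp add: ennreal_mult)
    also have "(2 ^ Suc j) powr (s - 1) * (V * (1 / 2 ^ j) ^ d) = V * 2 powr (s - 1) * (2 powr (- \<alpha>)) ^ j"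
    proof -
      have "(2 ^ Suc j :: real) powr (s - 1) = 2 powr (s - 1) * 2 powr (real j * (s - 1))"
        by (simp add: powr_powr powr_realpow[symmetric] powr_add[symmetric] powr_mult algebra_simps)
      moreover have "(1 / 2 ^ j :: real) ^ d = 2 powr (- (real j * real d))"
        by (simp add: powr_minus_divide powr_realpow[symmetric] powr_powr power_divide
             power_mult[symmetric] flip: of_nat_mult)
      moreover have "(2 powr (- \<alpha>)) ^ j = (2 :: real) powr (real j * (s - 1)) * 2 powr (- (real j * real d))"
        by (simp add: powr_realpow[symmetric] powr_powr powr_add[symmetric] s(2) algebra_simps)
      ultimately show ?thesis by (simp add: mult_ac)
    qed
    finally show ?thesis .
  qed
  have intB: "(\<integral>\<^sup>+h. B j h \<partial>lborel) = ennreal (V * 2 ^ Suc d * (2 powr (\<alpha> - 1)) ^ j)" for j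
  proof -
    have "(\<integral>\<^sup>+h. B j h \<partial>lborel) = ennreal (2 * (2 ^ j) powr (- s)) * ennreal (V * (2 ^ Suc j) ^ d)"
      unfolding B_def by (subst nn_integral_cmult_indicator) (auto simp: emeasure_cball V_def d_def)
    also have "\<dots> = ennreal (2 * (2 ^ j) powr (- s) * (V * (2 ^ Suc j) ^ d))"
      using V by (simp add: ennreal_mult)
    also have "2 * (2 ^ j) powr (- s) * (V * (2 ^ Suc j) ^ d) = V * 2 ^ Suc d * (2 powr (\<alpha> - 1)) ^ j"
    proof -
      have "(2 ^ Suc j :: real) ^ d = 2 ^ d * 2 powr (real j * real d)"
        by (simp add: power_mult_distrib powr_realpow[symmetric] powr_powr
             power_mult[symmetric] flip: of_nat_mult)
      moreover have "(2 ^ j :: real) powr (- s) = 2 powr (- (real j * s))"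
        by (simp add: powr_realpow[symmetric] powr_powr)
      moreover have "(2 powr (\<alpha> - 1)) ^ j = (2 :: real) powr (- (real j * s)) * 2 powr (real j * real d)"
        by (simp add: powr_realpow[symmetric] powr_powr powr_add[symmetric] s_def algebra_simps)
      ultimately show ?thesis by (simp add: mult_ac)
    qed
    finally show ?thesis .
  qed
  have [measurable]: "A j \<in> borel_measurable borel" "B j \<in> borel_measurable borel" for j
    unfolding A_def[abs_def] B_def[abs_def]
    by (intro borel_measurable_times_ennreal borel_measurable_const borel_measurable_indicator borel_closed closed_cball)+
  have "(\<integral>\<^sup>+h. ennreal (min 2 (norm h) / norm h powr s) \<partial>(lborel :: 'a measure))
      \<le> (\<integral>\<^sup>+h. (\<Sum>j. A j h + B j h) \<partial>lborel)"
    by (intro nn_integral_mono pointwise)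
  also have "\<dots> = (\<Sum>j. (\<integral>\<^sup>+h. A j h \<partial>lborel) + (\<integral>\<^sup>+h. B j h \<partial>lborel))"
    by (simp add: nn_integral_suminf nn_integral_add)
  also have "\<dots> = (\<Sum>j. ennreal (V * 2 powr (s - 1) * (2 powr (- \<alpha>)) ^ j + V * 2 ^ Suc d * (2 powr (\<alpha> - 1)) ^ j))"
    unfolding intA intB using V by (simp add: ennreal_plus)
  also have "\<dots> < \<infinity>"
  proof -
    have "(2 :: real) powr (- \<alpha>) < 1" "(2 :: real) powr (\<alpha> - 1) < 1"
      using assms powr_less_mono[of "-\<alpha>" 0 "2::real"] powr_less_mono[of "\<alpha> - 1" 0 "2::real"] by auto
    then have "summable (\<lambda>j. V * 2 powr (s - 1) * (2 powr (- \<alpha>)) ^ j + V * 2 ^ Suc d * (2 powr (\<alpha> - 1)) ^ j)"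
      by (intro summable_add summable_mult summable_geometric) auto
    then have "(\<Sum>j. ennreal (V * 2 powr (s - 1) * (2 powr (- \<alpha>)) ^ j + V * 2 ^ Suc d * (2 powr (\<alpha> - 1)) ^ j)) \<noteq> top"
      by (rule ennreal_suminf_neq_top) (use V in auto)
    then show ?thesis by (simp only: less_top infinity_ennreal_def)
  qed
  finally show ?thesis by (simp add: s_def d_def)
qed

text \<open>After rescaling \<open>h\<close> by \<open>l = M / B\<close>, the length at which
  \<open>norm h * B\<close> equals \<open>M\<close>, both alternatives of the minimum contain the
  factor \<open>M\<close>. The Jacobian and the kernel contribute \<open>l\<close> to the power
  \<open>\<alpha> - 1\<close>, and \<open>M\<close> times that is
  \<open>B powr (1 - \<alpha>) * M powr \<alpha>\<close>. If \<open>M\<close> or \<open>B\<close> is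
  0 the integrand vanishes.\<close>

lemma kernel_integral_scaled:
  fixes M B :: real
  assumes "0 < \<alpha>" "\<alpha> < 1" and MB: "0 \<le> M" "0 \<le> B"
  defines "s \<equiv> real DIM('a) + 1 - \<alpha>"
  shows "(\<integral>\<^sup>+h. ennreal (min (2 * M) (norm h * B) / norm h powr s) \<partial>(lborel :: 'a::euclidean_space measure))
    \<le> (\<integral>\<^sup>+h. ennreal (min 2 (norm h) / norm h powr s) \<partial>(lborel :: 'a measure)) *
       ennreal (B powr (1 - \<alpha>) * M powr \<alpha>)"
proof (cases "M = 0 \<or> B = 0")
  case True
  then have "min (2 * M) (norm h * B) = 0" for h :: 'a using MB by (auto simp: min_def)
  then show ?thesis by simp
next
  case False
  then have pos: "0 < M" "0 < B" using MB by auto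
  define l where "l = M / B"
  have l: "0 < l" using pos by (simp add: l_def)
  have eq: "min (2 * M) (norm (l *\<^sub>R h) * B) / norm (l *\<^sub>R h) powr s
      = (M * l powr (- s)) * (min 2 (norm h) / norm h powr s)" for h :: 'a
  proof -
    have "norm (l *\<^sub>R h) * B = M * norm h" using pos l by (simp add: l_def)
    then have "min (2 * M) (norm (l *\<^sub>R h) * B) = min (2 * M) (M * norm h)" by (simp only:)
    also have "\<dots> = M * min 2 (norm h)"
      using pos by (simp add: min_mult_distrib_left mult.commute)
    finally show ?thesis using l by (simp add: powr_mult powr_minus_divide)
  qed
  have "(\<integral>\<^sup>+h. ennreal (min (2 * M) (norm h * B) / norm h powr s) \<partial>(lborel :: 'a measure))
     = ennreal (l ^ DIM('a)) *
       (\<integral>\<^sup>+h. ennreal ((M * l powr (- s)) * (min 2 (norm h) / norm h powr s)) \<partial>(lborel :: 'a measure))"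
    unfolding eq[symmetric] using l by (subst nn_integral_lborel_affine[of _ l 0]) auto
  also have "\<dots> = ennreal (l ^ DIM('a)) * (ennreal (M * l powr (- s)) *
       (\<integral>\<^sup>+h. ennreal (min 2 (norm h) / norm h powr s) \<partial>(lborel :: 'a measure)))"
  proof -
    have "ennreal ((M * l powr (- s)) * (min 2 (norm h) / norm h powr s)) =
        ennreal (M * l powr (- s)) * ennreal (min 2 (norm h) / norm h powr s)" for h :: 'a
      by (rule ennreal_mult) (use pos in auto)
    then show ?thesis by (simp only:) (subst nn_integral_cmult, auto)
  qed
  also have "\<dots> = ennreal (l ^ DIM('a) * (M * l powr (- s))) *
       (\<integral>\<^sup>+h. ennreal (min 2 (norm h) / norm h powr s) \<partial>(lborel :: 'a measure))"
    using pos l by (simp add: ennreal_mult mult.assoc)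
  also have "l ^ DIM('a) * (M * l powr (- s)) = B powr (1 - \<alpha>) * M powr \<alpha>"
  proof -
    have "l ^ DIM('a) * (M * l powr (- s)) = M * l powr (real DIM('a) - s)"
      using l by (simp add: powr_realpow[symmetric] powr_diff powr_minus_divide)
    also have "real DIM('a) - s = - (1 - \<alpha>)" by (simp add: s_def)
    also have "M * l powr (- (1 - \<alpha>)) = M * (B powr (1 - \<alpha>) / M powr (1 - \<alpha>))"
    proof -
      have "M * l powr (- g) = M * (B powr g / M powr g)" for g
        unfolding l_def using pos by (simp add: powr_minus_divide powr_divide)
      then show ?thesis .
    qed
    also have "\<dots> = B powr (1 - \<alpha>) * (M powr 1 / M powr (1 - \<alpha>))" using pos by simp
    also have "M powr 1 / M powr (1 - \<alpha>) = M powr \<alpha>"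
      unfolding powr_diff[symmetric] by simp
    finally show ?thesis .
  qed
  finally show ?thesis by (simp add: mult.commute)
qed

section \<open>Fractional currents have finite Sobolev norm\<close>

lemma normal_currentD:
  assumes "normal_current m S" "0 < m"
  shows "current m S" "mass m S < \<infinity>" "mass (m - 1) (boundary S) < \<infinity>"
    "enn2real (mass m S) \<le> enn2real (normal_mass m S)"
    "enn2real (mass (m - 1) (boundary S)) \<le> enn2real (normal_mass m S)"
proof -
  have N: "normal_mass m S = mass m S + mass (m - 1) (boundary S)" "normal_mass m S < top"
    using assms by (auto simp: normal_mass_def normal_current_def)
  then show "current m S" "mass m S < \<infinity>" "mass (m - 1) (boundary S) < \<infinity>"
    using assms by (auto simp: normal_current_def less_top)
  show "enn2real (mass m S) \<le> enn2real (normal_mass m S)"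
    "enn2real (mass (m - 1) (boundary S)) \<le> enn2real (normal_mass m S)"
    by (rule enn2real_mono; use N in \<open>simp add: add_increasing add_increasing2\<close>)+
qed

lemma decomposition_tendsto:
  fixes T :: "'a::euclidean_space current"
  assumes dec: "fractional_decomposition DIM('a) \<alpha> T S" and w: "\<omega> \<in> smooth_forms DIM('a)"
    and hom: "\<And>k. T (\<lambda>x vs. k * \<omega> x vs) = k * T \<omega>"
    and bound: "\<And>x vs. orthonormal_list vs \<Longrightarrow> \<bar>\<omega> x vs\<bar> \<le> c" and c: "0 < c"
  shows "(\<lambda>n. \<Sum>k<n. S k \<omega>) \<longlonglongrightarrow> T \<omega>"
proof -
  define R where "R n = (\<lambda>\<omega>. T \<omega> - (\<Sum>k<n. S k \<omega>))" for n
  have lim: "(\<lambda>n. mass DIM('a) (R n)) \<longlonglongrightarrow> 0"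
    using dec unfolding fractional_decomposition_def flat_norm_top R_def by blast
  have Rhom: "R n (\<lambda>x vs. k * \<omega> x vs) = k * R n \<omega>" for n k
  proof -
    have "S j (\<lambda>x vs. k * \<omega> x vs) = k * S j \<omega>" for j
      using dec w unfolding fractional_decomposition_def normal_current_def current_def by blast
    then show ?thesis by (simp add: R_def hom sum_distrib_left right_diff_distrib)
  qed
  have "(\<lambda>n. R n \<omega>) \<longlonglongrightarrow> 0"
  \<comment> \<open>The first remainders may have infinite mass, for which \<open>enn2real\<close>
    gives 0 and no bound holds; hence the comparison is only eventual.\<close>
  proof (rule Lim_null_comparison)
    have "\<forall>\<^sub>F n in sequentially. mass DIM('a) (R n) < \<infinity>"
      using order_tendstoD(2)[OF lim, of \<infinity>] by simp
    then show "\<forall>\<^sub>F n in sequentially. norm (R n \<omega>) \<le> c * enn2real (mass DIM('a) (R n))"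
    proof eventually_elim
      case (elim n)
      show ?case using mass_bound[OF w Rhom elim bound c] by simp
    qed
    have "(\<lambda>n. c * enn2real (mass DIM('a) (R n))) \<longlonglongrightarrow> c * 0"
      using lim by (intro tendsto_intros tendsto_enn2real) auto
    then show "(\<lambda>n. c * enn2real (mass DIM('a) (R n))) \<longlonglongrightarrow> 0" by simp
  qed
  then have "(\<lambda>n. T \<omega> - R n \<omega>) \<longlonglongrightarrow> T \<omega> - 0" by (intro tendsto_intros)
  then show ?thesis by (simp add: R_def)
qed

text \<open>By duality it suffices to test \<open>v (x - h) - v x\<close> against smooth functions
  bounded by 1. Translation invariance moves the shift to the test function, which makes the
  integral a difference of two values of \<open>T\<close>. The decomposition converges at both
  forms, and each piece obeys the translation bound for normal currents.\<close>

lemma shift_diff_le_decomposition: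
  fixes T :: "(real, 'n::{finite,linorder}) vec current"
  assumes v [measurable]: "v \<in> borel_measurable borel" and int: "integrable lborel v"
    and hom: "\<And>\<omega> k. T (\<lambda>x vs. k * \<omega> x vs) = k * T \<omega>"
    and rep: "\<And>f. smooth f \<Longrightarrow> T (\<lambda>x vs. f x * det_form vs) = (\<integral>x. v x * f x \<partial>lborel)"
    and dec: "fractional_decomposition CARD('n) \<alpha> T S"
  shows "shift_diff v h \<le> ennreal (fact CARD('n)) * (\<Sum>k. ennreal (min
      (2 * enn2real (mass CARD('n) (S k)))
      (norm h * enn2real (mass (CARD('n) - 1) (boundary (S k))))))"
proof -
  let ?d = "CARD('n)"
  define q where "q k = min (2 * enn2real (mass ?d (S k)))
      (norm h * enn2real (mass (?d - 1) (boundary (S k))))" for k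
  have q0: "0 \<le> q k" for k by (simp add: q_def)
  show ?thesis
  proof (cases "(\<Sum>k. ennreal (q k)) = top")
    case True
    then show ?thesis unfolding q_def[symmetric] by (simp add: ennreal_mult_top)
  next
    case False
    then have sum: "summable q" using q0 summable_suminf_not_top by blast
    define w where "w x = v (x - h) - v x" for x
    have w [measurable]: "w \<in> borel_measurable borel" unfolding w_def[abs_def] by measurable
    have vh: "integrable lborel (\<lambda>x. v (x - h))"
      using integrable_lborel_translate[OF v int, of "- h"] by simp
    have wint: "integrable lborel w" unfolding w_def[abs_def] using vh int by simp
    have "(\<integral>x. \<bar>w x\<bar> \<partial>lborel) \<le> fact ?d * suminf q"
    proof (rule integral_abs_le_smooth_dual[OF w wint])
      fix f :: "(real, 'n) vec \<Rightarrow> real" assume f: "smooth f" and f1: "\<And>x. \<bar>f x\<bar> \<le> 1"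
      note [measurable] = smooth_borel_measurable[OF f]
      define fh where "fh x = f (x + h)" for x
      have fh: "smooth fh" unfolding fh_def by (rule smooth_translate[OF f])
      have i: "integrable lborel (\<lambda>x. u x * f x)" if "integrable lborel u" "u \<in> borel_measurable borel" for u
        by (rule Bochner_Integration.integrable_bound[OF that(1)])
           (use that(2) f1 in \<open>auto simp: abs_mult intro!: mult_left_le\<close>)
      have "(\<integral>x. w x * f x \<partial>lborel) = (\<integral>x. v (x - h) * f x - v x * f x \<partial>lborel)"
        by (simp add: w_def left_diff_distrib)
      also have "\<dots> = (\<integral>x. v (x - h) * f x \<partial>lborel) - (\<integral>x. v x * f x \<partial>lborel)"
        by (intro Bochner_Integration.integral_diff i vh int v) measurable
      also have "(\<integral>x. v (x - h) * f x \<partial>lborel) = (\<integral>x. v x * fh x \<partial>lborel)"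
        using integral_lborel_translate[of "\<lambda>x. v (x - h) * f x" h] by (simp add: fh_def)
      finally have eq: "(\<integral>x. w x * f x \<partial>lborel) =
          T (\<lambda>x vs. fh x * det_form vs) - T (\<lambda>x vs. f x * det_form vs)"
        by (simp add: rep f fh)
      have conv: "(\<lambda>n. \<Sum>k<n. S k (\<lambda>x vs. g x * det_form vs)) \<longlonglongrightarrow> T (\<lambda>x vs. g x * det_form vs)"
        if g: "smooth g" and g1: "\<And>x. \<bar>g x\<bar> \<le> 1" for g
      proof (rule decomposition_tendsto[where c="fact ?d" and \<alpha>=\<alpha> and S=S and T=T
            and \<omega>="\<lambda>x vs. g x * det_form vs"])
        show "fractional_decomposition DIM((real, 'n) vec) \<alpha> T S" using dec by simp
        show "(\<lambda>x vs. g x * det_form vs) \<in> smooth_forms DIM((real, 'n) vec)"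
          using smooth_forms_product[OF g covector_det_form] by simp
        show "\<bar>g x * det_form vs\<bar> \<le> fact ?d" if "orthonormal_list vs" for x and vs :: "(real, 'n) vec list"
          using mult_mono[OF g1[of x] abs_det_form_le[of vs]] orthonormal_list_norm[OF that]
          by (simp add: abs_mult)
      qed (use hom in auto)
      have lim: "(\<lambda>n. (\<Sum>k<n. S k (\<lambda>x vs. fh x * det_form vs)) - (\<Sum>k<n. S k (\<lambda>x vs. f x * det_form vs)))
          \<longlonglongrightarrow> (\<integral>x. w x * f x \<partial>lborel)"
        unfolding eq by (intro tendsto_diff conv f f1 fh) (simp add: fh_def f1)
      have le: "(\<Sum>k<n. S k (\<lambda>x vs. fh x * det_form vs)) - (\<Sum>k<n. S k (\<lambda>x vs. f x * det_form vs))
          \<le> fact ?d * suminf q" for n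
      proof -
        have "S k (\<lambda>x vs. fh x * det_form vs) - S k (\<lambda>x vs. f x * det_form vs) \<le> fact ?d * q k" for k
        proof -
          have "normal_current ?d (S k)" using dec unfolding fractional_decomposition_def by blast
          from normal_current_translation_bound[OF this f f1, of h]
          show ?thesis unfolding q_def fh_def by linarith
        qed
        then have "(\<Sum>k<n. S k (\<lambda>x vs. fh x * det_form vs)) - (\<Sum>k<n. S k (\<lambda>x vs. f x * det_form vs))
            \<le> (\<Sum>k<n. fact ?d * q k)"
          unfolding sum_subtractf[symmetric] by (rule sum_mono)
        also have "\<dots> \<le> fact ?d * suminf q"
          unfolding sum_distrib_left[symmetric]
          by (intro mult_left_mono sum_le_suminf sum) (use q0 in auto)
        finally show ?thesis .
      qed
      show "(\<integral>x. w x * f x \<partial>lborel) \<le> fact ?d * suminf q"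
        by (rule LIMSEQ_le_const2[OF lim]) (use le in blast)
    qed
    moreover have "shift_diff v h = ennreal (\<integral>x. \<bar>w x\<bar> \<partial>lborel)"
      unfolding shift_diff_def w_def[symmetric]
      by (rule nn_integral_eq_integral) (use wint in auto)
    moreover have "(\<Sum>k. ennreal (q k)) = ennreal (suminf q)"
      by (rule suminf_ennreal2[OF q0 sum])
    ultimately show ?thesis
      unfolding q_def[symmetric]
      using suminf_nonneg[OF sum q0] by (simp add: ennreal_mult[symmetric] ennreal_leI)
  qed
qed

lemma sobolev_norm_le_decomposition:
  fixes T :: "(real, 'n::{finite,linorder}) vec current" and \<alpha> :: real
  assumes \<alpha>: "0 < \<alpha>" "\<alpha> < 1"
    and v [measurable]: "v \<in> borel_measurable borel" and int: "integrable lborel v"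
    and uv: "AE x in lebesgue. u x = v x"
    and hom: "\<And>\<omega> k. T (\<lambda>x vs. k * \<omega> x vs) = k * T \<omega>"
    and rep: "\<And>f. smooth f \<Longrightarrow> T (\<lambda>x vs. f x * det_form vs) = (\<integral>x. v x * f x \<partial>lborel)"
    and dec: "fractional_decomposition CARD('n) \<alpha> T S"
  shows "sobolev_norm \<alpha> u \<le> ennreal (fact CARD('n)) *
     (\<integral>\<^sup>+h. ennreal (min 2 (norm h) / norm h powr (real CARD('n) + 1 - \<alpha>)) \<partial>(lborel :: (real, 'n) vec measure)) *
     (\<Sum>k. ennreal (enn2real (mass (CARD('n) - 1) (boundary (S k))) powr (1 - \<alpha>) *
                     enn2real (mass CARD('n) (S k)) powr \<alpha>))"
proof -
  let ?d = "CARD('n)"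
  let ?s = "real ?d + 1 - \<alpha>"
  let ?M = "\<lambda>k. enn2real (mass ?d (S k))" and ?B = "\<lambda>k. enn2real (mass (?d - 1) (boundary (S k)))"
  let ?K = "\<integral>\<^sup>+h. ennreal (min 2 (norm h) / norm h powr ?s) \<partial>(lborel :: (real, 'n) vec measure)"
  have "sobolev_norm \<alpha> u = (\<integral>\<^sup>+h. shift_diff v h * ennreal (1 / norm h powr ?s) \<partial>lborel)"
    using sobolev_norm_eq_shift_diff[OF v uv, of \<alpha>] by simp
  also have "\<dots> \<le> (\<integral>\<^sup>+h. ennreal (fact ?d) *
      (\<Sum>k. ennreal (min (2 * ?M k) (norm h * ?B k) / norm h powr ?s)) \<partial>(lborel :: (real, 'n) vec measure))"
  proof (rule nn_integral_mono)
    fix h :: "(real, 'n) vec"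
    have "shift_diff v h * ennreal (1 / norm h powr ?s)
        \<le> ennreal (fact ?d) * (\<Sum>k. ennreal (min (2 * ?M k) (norm h * ?B k))) * ennreal (1 / norm h powr ?s)"
      by (intro mult_right_mono shift_diff_le_decomposition[OF v int hom rep dec]) auto
    also have "\<dots> = ennreal (fact ?d) * (\<Sum>k. ennreal (min (2 * ?M k) (norm h * ?B k)) * ennreal (1 / norm h powr ?s))"
      by (simp add: mult.assoc)
    also have "\<dots> = ennreal (fact ?d) * (\<Sum>k. ennreal (min (2 * ?M k) (norm h * ?B k) / norm h powr ?s))"
      by (simp add: ennreal_mult[symmetric])
    finally show "shift_diff v h * ennreal (1 / norm h powr ?s)
      \<le> ennreal (fact ?d) * (\<Sum>k. ennreal (min (2 * ?M k) (norm h * ?B k) / norm h powr ?s))" .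
  qed
  also have "\<dots> = ennreal (fact ?d) *
      (\<Sum>k. \<integral>\<^sup>+h. ennreal (min (2 * ?M k) (norm h * ?B k) / norm h powr ?s) \<partial>(lborel :: (real, 'n) vec measure))"
    by (subst nn_integral_cmult) (auto simp: nn_integral_suminf)
  also have "\<dots> \<le> ennreal (fact ?d) * (\<Sum>k. ?K * ennreal (?B k powr (1 - \<alpha>) * ?M k powr \<alpha>))"
    using kernel_integral_scaled[OF \<alpha>, of "?M k" "?B k" for k, where 'a="(real, 'n) vec"]
    by (intro mult_left_mono suminf_le) auto
  also have "\<dots> = ennreal (fact ?d) * ?K * (\<Sum>k. ennreal (?B k powr (1 - \<alpha>) * ?M k powr \<alpha>))"
    by (simp add: mult.assoc)
  finally show ?thesis .
qed

text \<open>The definition gives summability with normal mass and flat norm. In top degree the flat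
  norm is the mass, and the boundary mass is at most the normal mass.\<close>

lemma decomposition_sum_finite:
  fixes T :: "(real, 'n::{finite,linorder}) vec current" and \<alpha> :: real
  assumes \<alpha>: "0 < \<alpha>" "\<alpha> < 1" and dec: "fractional_decomposition CARD('n) \<alpha> T S"
  shows "(\<Sum>k. ennreal (enn2real (mass (CARD('n) - 1) (boundary (S k))) powr (1 - \<alpha>) *
                     enn2real (mass CARD('n) (S k)) powr \<alpha>)) < \<infinity>"
proof -
  let ?d = "CARD('n)"
  let ?t = "\<lambda>k. enn2real (normal_mass ?d (S k)) powr (1 - \<alpha>) * enn2real (mass ?d (S k)) powr \<alpha>"
  have "summable ?t"
    using dec flat_norm_top[where 'a="(real, 'n) vec"] unfolding fractional_decomposition_def by simp
  then have fin: "(\<Sum>k. ennreal (?t k)) \<noteq> top" by (rule ennreal_suminf_neq_top) auto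
  have "(\<Sum>k. ennreal (enn2real (mass (?d - 1) (boundary (S k))) powr (1 - \<alpha>) *
                     enn2real (mass ?d (S k)) powr \<alpha>)) \<le> (\<Sum>k. ennreal (?t k))"
  proof (intro suminf_le ennreal_leI mult_right_mono powr_mono2)
    fix k
    have "normal_current ?d (S k)" using dec unfolding fractional_decomposition_def by blast
    then show "enn2real (mass (?d - 1) (boundary (S k))) \<le> enn2real (normal_mass ?d (S k))"
      by (rule normal_currentD) simp
  qed (use \<alpha> in auto)
  also have "(\<Sum>k. ennreal (?t k)) < \<infinity>" using fin by (simp add: less_top)
  finally show ?thesis .
qed

section \<open>Integration by parts against a bump kernel\<close>

text \<open>The derivative is assumed at parameter 0 only, but at every base point; moving the base
  point along the line gives it at every parameter, and the mean value inequality applies.\<close>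

lemma directional_difference_bound:
  fixes w :: "'a::euclidean_space \<Rightarrow> real"
  assumes deriv: "\<And>z. ((\<lambda>t. w (z + t *\<^sub>R e)) has_real_derivative w' z) (at 0)"
    and bound: "\<And>t. \<bar>t\<bar> \<le> \<bar>s\<bar> \<Longrightarrow> \<bar>w' (z + t *\<^sub>R e)\<bar> \<le> B"
  shows "\<bar>w (z + s *\<^sub>R e) - w z\<bar> \<le> B * \<bar>s\<bar>"
proof -
  have d: "((\<lambda>t. w (z + t *\<^sub>R e)) has_real_derivative w' (z + t *\<^sub>R e)) (at t)" for t
    using DERIV_shift[of "\<lambda>t. w (z + t *\<^sub>R e)" "w' (z + t *\<^sub>R e)" 0 t] deriv[of "z + t *\<^sub>R e"]
    by (simp add: scaleR_add_left ac_simps)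
  have "\<bar>w (z + s *\<^sub>R e) - w (z + 0 *\<^sub>R e)\<bar> \<le> B * \<bar>s - 0\<bar>"
  proof (rule field_differentiable_bound[of "{-\<bar>s\<bar>..\<bar>s\<bar>}" "\<lambda>t. w (z + t *\<^sub>R e)" "\<lambda>t. w' (z + t *\<^sub>R e)", unfolded real_norm_def])
    show "((\<lambda>t. w (z + t *\<^sub>R e)) has_field_derivative w' (z + t *\<^sub>R e)) (at t within {-\<bar>s\<bar>..\<bar>s\<bar>})" for t
      using d by (rule has_field_derivative_at_within)
  qed (use bound in auto)
  then show ?thesis by simp
qed

lemma smooth_directional_derivative:
  assumes "smooth f"
  shows "((\<lambda>t. f (z + t *\<^sub>R e)) has_real_derivative frechet_derivative f (at z) e) (at 0)"
proof -
  have "((\<lambda>t. f (z + t *\<^sub>R e)) has_derivative (\<lambda>t. frechet_derivative f (at z) (t *\<^sub>R e))) (at 0)"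
    by (rule has_derivative_in_compose2[where g=f and t=UNIV and f="\<lambda>t. z + t *\<^sub>R e" and g'="\<lambda>y. frechet_derivative f (at y)" and f'="\<lambda>t. t *\<^sub>R e" and x=0, simplified])
       (auto intro!: derivative_eq_intros smooth_has_derivative assms)
  moreover have "frechet_derivative f (at z) (t *\<^sub>R e) = frechet_derivative f (at z) e * t" for t
    by (simp add: assms linear_cmul linear_frechet_derivative smooth_differentiable)
  ultimately show ?thesis by (simp add: has_field_derivative_def)
qed

text \<open>Coefficients of smooth forms may be unbounded. The points that matter lie in
  \<open>K\<close> plus a ball, which is compact; this supplies the constants for dominated
  convergence below.\<close>

lemma continuous_bounded_compact:
  fixes f :: "'a::euclidean_space \<Rightarrow> real"
  assumes f: "continuous_on UNIV f" and K: "compact K"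
  shows "\<exists>B\<ge>0. \<forall>y\<in>K. \<forall>z\<in>cball 0 R. \<bar>f (y + z)\<bar> \<le> B"
proof -
  have "compact {y + z | y z. y \<in> K \<and> z \<in> cball 0 R}"
    by (rule compact_sums[OF K compact_cball])
  then have "bounded (f ` {y + z | y z. y \<in> K \<and> z \<in> cball 0 R})"
    by (intro compact_imp_bounded compact_continuous_image continuous_on_subset[OF f]) auto
  then obtain B where "\<And>x. x \<in> {y + z | y z. y \<in> K \<and> z \<in> cball 0 R} \<Longrightarrow> \<bar>f x\<bar> \<le> B"
    unfolding bounded_iff by auto
  then show ?thesis by (intro exI[of _ "max 0 B"]) fastforce
qed

text \<open>The integrals of the difference quotients vanish by translation invariance.\<close>

lemma integral_directional_derivative_zero:
  fixes w w' :: "'a::euclidean_space \<Rightarrow> real"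
  assumes w: "continuous_on UNIV w" and w': "continuous_on UNIV w'"
    and supp: "\<And>z. z \<notin> cball 0 1 \<Longrightarrow> w z = 0 \<and> w' z = 0"
    and deriv: "\<And>z. ((\<lambda>t. w (z + t *\<^sub>R e)) has_real_derivative w' z) (at 0)"
  shows "(\<integral>z. w' z \<partial>lborel) = 0"
proof -
  note [measurable] = borel_measurable_continuous_onI[OF w] borel_measurable_continuous_onI[OF w']
  obtain B where B0: "0 \<le> B" and "\<forall>y\<in>{0}. \<forall>z\<in>cball 0 1. \<bar>w' (y + z)\<bar> \<le> B"
    using continuous_bounded_compact[OF w', of "{0}" 1] by auto
  then have B: "\<bar>w' z\<bar> \<le> B" for z using supp[of z] by (cases "z \<in> cball 0 1") auto
  obtain A where "\<forall>y\<in>{0}. \<forall>z\<in>cball 0 1. \<bar>w (y + z)\<bar> \<le> A"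
    using continuous_bounded_compact[OF w, of "{0}" 1] by auto
  then have A: "\<bar>w z\<bar> \<le> A" if "z \<in> cball 0 1" for z using that by auto
  have wint: "integrable lborel w"
    by (rule integrableI_bounded_set[of "cball 0 1" _ _ A])
       (use A supp in \<open>auto simp: emeasure_cball\<close>)
  define t where "t n = 1 / real (Suc n)" for n
  have t: "0 < t n" "t n \<le> 1" for n by (auto simp: t_def)
  have tlim: "t \<longlonglongrightarrow> 0"
    unfolding t_def[abs_def] using LIMSEQ_inverse_real_of_nat by (simp add: inverse_eq_divide)
  define Q where "Q n z = (w (z + t n *\<^sub>R e) - w z) / t n" for n z
  have Q0: "(\<integral>z. Q n z \<partial>lborel) = 0" for n
  proof -
    have "(\<integral>z. Q n z \<partial>lborel) = ((\<integral>z. w (z + t n *\<^sub>R e) \<partial>lborel) - (\<integral>z. w z \<partial>lborel)) / t n"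
      unfolding Q_def by (simp add: integrable_lborel_translate wint)
    then show ?thesis by (simp add: integral_lborel_translate)
  qed
  have "(\<lambda>n. \<integral>z. Q n z \<partial>lborel) \<longlonglongrightarrow> (\<integral>z. w' z \<partial>lborel)"
  \<comment> \<open>As the step sizes are at most 1, the difference quotients vanish off the ball of
    radius \<open>1 + norm e\<close>, and the bound \<open>B\<close> on \<open>w'\<close> controls
    them inside.\<close>
  proof (rule integral_dominated_convergence[where w="\<lambda>z. B * indicator (cball 0 (1 + norm e)) z"])
    show "integrable lborel (\<lambda>z. B * indicator (cball 0 (1 + norm e)) z :: real)"
      by (intro integrable_mult_right integrable_real_indicator) (auto simp: emeasure_cball)
    show "Q n \<in> borel_measurable lborel" for n unfolding Q_def by measurable
    show "AE z in lborel. (\<lambda>n. Q n z) \<longlonglongrightarrow> w' z"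
    proof (rule AE_I2)
      fix z
      have "((\<lambda>s. (w (z + s *\<^sub>R e) - w z) / s) \<longlongrightarrow> w' z) (at 0)"
        using deriv[of z] unfolding has_field_derivative_iff by simp
      moreover have "filterlim t (at 0) sequentially"
        using tlim t by (auto simp: filterlim_at less_imp_neq[symmetric] intro!: always_eventually)
      ultimately show "(\<lambda>n. Q n z) \<longlonglongrightarrow> w' z"
        unfolding Q_def by (rule filterlim_compose)
    qed
    show "AE z in lborel. norm (Q n z) \<le> B * indicator (cball 0 (1 + norm e)) z" for n
    proof (rule AE_I2)
      fix z
      show "norm (Q n z) \<le> B * indicator (cball 0 (1 + norm e)) z"
      proof (cases "norm z \<le> 1 + norm e")
        case True
        have "\<bar>w (z + t n *\<^sub>R e) - w z\<bar> \<le> B * \<bar>t n\<bar>"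
          by (rule directional_difference_bound[OF deriv]) (rule B)
        then show ?thesis using True t[of n] by (simp add: Q_def divide_simps)
      next
        case False
        have "norm (t n *\<^sub>R e) \<le> norm e" using t[of n] by (simp add: mult_left_le_one_le)
        then have "1 < norm (z + t n *\<^sub>R e)" using False norm_diff_ineq[of z "t n *\<^sub>R e"] by linarith
        then have "w (z + t n *\<^sub>R e) = 0" using supp by simp
        moreover have "w z = 0" using False supp[of z] norm_ge_zero[of e] by simp
        ultimately show ?thesis using False by (simp add: Q_def)
      qed
    qed
  qed auto
  then show ?thesis unfolding Q0 using LIMSEQ_unique tendsto_const by blast
qed

text \<open>Squaring the truncated paraboloid makes it continuously differentiable across the unit
  sphere, which is the regularity that one integration by parts consumes.\<close>

definition bump0 :: "'a::euclidean_space \<Rightarrow> real" where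
  "bump0 z = (max 0 (1 - z \<bullet> z))\<^sup>2"

definition bump_deriv :: "'a::euclidean_space \<Rightarrow> 'a \<Rightarrow> real" where
  "bump_deriv e z = - 4 * max 0 (1 - z \<bullet> z) * (z \<bullet> e)"

definition bump_mass :: "'a::euclidean_space itself \<Rightarrow> real" where
  "bump_mass _ = (\<integral>z. bump0 (z :: 'a) \<partial>lborel)"

lemma bump0_continuous: "continuous_on S bump0"
  unfolding bump0_def[abs_def] by (intro continuous_intros)

lemma bump_deriv_continuous: "continuous_on S (bump_deriv e)"
  unfolding bump_deriv_def[abs_def] by (intro continuous_intros)

lemma bump0_measurable [measurable]: "bump0 \<in> borel_measurable borel"
  by (rule borel_measurable_continuous_onI[OF bump0_continuous])

lemma bump_deriv_measurable [measurable]: "bump_deriv e \<in> borel_measurable borel"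
  by (rule borel_measurable_continuous_onI[OF bump_deriv_continuous])

lemma bump0_bounds: "0 \<le> bump0 z" "bump0 z \<le> indicator (cball 0 1) z"
proof -
  show "0 \<le> bump0 z" by (simp add: bump0_def)
  show "bump0 z \<le> indicator (cball 0 1) z"
  proof (cases "norm z \<le> 1")
    case True
    have "(max 0 (1 - z \<bullet> z))\<^sup>2 \<le> 1\<^sup>2" by (rule power_mono) auto
    then show ?thesis using True by (simp add: bump0_def)
  next
    case False
    then have "1 < z \<bullet> z" by (simp add: dot_square_norm power2_eq_square less_1_mult)
    then show ?thesis using False by (simp add: bump0_def max_def)
  qed
qed

lemma bump_deriv_bound: "\<bar>bump_deriv e z\<bar> \<le> 4 * norm e * indicator (cball 0 1) z"
proof (cases "norm z \<le> 1")
  case True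
  have "\<bar>z \<bullet> e\<bar> \<le> 1 * norm e"
    using Cauchy_Schwarz_ineq2[of z e] True mult_right_mono[OF True norm_ge_zero[of e]] by linarith
  moreover have "\<bar>max 0 (1 - z \<bullet> z)\<bar> \<le> 1" by simp
  ultimately have "\<bar>max 0 (1 - z \<bullet> z)\<bar> * \<bar>z \<bullet> e\<bar> \<le> 1 * (1 * norm e)" by (intro mult_mono) auto
  then show ?thesis using True by (simp add: bump_deriv_def abs_mult)
next
  case False
  then have "1 < z \<bullet> z" by (simp add: dot_square_norm power2_eq_square less_1_mult)
  then show ?thesis using False by (simp add: bump_deriv_def max_def)
qed

lemma bump_zero: "z \<notin> cball 0 1 \<Longrightarrow> bump0 z = 0 \<and> bump_deriv e z = 0"
  using bump0_bounds[of z] bump_deriv_bound[of e z] by auto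

lemma bump_has_derivative:
  "((\<lambda>t. bump0 (z + t *\<^sub>R e)) has_real_derivative bump_deriv e z) (at 0)"
proof -
  \<comment> \<open>Squaring removes the kink at 0: the difference quotient there is at most
    \<open>\<bar>h\<bar>\<close>. The chain rule then yields the factor \<open>2 * (- 2)\<close> in
    \<open>bump_deriv\<close>.\<close>
  have sq: "((\<lambda>x. (max 0 x)\<^sup>2) has_real_derivative 2 * max 0 x) (at x)" for x :: real
  proof (cases "x = 0")
    case True
    have "((\<lambda>h. (max 0 h)\<^sup>2 / h) \<longlongrightarrow> 0) (at (0::real))"
    proof (rule Lim_null_comparison)
      show "\<forall>\<^sub>F h in at (0::real). norm ((max 0 h)\<^sup>2 / h) \<le> \<bar>h\<bar>"
        by (intro always_eventually) (auto simp: max_def power2_eq_square)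
      show "((\<lambda>h. \<bar>h\<bar>) \<longlongrightarrow> 0) (at (0::real))"
        using tendsto_rabs[OF tendsto_ident_at[of "0::real" UNIV]] by simp
    qed
    then show ?thesis using True by (simp add: has_field_derivative_iff)
  next
    case False
    then show ?thesis
    proof (cases "0 < x")
      case True
      have "((\<lambda>x. x\<^sup>2) has_real_derivative 2 * max 0 x) (at x)"
        using True by (auto intro!: derivative_eq_intros)
      then show ?thesis
        by (rule has_field_derivative_transform_within_open[of _ _ _ "{0<..}"]) (use True in auto)
    next
      assume "\<not> 0 < x"
      have "((\<lambda>x. 0) has_real_derivative 2 * max 0 x) (at x)"
        using \<open>\<not> 0 < x\<close> by (auto intro!: derivative_eq_intros simp: max_def)
      then show ?thesis
        by (rule has_field_derivative_transform_within_open[of _ _ _ "{..<0}"])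
           (use False \<open>\<not> 0 < x\<close> in auto)
    qed
  qed
  have "((\<lambda>t. 1 - (z + t *\<^sub>R e) \<bullet> (z + t *\<^sub>R e)) has_real_derivative - 2 * (z \<bullet> e)) (at 0)"
  proof -
    have "(\<lambda>t. 1 - (z + t *\<^sub>R e) \<bullet> (z + t *\<^sub>R e)) = (\<lambda>t. 1 - z \<bullet> z - 2 * t * (z \<bullet> e) - t\<^sup>2 * (e \<bullet> e))"
      by (simp add: fun_eq_iff inner_add inner_commute power2_eq_square algebra_simps)
    then show ?thesis by (auto intro!: derivative_eq_intros)
  qed
  from DERIV_chain2[OF sq this] show ?thesis
    unfolding bump0_def bump_deriv_def by (simp add: mult.assoc)
qed

lemma integrable_indicator_bound:
  fixes g :: "'a::euclidean_space \<Rightarrow> real"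
  assumes "g \<in> borel_measurable borel" "\<And>z. \<bar>g z\<bar> \<le> B * indicator (cball 0 1) z"
  shows "integrable lborel g"
proof (rule Bochner_Integration.integrable_bound)
  show "integrable lborel (\<lambda>z. B * indicator (cball 0 1) z :: real)"
    by (intro integrable_mult_right integrable_real_indicator) (auto simp: emeasure_cball)
  show "AE z in lborel. norm (g z) \<le> norm (B * indicator (cball 0 1) z)"
    using assms(2) by (auto intro!: AE_I2 intro: order_trans[OF _ abs_ge_self])
qed (use assms in auto)

lemma bump_mass_pos: "0 < bump_mass TYPE('a::euclidean_space)"
proof -
  \<comment> \<open>For \<open>norm z \<le> 1/2\<close> the base of the square is at least 3/4, and
    9/16 exceeds 1/2.\<close>
  have le: "(1/2) * indicator (cball 0 (1/2)) z \<le> bump0 z" for z :: 'a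
  proof (cases "norm z \<le> 1/2")
    case True
    have "z \<bullet> z \<le> (1/2)\<^sup>2" unfolding dot_square_norm by (rule power_mono[OF True]) auto
    then have "(3/4)\<^sup>2 \<le> (max 0 (1 - z \<bullet> z))\<^sup>2" by (intro power_mono) (auto simp: power2_eq_square)
    then show ?thesis using True by (simp add: bump0_def power2_eq_square)
  qed (simp add: bump0_bounds)
  have "0 < (1/2) * measure lborel (cball (0 :: 'a) (1/2))"
    by (simp add: content_cball_pos)
  also have "\<dots> = (\<integral>z. (1/2) * indicator (cball 0 (1/2)) z \<partial>(lborel :: 'a measure))" by simp
  also have "\<dots> \<le> bump_mass TYPE('a)"
    unfolding bump_mass_def
  proof (rule integral_mono[OF _ _ le])
    show "integrable lborel (\<lambda>z :: 'a. (1/2) * indicator (cball 0 (1/2)) z :: real)"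
      by (intro integrable_mult_right integrable_real_indicator) (auto simp: emeasure_cball)
    show "integrable lborel (bump0 :: 'a \<Rightarrow> real)"
    proof (rule integrable_indicator_bound[of _ 1])
      show "\<bar>bump0 z\<bar> \<le> 1 * indicator (cball 0 1) z" for z :: 'a
        using bump0_bounds[of z] by simp
    qed simp
  qed
  finally show ?thesis .
qed

section \<open>Pairing a compactly supported function with translated test functions\<close>

locale compact_integrable =
  fixes v :: "'a::euclidean_space \<Rightarrow> real" and K :: "'a set"
  assumes v_measurable [measurable]: "v \<in> borel_measurable borel"
    and v_integrable: "integrable lborel v"
    and K: "compact K"
    and v_zero: "\<And>x. x \<notin> K \<Longrightarrow> v x = 0"
begin

text \<open>The value at \<open>f\<close> of \<open>v\<close> translated by \<open>h\<close>. With
  the translation on \<open>f\<close> the integrand vanishes off \<open>K\<close> for every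
  \<open>h\<close>, and smoothness in \<open>h\<close> is inherited from \<open>f\<close>.\<close>

definition pairing :: "('a \<Rightarrow> real) \<Rightarrow> 'a \<Rightarrow> real" where
  "pairing f h = (\<integral>y. v y * f (y + h) \<partial>lborel)"

definition L1 :: real where
  "L1 = (\<integral>y. \<bar>v y\<bar> \<partial>lborel)"

lemma L1_nonneg: "0 \<le> L1"
  unfolding L1_def by simp

lemma v_mult_le: "(y \<in> K \<Longrightarrow> \<bar>g\<bar> \<le> B) \<Longrightarrow> \<bar>v y * g\<bar> \<le> B * \<bar>v y\<bar>"
  using v_zero[of y] by (cases "y \<in> K") (auto simp: abs_mult mult.commute[of "\<bar>v y\<bar>"] mult_right_mono)

lemma measurable_translate_continuous:
  assumes "continuous_on UNIV (f :: 'a \<Rightarrow> real)"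
  shows "(\<lambda>y. f (y + h)) \<in> borel_measurable borel"
  by (intro borel_measurable_continuous_onI continuous_on_compose2[OF assms] continuous_intros) auto

lemma pairing_integrable:
  assumes f: "continuous_on UNIV f"
  shows "integrable lborel (\<lambda>y. v y * f (y + h))"
proof -
  note [measurable] = measurable_translate_continuous[OF f, of h]
  obtain B where B: "\<forall>y\<in>K. \<forall>z\<in>cball 0 (norm h). \<bar>f (y + z)\<bar> \<le> B"
    using continuous_bounded_compact[OF f K] by blast
  show ?thesis
  proof (rule Bochner_Integration.integrable_bound)
    show "integrable lborel (\<lambda>y. B * \<bar>v y\<bar>)" using v_integrable by simp
    show "AE y in lborel. norm (v y * f (y + h)) \<le> norm (B * \<bar>v y\<bar>)"
      unfolding real_norm_def
      by (intro AE_I2 order_trans[OF v_mult_le abs_ge_self]) (use B in auto)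
  qed measurable
qed

lemma pairing_bound:
  assumes f: "continuous_on UNIV f" and B: "\<And>y. y \<in> K \<Longrightarrow> \<bar>f (y + h)\<bar> \<le> B"
  shows "\<bar>pairing f h\<bar> \<le> B * L1"
proof -
  have "\<bar>pairing f h\<bar> \<le> (\<integral>y. \<bar>v y * f (y + h)\<bar> \<partial>lborel)"
    unfolding pairing_def by (rule integral_abs_bound)
  also have "\<dots> \<le> (\<integral>y. B * \<bar>v y\<bar> \<partial>lborel)"
    by (intro integral_mono v_mult_le) (use B pairing_integrable[OF f] v_integrable in auto)
  finally show ?thesis by (simp add: L1_def)
qed

lemma pairing_add:
  assumes "continuous_on UNIV f" "continuous_on UNIV g"
  shows "pairing (\<lambda>x. f x + g x) h = pairing f h + pairing g h"
  unfolding pairing_def distrib_left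
  by (intro Bochner_Integration.integral_add pairing_integrable assms)

lemma pairing_cmult: "pairing (\<lambda>x. c * f x) h = c * pairing f h"
proof -
  have "(\<lambda>y. v y * (c * f (y + h))) = (\<lambda>y. c * (v y * f (y + h)))" by (simp add: mult.left_commute)
  then show ?thesis unfolding pairing_def by simp
qed

lemma pairing_continuous:
  assumes f: "continuous_on UNIV f"
  shows "continuous_on UNIV (pairing f)"
  unfolding continuous_on_sequentially
proof (intro allI ballI impI)
  fix X h assume X: "(\<forall>n. X n \<in> UNIV) \<and> X \<longlonglongrightarrow> (h :: 'a)"
  then obtain R where R: "\<And>n. norm (X n) \<le> R"
    using convergent_imp_Bseq[of X] unfolding convergent_def Bseq_def by blast
  obtain B where B: "\<forall>y\<in>K. \<forall>z\<in>cball 0 R. \<bar>f (y + z)\<bar> \<le> B"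
    using continuous_bounded_compact[OF f K] by blast
  note [measurable] = measurable_translate_continuous[OF f]
  have "(\<lambda>n. \<integral>y. v y * f (y + X n) \<partial>lborel) \<longlonglongrightarrow> (\<integral>y. v y * f (y + h) \<partial>lborel)"
  proof (rule integral_dominated_convergence[where w="\<lambda>y. B * \<bar>v y\<bar>"])
    show "AE y in lborel. (\<lambda>n. v y * f (y + X n)) \<longlonglongrightarrow> v y * f (y + h)"
    proof (rule AE_I2)
      fix y
      have "isCont f (y + h)" using f by (simp add: continuous_on_eq_continuous_at)
      moreover have "(\<lambda>n. y + X n) \<longlonglongrightarrow> y + h" using X by (intro tendsto_intros) auto
      ultimately have "(\<lambda>n. f (y + X n)) \<longlonglongrightarrow> f (y + h)" by (rule isCont_tendsto_compose)
      then show "(\<lambda>n. v y * f (y + X n)) \<longlonglongrightarrow> v y * f (y + h)" by (intro tendsto_intros)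
    qed
    show "AE y in lborel. norm (v y * f (y + X n)) \<le> B * \<bar>v y\<bar>" for n
      unfolding real_norm_def by (intro AE_I2 v_mult_le) (use B R in auto)
    show "(\<lambda>y. v y * f (y + X n)) \<in> borel_measurable lborel" for n by measurable
    show "(\<lambda>y. v y * f (y + h)) \<in> borel_measurable lborel" by measurable
    show "integrable lborel (\<lambda>y. B * \<bar>v y\<bar>)" using v_integrable by simp
  qed
  then show "(pairing f \<circ> X) \<longlonglongrightarrow> pairing f h" by (simp add: pairing_def o_def)
qed

text \<open>Differentiation under the integral sign. Along a sequence of step sizes the quotients
  are bounded by the maximum of the directional derivative over \<open>K\<close> plus a ball, so a
  multiple of \<open>\<bar>v y\<bar>\<close> dominates.\<close>

lemma pairing_directional_derivative:
  assumes f: "smooth f"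
  shows "((\<lambda>t. pairing f (h + t *\<^sub>R e)) has_real_derivative
     pairing (\<lambda>x. frechet_derivative f (at x) e) h) (at 0)"
proof -
  define f' where "f' x = frechet_derivative f (at x) e" for x
  have f': "continuous_on UNIV f'"
    unfolding f'_def by (intro smooth_continuous_on smooth_frechet_derivative f)
  have fc: "continuous_on UNIV f" by (rule smooth_continuous_on[OF f])
  note [measurable] = measurable_translate_continuous[OF f'] measurable_translate_continuous[OF fc]
  have "(\<lambda>n. (pairing f (h + X n *\<^sub>R e) - pairing f h) / X n) \<longlonglongrightarrow> pairing f' h"
    if X: "\<And>n. X n \<noteq> 0" "X \<longlonglongrightarrow> 0" for X :: "nat \<Rightarrow> real"
  proof -
    obtain R where R: "\<And>n. \<bar>X n\<bar> \<le> R"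
      using convergent_imp_Bseq[of X] X(2) unfolding convergent_def Bseq_def real_norm_def by blast
    obtain B where B0: "0 \<le> B" and B: "\<forall>y\<in>K. \<forall>z\<in>cball 0 (norm h + R * norm e). \<bar>f' (y + z)\<bar> \<le> B"
      using continuous_bounded_compact[OF f' K] by blast
    have "(\<lambda>n. \<integral>y. v y * ((f (y + h + X n *\<^sub>R e) - f (y + h)) / X n) \<partial>lborel)
        \<longlonglongrightarrow> (\<integral>y. v y * f' (y + h) \<partial>lborel)"
    proof (rule integral_dominated_convergence[where w="\<lambda>y. B * \<bar>v y\<bar>"])
      show "AE y in lborel. (\<lambda>n. v y * ((f (y + h + X n *\<^sub>R e) - f (y + h)) / X n)) \<longlonglongrightarrow> v y * f' (y + h)"
      proof (intro AE_I2 tendsto_mult tendsto_const)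
        fix y
        have "((\<lambda>s. (f (y + h + s *\<^sub>R e) - f (y + h)) / s) \<longlongrightarrow> f' (y + h)) (at 0)"
          using smooth_directional_derivative[OF f, of "y + h" e]
          unfolding has_field_derivative_iff f'_def by simp
        moreover have "filterlim X (at 0) sequentially"
          using X by (auto simp: filterlim_at)
        ultimately show "(\<lambda>n. (f (y + h + X n *\<^sub>R e) - f (y + h)) / X n) \<longlonglongrightarrow> f' (y + h)"
          by (rule filterlim_compose)
      qed
      show "AE y in lborel. norm (v y * ((f (y + h + X n *\<^sub>R e) - f (y + h)) / X n)) \<le> B * \<bar>v y\<bar>" for n
        unfolding real_norm_def
      proof (intro AE_I2 v_mult_le)
        fix y assume y: "y \<in> K"
        have "\<bar>f (y + h + X n *\<^sub>R e) - f (y + h)\<bar> \<le> B * \<bar>X n\<bar>"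
        proof (rule directional_difference_bound[where w'=f'])
          show "((\<lambda>t. f (z + t *\<^sub>R e)) has_real_derivative f' z) (at 0)" for z
            unfolding f'_def by (rule smooth_directional_derivative[OF f])
          fix t assume "\<bar>t\<bar> \<le> \<bar>X n\<bar>"
          then have "norm (t *\<^sub>R e) \<le> R * norm e"
            using R[of n] by (simp add: mult_right_mono)
          then have "h + t *\<^sub>R e \<in> cball 0 (norm h + R * norm e)"
            using norm_triangle_ineq[of h "t *\<^sub>R e"] by simp
          then show "\<bar>f' (y + h + t *\<^sub>R e)\<bar> \<le> B" using B y by (metis add.assoc)
        qed
        then show "\<bar>(f (y + h + X n *\<^sub>R e) - f (y + h)) / X n\<bar> \<le> B"
          using X(1)[of n] by (simp add: divide_simps)
      qed
      show "(\<lambda>y. v y * ((f (y + h + X n *\<^sub>R e) - f (y + h)) / X n)) \<in> borel_measurable lborel" for n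
        unfolding add.assoc by measurable
      show "(\<lambda>y. v y * f' (y + h)) \<in> borel_measurable lborel" by measurable
      show "integrable lborel (\<lambda>y. B * \<bar>v y\<bar>)" using v_integrable by simp
    qed
    moreover have "(\<integral>y. v y * ((f (y + h + X n *\<^sub>R e) - f (y + h)) / X n) \<partial>lborel)
        = (pairing f (h + X n *\<^sub>R e) - pairing f h) / X n" for n
    proof -
      have "(\<integral>y. v y * ((f (y + h + X n *\<^sub>R e) - f (y + h)) / X n) \<partial>lborel)
          = (\<integral>y. (v y * f (y + (h + X n *\<^sub>R e)) - v y * f (y + h)) / X n \<partial>lborel)"
        by (simp add: right_diff_distrib add.assoc)
      then show ?thesis
        unfolding pairing_def by (simp add: pairing_integrable[OF fc])
    qed
    ultimately show ?thesis by (simp only: pairing_def)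
  qed
  then show ?thesis
    unfolding has_field_derivative_iff tendsto_at_iff_sequentially f'_def[symmetric]
    by (auto simp: o_def)
qed

text \<open>The integral of \<open>f\<close> against the convolution of \<open>v\<close> with the
  bump scaled to radius \<open>r\<close> and normalised, for positive \<open>r\<close>, with the
  kernel variable as outer variable.\<close>

definition smear :: "real \<Rightarrow> ('a \<Rightarrow> real) \<Rightarrow> real" where
  "smear r f = (\<integral>z. bump0 z * pairing f (r *\<^sub>R z) \<partial>lborel) / bump_mass TYPE('a)"

lemma pairing_scaled_continuous:
  "continuous_on UNIV f \<Longrightarrow> continuous_on UNIV (\<lambda>z. pairing f (r *\<^sub>R z))"
  by (rule continuous_on_compose2[OF pairing_continuous]) (auto intro!: continuous_intros)

lemma integrable_kernel_times:
  fixes g k :: "'a \<Rightarrow> real"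
  assumes g: "continuous_on UNIV g" and k: "k \<in> borel_measurable borel"
    and bound: "\<And>z. \<bar>k z\<bar> \<le> C * indicator (cball 0 1) z"
  shows "integrable lborel (\<lambda>z. k z * g z)"
proof -
  note [measurable] = borel_measurable_continuous_onI[OF g] k
  obtain B where B: "\<forall>y\<in>{0}. \<forall>z\<in>cball 0 1. \<bar>g (y + z)\<bar> \<le> B"
    using continuous_bounded_compact[OF g, of "{0}" 1] by auto
  show ?thesis
  proof (rule integrable_indicator_bound[of _ "C * B"])
    show "\<bar>k z * g z\<bar> \<le> C * B * indicator (cball 0 1) z" for z
    proof (cases "z \<in> cball 0 1")
      case True
      then have "\<bar>k z\<bar> \<le> C" "\<bar>g z\<bar> \<le> B" using bound[of z] B by auto
      then show ?thesis using True mult_mono[of "\<bar>k z\<bar>" C "\<bar>g z\<bar>" B] by (auto simp: abs_mult)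
    next
      case False
      then show ?thesis using bound[of z] by simp
    qed
  qed measurable
qed

lemma bump0_le: "\<bar>bump0 z\<bar> \<le> 1 * indicator (cball 0 1) z"
  using bump0_bounds[of z] by simp

lemma smear_integrable:
  "continuous_on UNIV f \<Longrightarrow> integrable lborel (\<lambda>z. bump0 z * pairing f (r *\<^sub>R z))"
  by (rule integrable_kernel_times[OF pairing_scaled_continuous _ bump0_le]) auto

lemma smear_add:
  assumes "continuous_on UNIV f" "continuous_on UNIV g"
  shows "smear r (\<lambda>x. f x + g x) = smear r f + smear r g"
  unfolding smear_def pairing_add[OF assms] distrib_left
  by (simp add: smear_integrable assms add_divide_distrib)

lemma smear_cmult: "smear r (\<lambda>x. c * f x) = c * smear r f"
  unfolding smear_def pairing_cmult by (simp add: mult.left_commute)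

lemma smear_sum:
  assumes "finite I" "\<And>i. i \<in> I \<Longrightarrow> continuous_on UNIV (f i)"
  shows "smear r (\<lambda>x. \<Sum>i\<in>I. f i x) = (\<Sum>i\<in>I. smear r (f i))"
  using assms
proof (induction I rule: finite_induct)
  case empty
  show ?case using smear_cmult[of r 0 "\<lambda>x. 0"] by simp
next
  case (insert i I)
  have "continuous_on UNIV (\<lambda>x. \<Sum>j\<in>I. f j x)" by (intro continuous_on_sum) (use insert in auto)
  then show ?case using insert by (simp add: smear_add)
qed

text \<open>Division by \<open>bump_mass\<close> makes the kernel a probability density, so
  averaging does not enlarge the bound for a single pairing. That only points within
  \<open>\<bar>r\<bar>\<close> of \<open>K\<close> enter will confine the support of the mollified
  current.\<close>

lemma smear_bound:
  assumes f: "continuous_on UNIV f"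
    and B: "\<And>y z. y \<in> K \<Longrightarrow> norm z \<le> \<bar>r\<bar> \<Longrightarrow> \<bar>f (y + z)\<bar> \<le> B"
  shows "\<bar>smear r f\<bar> \<le> B * L1"
proof -
  have p: "\<bar>bump0 z * pairing f (r *\<^sub>R z)\<bar> \<le> bump0 z * (B * L1)" for z
  proof (cases "z \<in> cball 0 1")
    case True
    then have "norm (r *\<^sub>R z) \<le> \<bar>r\<bar>" by (simp add: mult_left_le)
    then have "\<bar>pairing f (r *\<^sub>R z)\<bar> \<le> B * L1" by (intro pairing_bound[OF f] B)
    then show ?thesis using bump0_bounds(1)[of z] by (simp add: abs_mult mult_left_mono)
  next
    case False
    then show ?thesis using bump_zero[of z] by simp
  qed
  have "\<bar>\<integral>z. bump0 z * pairing f (r *\<^sub>R z) \<partial>lborel\<bar> \<le> (\<integral>z. \<bar>bump0 z * pairing f (r *\<^sub>R z)\<bar> \<partial>lborel)"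
    by (rule integral_abs_bound)
  also have "\<dots> \<le> (\<integral>z. bump0 (z :: 'a) * (B * L1) \<partial>lborel)"
    by (rule integral_mono[OF _ _ p])
       (auto intro!: integrable_abs smear_integrable[OF f] integrable_mult_left
         integrable_indicator_bound[OF _ bump0_le])
  also have "\<dots> = bump_mass TYPE('a) * (B * L1)" by (simp add: bump_mass_def)
  finally show ?thesis
    using bump_mass_pos[where 'a='a] by (simp add: smear_def abs_divide pos_divide_le_eq mult.commute)
qed

lemma smear_tendsto:
  assumes f: "continuous_on UNIV f" and r: "r \<longlonglongrightarrow> 0"
  shows "(\<lambda>n. smear (r n) f) \<longlonglongrightarrow> pairing f 0"
proof -
  obtain R where R: "\<And>n. \<bar>r n\<bar> \<le> R"
    using convergent_imp_Bseq[of r] r unfolding convergent_def Bseq_def real_norm_def by blast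
  obtain B where B: "\<forall>y\<in>{0}. \<forall>z\<in>cball 0 R. \<bar>pairing f (y + z)\<bar> \<le> B"
    using continuous_bounded_compact[OF pairing_continuous[OF f], of "{0}" R] by auto
  note [measurable] = borel_measurable_continuous_onI[OF pairing_continuous[OF f]]
  have "(\<lambda>n. \<integral>z. bump0 z * pairing f (r n *\<^sub>R z) \<partial>lborel) \<longlonglongrightarrow> (\<integral>z. bump0 (z :: 'a) * pairing f 0 \<partial>lborel)"
  proof (rule integral_dominated_convergence[where w="\<lambda>z :: 'a. bump0 z * B"])
    show "AE z in lborel. (\<lambda>n. bump0 z * pairing f (r n *\<^sub>R z)) \<longlonglongrightarrow> bump0 z * pairing f 0"
    proof (intro AE_I2 tendsto_mult tendsto_const)
      fix z :: 'a
      have "isCont (pairing f) 0" using pairing_continuous[OF f] by (simp add: continuous_on_eq_continuous_at)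
      moreover have "(\<lambda>n. r n *\<^sub>R z) \<longlonglongrightarrow> 0"
        using tendsto_scaleR[OF r, of "\<lambda>n. z" z] by simp
      ultimately show "(\<lambda>n. pairing f (r n *\<^sub>R z)) \<longlonglongrightarrow> pairing f 0" by (rule isCont_tendsto_compose)
    qed
    show "AE z in lborel. norm (bump0 z * pairing f (r n *\<^sub>R z)) \<le> bump0 z * B" for n
    proof (rule AE_I2)
      fix z
      show "norm (bump0 z * pairing f (r n *\<^sub>R z)) \<le> bump0 z * B"
      proof (cases "z \<in> cball 0 1")
        case True
        then have "norm (r n *\<^sub>R z) \<le> R" using order_trans[OF mult_left_le[of "norm z" "\<bar>r n\<bar>"] R[of n]] by simp
        then show ?thesis using B bump0_bounds(1)[of z] by (simp add: abs_mult mult_left_mono)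
      qed (use bump_zero[of z] in simp)
    qed
    show "integrable lborel (\<lambda>z :: 'a. bump0 z * B)"
      by (intro integrable_mult_left) (rule integrable_indicator_bound[OF _ bump0_le], simp)
  qed measurable
  then have "(\<lambda>n. smear (r n) f) \<longlonglongrightarrow> (\<integral>z. bump0 (z :: 'a) * pairing f 0 \<partial>lborel) / bump_mass TYPE('a)"
    unfolding smear_def by (intro tendsto_intros) (use bump_mass_pos[where 'a='a] in auto)
  then show ?thesis using bump_mass_pos[where 'a='a] by (simp add: bump_mass_def)
qed

text \<open>Integration by parts moves the derivative from the test function to the kernel.\<close>

lemma smear_deriv:
  assumes f: "smooth f"
  shows "r * smear r (\<lambda>x. frechet_derivative f (at x) e) * bump_mass TYPE('a) =
    - (\<integral>z. bump_deriv e z * (pairing f (r *\<^sub>R z) - pairing f 0) \<partial>lborel)"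
proof -
  define f' where "f' x = frechet_derivative f (at x) e" for x
  have f': "continuous_on UNIV f'"
    unfolding f'_def by (intro smooth_continuous_on smooth_frechet_derivative f)
  have fc: "continuous_on UNIV f" by (rule smooth_continuous_on[OF f])
  \<comment> \<open>Subtracting the constant leaves the derivative in \<open>z\<close> unchanged,
    while the term with \<open>bump_deriv\<close> then contains only differences of
    pairings.\<close>
  define g where "g z = pairing f (r *\<^sub>R z) - pairing f 0" for z
  have g: "continuous_on UNIV g"
    unfolding g_def by (intro continuous_intros pairing_scaled_continuous fc)
  define w' where "w' z = bump_deriv e z * g z + r * (bump0 z * pairing f' (r *\<^sub>R z))" for z
  have "(\<integral>z. w' z \<partial>lborel) = 0"
  proof (rule integral_directional_derivative_zero[where w="\<lambda>z. bump0 z * g z" and e=e])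
    show "continuous_on UNIV (\<lambda>z. bump0 z * g z)" by (intro continuous_intros bump0_continuous g)
    show "continuous_on UNIV w'"
      unfolding w'_def by (intro continuous_intros bump0_continuous bump_deriv_continuous g pairing_scaled_continuous f')
    show "bump0 z * g z = 0 \<and> w' z = 0" if "z \<notin> cball 0 1" for z
      using bump_zero[OF that] by (simp add: w'_def)
    fix z :: 'a
    have "((\<lambda>t. pairing f (r *\<^sub>R z + t *\<^sub>R (r *\<^sub>R e)) - pairing f 0) has_real_derivative
        pairing (\<lambda>x. frechet_derivative f (at x) (r *\<^sub>R e)) (r *\<^sub>R z)) (at 0)"
      using DERIV_diff[OF pairing_directional_derivative[OF f, of "r *\<^sub>R z" "r *\<^sub>R e"] DERIV_const[of "pairing f 0"]] by simp
    moreover have "frechet_derivative f (at x) (r *\<^sub>R e) = r * f' x" for x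
      unfolding f'_def by (simp add: f linear_cmul linear_frechet_derivative smooth_differentiable)
    ultimately have "((\<lambda>t. g (z + t *\<^sub>R e)) has_real_derivative r * pairing f' (r *\<^sub>R z)) (at 0)"
      by (simp add: g_def scaleR_add_right pairing_cmult mult.commute)
    from DERIV_mult[OF bump_has_derivative this, of z e]
    show "((\<lambda>t. bump0 (z + t *\<^sub>R e) * g (z + t *\<^sub>R e)) has_real_derivative w' z) (at 0)"
      by (simp add: w'_def mult_ac add.commute)
  qed
  moreover have "(\<integral>z. w' z \<partial>lborel) = (\<integral>z. bump_deriv e z * g z \<partial>lborel) +
      r * (\<integral>z. bump0 z * pairing f' (r *\<^sub>R z) \<partial>lborel)"
    unfolding w'_def
    by (subst Bochner_Integration.integral_add)
       (auto intro!: integrable_mult_right smear_integrable f' integrable_kernel_times[OF g _ bump_deriv_bound])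
  ultimately show ?thesis
    using bump_mass_pos[where 'a='a] by (simp add: smear_def g_def f'_def[symmetric])
qed

end

section \<open>Average oscillation over dyadic scales\<close>

text \<open>The terms at least double, so a sum up to some term is at most twice that term, and the
  last term counted is at most \<open>c\<close>.\<close>

lemma doubling_sum_le:
  fixes b :: "nat \<Rightarrow> real"
  assumes b: "\<And>k. 0 < b k" "\<And>k. 2 * b k \<le> b (Suc k)" and c: "0 \<le> c"
  shows "(\<Sum>k<n. if b k \<le> c then b k else 0) \<le> 2 * c"
proof -
  have mono: "b i \<le> b j" if "i \<le> j" for i j
    by (rule lift_Suc_mono_le[OF _ that]) (use b in \<open>smt (verit)\<close>)
  have geom: "(\<Sum>k<Suc n. b k) \<le> 2 * b n" for n
  proof (induction n)
    case 0 then show ?case using b(1)[of 0] by simp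
  next
    case (Suc n) then show ?case using b(2)[of n] by simp
  qed
  show ?thesis
  proof (induction n)
    case 0 then show ?case using c by simp
  next
    case (Suc n)
    show ?case
    proof (cases "b n \<le> c")
      case True
      then have "b k \<le> c" if "k \<le> n" for k using mono[OF that] by simp
      then have "(\<Sum>k<Suc n. if b k \<le> c then b k else 0) = (\<Sum>k<Suc n. b k)"
        by (intro sum.cong) auto
      then show ?thesis using geom[of n] True by simp
    next
      case False
      then show ?thesis using Suc by simp
    qed
  qed
qed

context compact_integrable
begin

definition osc :: "'a \<Rightarrow> real" where
  "osc h = enn2real (shift_diff v h)"

text \<open>The mean of \<open>osc\<close> over the ball of radius \<open>r\<close>, up to the
  volume of the unit ball.\<close>

definition avg_osc :: "real \<Rightarrow> real" where
  "avg_osc r = (\<integral>z. indicator (cball 0 1) z * osc (r *\<^sub>R z) \<partial>lborel)"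

lemma shift_diff_le: "shift_diff v h \<le> ennreal (2 * L1)"
proof -
  have v': "integrable lborel (\<lambda>x. v (x - h))"
    using integrable_lborel_translate[OF v_measurable v_integrable, of "- h"] by simp
  have "shift_diff v h \<le> (\<integral>\<^sup>+x. ennreal (\<bar>v (x - h)\<bar> + \<bar>v x\<bar>) \<partial>lborel)"
    unfolding shift_diff_def by (intro nn_integral_mono ennreal_leI) (simp add: abs_triangle_ineq4)
  also have "\<dots> = ennreal (\<integral>x. \<bar>v (x - h)\<bar> + \<bar>v x\<bar> \<partial>lborel)"
    by (rule nn_integral_eq_integral) (use v' v_integrable in auto)
  also have "(\<integral>x. \<bar>v (x - h)\<bar> + \<bar>v x\<bar> \<partial>lborel) = 2 * L1"
    using integral_lborel_translate[of "\<lambda>x. \<bar>v x\<bar>" "- h"] v' v_integrable by (simp add: L1_def)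
  finally show ?thesis .
qed

lemma shift_diff_osc: "shift_diff v h = ennreal (osc h)"
  using shift_diff_le[of h] unfolding osc_def by (metis ennreal_enn2real ennreal_less_top le_less_trans)

lemma osc_bounds: "0 \<le> osc h" "osc h \<le> 2 * L1"
proof -
  show "0 \<le> osc h" by (simp add: osc_def)
  show "osc h \<le> 2 * L1"
    using shift_diff_le[of h] L1_nonneg unfolding shift_diff_osc by (simp add: ennreal_le_iff)
qed

lemma osc_measurable [measurable]: "osc \<in> borel_measurable borel"
  unfolding osc_def[abs_def] by measurable

text \<open>Translation invariance puts the shift back on \<open>v\<close>; what multiplies
  \<open>f\<close> is then the integrand of \<open>shift_diff\<close>.\<close>

lemma pairing_diff_le_osc:
  assumes f: "continuous_on UNIV f" and f1: "\<And>x. \<bar>f x\<bar> \<le> 1"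
  shows "\<bar>pairing f h - pairing f 0\<bar> \<le> osc h"
proof -
  note [measurable] = borel_measurable_continuous_onI[OF f]
  have v': "integrable lborel (\<lambda>x. v (x - h))"
    using integrable_lborel_translate[OF v_measurable v_integrable, of "- h"] by simp
  have i: "integrable lborel (\<lambda>x. u x * f x)" if "integrable lborel u" "u \<in> borel_measurable borel" for u :: "'a \<Rightarrow> real"
    by (rule Bochner_Integration.integrable_bound[OF that(1)])
       (use that(2) f1 in \<open>auto simp: abs_mult intro!: mult_left_le\<close>)
  have "pairing f h = (\<integral>x. v (x - h) * f x \<partial>lborel)"
    unfolding pairing_def using integral_lborel_translate[of "\<lambda>x. v (x - h) * f x" h] by simp
  then have "pairing f h - pairing f 0 = (\<integral>x. v (x - h) * f x - v x * f x \<partial>lborel)"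
    using i[OF v'] i[OF v_integrable v_measurable] by (simp add: pairing_def)
  also have "\<bar>\<dots>\<bar> \<le> (\<integral>x. \<bar>v (x - h) * f x - v x * f x\<bar> \<partial>lborel)" by (rule integral_abs_bound)
  also have "\<dots> \<le> (\<integral>x. \<bar>v (x - h) - v x\<bar> \<partial>lborel)"
  proof (rule integral_mono)
    show "\<bar>v (x - h) * f x - v x * f x\<bar> \<le> \<bar>v (x - h) - v x\<bar>" for x
      unfolding left_diff_distrib[symmetric] abs_mult by (rule mult_left_le[OF f1]) simp
  qed (use v' v_integrable i[OF v'] i[OF v_integrable v_measurable] in auto)
  also have "\<dots> = osc h"
    unfolding osc_def shift_diff_def
    by (rule integral_eq_nn_integral) auto
  finally show ?thesis .
qed

lemma avg_osc_integrable: "integrable lborel (\<lambda>z. indicator (cball 0 1) z * osc (r *\<^sub>R z))"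
  by (rule integrable_indicator_bound[of _ "2 * L1"])
     (use osc_bounds L1_nonneg in \<open>auto simp: abs_mult indicator_def\<close>)

lemma avg_osc_nonneg: "0 \<le> avg_osc r"
  unfolding avg_osc_def by (intro Bochner_Integration.integral_nonneg) (use osc_bounds in auto)

lemma avg_osc_le: "avg_osc r \<le> 2 * L1 * measure lborel (cball (0 :: 'a) 1)"
proof -
  have "avg_osc r \<le> (\<integral>z. 2 * L1 * indicator (cball (0 :: 'a) 1) z \<partial>lborel)"
    unfolding avg_osc_def
  proof (rule integral_mono[OF avg_osc_integrable])
    show "integrable lborel (\<lambda>z. 2 * L1 * indicator (cball (0 :: 'a) 1) z)"
      by (intro integrable_mult_right integrable_real_indicator) (auto simp: emeasure_cball)
  qed (use osc_bounds in \<open>auto simp: indicator_def\<close>)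
  then show ?thesis by simp
qed

text \<open>Used for both kernels: \<open>bump0\<close> gives the error of mollification,
  \<open>bump_deriv\<close> the boundary mass.\<close>

lemma abs_integral_kernel_le:
  assumes f: "continuous_on UNIV f" and f1: "\<And>x. \<bar>f x\<bar> \<le> 1"
    and k: "k \<in> borel_measurable borel" "\<And>z. \<bar>k z\<bar> \<le> C * indicator (cball 0 1) z"
  shows "\<bar>\<integral>z. k z * (pairing f (r *\<^sub>R z) - pairing f 0) \<partial>lborel\<bar> \<le> C * avg_osc r"
proof -
  have "\<bar>\<integral>z. k z * (pairing f (r *\<^sub>R z) - pairing f 0) \<partial>lborel\<bar>
      \<le> (\<integral>z. \<bar>k z * (pairing f (r *\<^sub>R z) - pairing f 0)\<bar> \<partial>lborel)"
    by (rule integral_abs_bound)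
  also have "\<dots> \<le> (\<integral>z. C * (indicator (cball 0 1) z * osc (r *\<^sub>R z)) \<partial>lborel)"
  proof (rule integral_mono)
    show "integrable lborel (\<lambda>z. \<bar>k z * (pairing f (r *\<^sub>R z) - pairing f 0)\<bar>)"
      by (intro integrable_abs integrable_kernel_times[OF _ k] continuous_intros pairing_scaled_continuous f)
    show "integrable lborel (\<lambda>z. C * (indicator (cball 0 1) z * osc (r *\<^sub>R z)))"
      by (intro integrable_mult_right avg_osc_integrable)
    fix z
    have "\<bar>k z * (pairing f (r *\<^sub>R z) - pairing f 0)\<bar> \<le> (C * indicator (cball 0 1) z) * osc (r *\<^sub>R z)"
      unfolding abs_mult using k(2)[of z]
      by (intro mult_mono pairing_diff_le_osc f f1) (auto intro: order_trans[OF abs_ge_zero])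
    then show "\<bar>k z * (pairing f (r *\<^sub>R z) - pairing f 0)\<bar> \<le> C * (indicator (cball 0 1) z * osc (r *\<^sub>R z))"
      by (simp add: mult.assoc)
  qed
  also have "\<dots> = C * avg_osc r" by (simp add: avg_osc_def)
  finally show ?thesis .
qed

lemma smear_diff_le:
  assumes f: "continuous_on UNIV f" and f1: "\<And>x. \<bar>f x\<bar> \<le> 1"
  shows "\<bar>smear r f - pairing f 0\<bar> \<le> avg_osc r / bump_mass TYPE('a)"
proof -
  have "(\<integral>z. bump0 z * (pairing f (r *\<^sub>R z) - pairing f 0) \<partial>lborel)
      = (\<integral>z. bump0 z * pairing f (r *\<^sub>R z) \<partial>lborel) - bump_mass TYPE('a) * pairing f 0"
    unfolding right_diff_distrib bump_mass_def
    by (subst Bochner_Integration.integral_diff)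
       (auto intro!: smear_integrable f integrable_mult_left integrable_indicator_bound[OF _ bump0_le])
  then have "smear r f - pairing f 0 =
      (\<integral>z. bump0 z * (pairing f (r *\<^sub>R z) - pairing f 0) \<partial>lborel) / bump_mass TYPE('a)"
    using bump_mass_pos[where 'a='a] by (simp add: smear_def diff_divide_distrib)
  then show ?thesis
    using abs_integral_kernel_le[OF f f1 bump0_measurable bump0_le, of r] bump_mass_pos[where 'a='a]
    by (simp add: abs_divide divide_right_mono)
qed

lemma smear_deriv_le:
  assumes f: "smooth f" and f1: "\<And>x. \<bar>f x\<bar> \<le> 1" and r: "0 < r"
  shows "\<bar>smear r (\<lambda>x. frechet_derivative f (at x) e)\<bar> \<le> 4 * norm e * (avg_osc r / r) / bump_mass TYPE('a)"
proof -
  let ?s = "smear r (\<lambda>x. frechet_derivative f (at x) e)"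
  have "r * bump_mass TYPE('a) * \<bar>?s\<bar> = \<bar>r * ?s * bump_mass TYPE('a)\<bar>"
    using r bump_mass_pos[where 'a='a] by (simp add: abs_mult)
  also have "\<dots> \<le> 4 * norm e * avg_osc r"
    unfolding smear_deriv[OF f]
    using abs_integral_kernel_le[OF smooth_continuous_on[OF f] f1 bump_deriv_measurable bump_deriv_bound]
    by simp
  finally show ?thesis
    using r bump_mass_pos[where 'a='a] by (simp add: field_simps)
qed

text \<open>Substitute \<open>h = r *\<^sub>R z\<close>: the volume factor and the weight combine to
  the power \<open>\<alpha> - 1\<close> of \<open>r\<close>. The weighted average becomes a Sobolev
  integral whose kernel is frozen at its value on the sphere of radius \<open>r\<close> and cut off
  there.\<close>

lemma avg_osc_scaled:
  assumes r: "0 < r"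
  shows "ennreal (avg_osc r * r powr (\<alpha> - 1)) =
    (\<integral>\<^sup>+h. ennreal (indicator (cball 0 r) h * r powr (- (real DIM('a) + 1 - \<alpha>))) * shift_diff v h \<partial>lborel)"
proof -
  let ?s = "real DIM('a) + 1 - \<alpha>"
  have "(\<lambda>h. ennreal (indicator (cball 0 r) h * r powr (- ?s)) * shift_diff v h) \<in> borel_measurable borel"
    by (intro borel_measurable_times_ennreal measurable_compose[OF _ measurable_ennreal] borel_measurable_times
        borel_measurable_indicator borel_closed closed_cball borel_measurable_const
        borel_measurable_shift_diff v_measurable)
  from nn_integral_lborel_affine[OF this, of r 0] r
  have "(\<integral>\<^sup>+h. ennreal (indicator (cball 0 r) h * r powr (- ?s)) * shift_diff v h \<partial>lborel)
     = ennreal (r ^ DIM('a)) * (\<integral>\<^sup>+z. ennreal (indicator (cball 0 r) (r *\<^sub>R z) * r powr (- ?s)) * shift_diff v (r *\<^sub>R z) \<partial>lborel)"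
    by simp
  also have "(\<integral>\<^sup>+z. ennreal (indicator (cball 0 r) (r *\<^sub>R z) * r powr (- ?s)) * shift_diff v (r *\<^sub>R z) \<partial>lborel)
     = (\<integral>\<^sup>+z. ennreal (r powr (- ?s)) * ennreal (indicator (cball 0 1) z * osc (r *\<^sub>R z)) \<partial>lborel)"
    using r osc_bounds
    by (intro nn_integral_cong) (auto simp: shift_diff_osc indicator_def ennreal_mult[symmetric])
  also have "\<dots> = ennreal (r powr (- ?s)) * (\<integral>\<^sup>+z. ennreal (indicator (cball 0 1) z * osc (r *\<^sub>R z)) \<partial>lborel)"
    by (rule nn_integral_cmult)
       (intro measurable_compose[OF borel_measurable_integrable[OF avg_osc_integrable] measurable_ennreal])
  also have "(\<integral>\<^sup>+z. ennreal (indicator (cball 0 1) z * osc (r *\<^sub>R z)) \<partial>lborel) = ennreal (avg_osc r)"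
    unfolding avg_osc_def
    by (rule nn_integral_eq_integral[OF avg_osc_integrable]) (use osc_bounds in auto)
  also have "ennreal (r ^ DIM('a)) * (ennreal (r powr (- ?s)) * ennreal (avg_osc r))
     = ennreal (r ^ DIM('a) * (r powr (- ?s) * avg_osc r))"
    using r avg_osc_nonneg by (simp add: ennreal_mult)
  also have "r ^ DIM('a) * (r powr (- ?s) * avg_osc r) = avg_osc r * r powr (\<alpha> - 1)"
  proof -
    have "r ^ DIM('a) * r powr (- ?s) = r powr (real DIM('a) + - ?s)"
      using r by (simp only: powr_add powr_realpow)
    also have "real DIM('a) + - ?s = \<alpha> - 1" by simp
    finally show ?thesis by (simp add: mult.assoc[symmetric] mult.commute)
  qed
  finally show ?thesis by simp
qed

text \<open>After the substitution the claim is a pointwise bound for the sum of the weights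
  \<open>b k\<close> over those \<open>k\<close> with \<open>norm h \<le> r k\<close>. As
  \<open>s > 1\<close>, halving the radius at least doubles the weight; the weights counted are
  those at most \<open>norm h powr (- s)\<close>, so their sum is at most twice that.\<close>

lemma dyadic_avg_osc_sum:
  assumes \<alpha>: "0 < \<alpha>" "\<alpha> < 1" and R: "0 < R"
  shows "(\<Sum>k. ennreal (avg_osc (R / 2 ^ k) * (R / 2 ^ k) powr (\<alpha> - 1))) \<le>
    2 * (\<integral>\<^sup>+h. shift_diff v h * ennreal (1 / norm h powr (real DIM('a) + 1 - \<alpha>)) \<partial>lborel)"
proof -
  define s where "s = real DIM('a) + 1 - \<alpha>"
  have "1 \<le> real DIM('a)" using DIM_positive[where 'a='a] by simp
  then have s: "1 < s" unfolding s_def using \<alpha> by linarith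
  define r where "r k = R / 2 ^ k" for k
  have r: "0 < r k" for k using R by (simp add: r_def)
  define b where "b k = r k powr (- s)" for k
  have b: "0 < b k" for k using r[of k] by (simp add: b_def)
  have b2: "2 * b k \<le> b (Suc k)" for k
  proof -
    have "b (Suc k) = (r k * (1/2)) powr (- s)" by (simp add: b_def r_def mult.commute)
    also have "\<dots> = b k * 2 powr s"
      using r[of k] by (simp add: b_def powr_mult powr_divide powr_minus_divide)
    also have "\<dots> \<ge> b k * 2 powr 1"
      using s b[of k] by (intro mult_left_mono powr_mono) auto
    finally show ?thesis by simp
  qed
  have pt: "(\<Sum>k. ennreal (indicator (cball 0 (r k)) h * b k)) \<le> ennreal (2 * (1 / norm h powr s))"
    if h: "h \<noteq> 0" for h :: 'a
  proof (rule suminf_le_const[OF summableI])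
    fix n
    have iff: "norm h \<le> r k \<longleftrightarrow> b k \<le> norm h powr (- s)" for k
    proof
      show "b k \<le> norm h powr (- s)" if "norm h \<le> r k"
        unfolding b_def using powr_mono2'[of "- s" "norm h" "r k"] that h s by simp
      show "norm h \<le> r k" if "b k \<le> norm h powr (- s)"
        using powr_less_mono2_neg[of "- s" "r k" "norm h"] that r[of k] s unfolding b_def by linarith
    qed
    have "(\<Sum>k<n. ennreal (indicator (cball 0 (r k)) h * b k))
        = ennreal (\<Sum>k<n. indicator (cball 0 (r k)) h * b k)"
      using b by (intro sum_ennreal) (simp add: less_imp_le)
    also have "(\<Sum>k<n. indicator (cball 0 (r k)) h * b k)
        = (\<Sum>k<n. if b k \<le> norm h powr (- s) then b k else 0)"
      by (intro sum.cong) (auto simp: indicator_def iff)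
    also have "ennreal \<dots> \<le> ennreal (2 * (norm h powr (- s)))"
      by (intro ennreal_leI doubling_sum_le b b2) simp
    finally show "(\<Sum>k<n. ennreal (indicator (cball 0 (r k)) h * b k)) \<le> ennreal (2 * (1 / norm h powr s))"
      by (simp add: powr_minus_divide)
  qed
  have "(\<Sum>k. ennreal (avg_osc (r k) * r k powr (\<alpha> - 1)))
      = (\<Sum>k. \<integral>\<^sup>+h. ennreal (indicator (cball 0 (r k)) h * b k) * shift_diff v h \<partial>lborel)"
    unfolding avg_osc_scaled[OF r] b_def s_def ..
  also have "\<dots> = (\<integral>\<^sup>+h. (\<Sum>k. ennreal (indicator (cball 0 (r k)) h * b k) * shift_diff v h) \<partial>lborel)"
    by (rule nn_integral_suminf[symmetric], simp)
       (intro borel_measurable_times_ennreal measurable_compose[OF _ measurable_ennreal] borel_measurable_times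
        borel_measurable_indicator borel_closed closed_cball borel_measurable_const
        borel_measurable_shift_diff v_measurable)
  also have "\<dots> \<le> (\<integral>\<^sup>+h. 2 * (shift_diff v h * ennreal (1 / norm h powr s)) \<partial>lborel)"
  proof (rule nn_integral_mono_AE)
    \<comment> \<open>The bound \<open>pt\<close> fails at 0, where the quotient by zero makes its
      right side 0; this is a null set.\<close>
    have "AE h in lborel. h \<noteq> (0 :: 'a)" by (rule AE_lborel_singleton)
    then show "AE h in lborel. (\<Sum>k. ennreal (indicator (cball 0 (r k)) h * b k) * shift_diff v h)
        \<le> 2 * (shift_diff v h * ennreal (1 / norm h powr s))"
    proof eventually_elim
      case (elim h)
      have "(\<Sum>k. ennreal (indicator (cball 0 (r k)) h * b k) * shift_diff v h)
          = (\<Sum>k. ennreal (indicator (cball 0 (r k)) h * b k)) * shift_diff v h" by simp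
      also have "\<dots> \<le> ennreal (2 * (1 / norm h powr s)) * shift_diff v h"
        by (intro mult_right_mono pt elim) simp
      also have "\<dots> = 2 * (shift_diff v h * ennreal (1 / norm h powr s))"
        by (subst ennreal_mult) (auto simp: mult_ac)
      finally show ?case .
    qed
  qed
  also have "\<dots> = 2 * (\<integral>\<^sup>+h. shift_diff v h * ennreal (1 / norm h powr s) \<partial>lborel)"
    by (rule nn_integral_cmult) measurable
  finally show ?thesis by (simp add: r_def s_def)
qed

end

section \<open>Mollified currents and their dyadic decomposition\<close>

lemma covector_add: "covector m \<phi> \<Longrightarrow> covector m \<psi> \<Longrightarrow> covector m (\<lambda>vs. \<phi> vs + \<psi> vs)"
  unfolding covector_def linear_iff by (simp add: algebra_simps)

lemma smooth_forms_add:
  "\<omega> \<in> smooth_forms m \<Longrightarrow> \<eta> \<in> smooth_forms m \<Longrightarrow> (\<lambda>x vs. \<omega> x vs + \<eta> x vs) \<in> smooth_forms m"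
  unfolding smooth_forms_def by (auto intro: covector_add smooth_add)

text \<open>Linear functionals of order zero that depend only on the coefficient at
  \<open>vs\<close> over \<open>K\<close>. This one property yields continuity in
  \<open>form_topology\<close> as well as the location of the support.\<close>

definition controlled :: "nat \<Rightarrow> 'a::euclidean_space set \<Rightarrow> 'a list \<Rightarrow> 'a current \<Rightarrow> bool" where
  "controlled m K vs T \<longleftrightarrow>
     (\<forall>\<omega>\<in>smooth_forms m. \<forall>\<eta>\<in>smooth_forms m. T (\<lambda>x vs. \<omega> x vs + \<eta> x vs) = T \<omega> + T \<eta>) \<and>
     (\<forall>c. \<forall>\<omega>\<in>smooth_forms m. T (\<lambda>x vs. c * \<omega> x vs) = c * T \<omega>) \<and>
     (\<exists>C\<ge>0. \<forall>\<omega>\<in>smooth_forms m. \<forall>B. (\<forall>x\<in>K. \<bar>\<omega> x vs\<bar> \<le> B) \<longrightarrow> \<bar>T \<omega>\<bar> \<le> B * C)"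

lemma controlledE:
  assumes "controlled m K vs T"
  obtains C where "0 \<le> C"
    "\<And>\<omega> B. \<omega> \<in> smooth_forms m \<Longrightarrow> \<forall>x\<in>K. \<bar>\<omega> x vs\<bar> \<le> B \<Longrightarrow> \<bar>T \<omega>\<bar> \<le> B * C"
  using assms unfolding controlled_def by (elim conjE exE) blast

lemma controlled_diff:
  assumes "controlled m K vs S" "controlled m K vs T"
  shows "controlled m K vs (\<lambda>\<omega>. S \<omega> - T \<omega>)"
proof -
  obtain C where "0 \<le> C"
    and C: "\<And>\<omega> B. \<omega> \<in> smooth_forms m \<Longrightarrow> \<forall>x\<in>K. \<bar>\<omega> x vs\<bar> \<le> B \<Longrightarrow> \<bar>S \<omega>\<bar> \<le> B * C"
    using controlledE[OF assms(1)] by metis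
  moreover obtain D where "0 \<le> D"
    and D: "\<And>\<omega> B. \<omega> \<in> smooth_forms m \<Longrightarrow> \<forall>x\<in>K. \<bar>\<omega> x vs\<bar> \<le> B \<Longrightarrow> \<bar>T \<omega>\<bar> \<le> B * D"
    using controlledE[OF assms(2)] by metis
  moreover have "\<bar>S \<omega> - T \<omega>\<bar> \<le> B * (C + D)"
    if "\<omega> \<in> smooth_forms m" "\<forall>x\<in>K. \<bar>\<omega> x vs\<bar> \<le> B" for \<omega> B
    using C[OF that] D[OF that] by (simp add: distrib_left)
  ultimately have "\<exists>C\<ge>0. \<forall>\<omega>\<in>smooth_forms m. \<forall>B. (\<forall>x\<in>K. \<bar>\<omega> x vs\<bar> \<le> B) \<longrightarrow> \<bar>S \<omega> - T \<omega>\<bar> \<le> B * C"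
    by (intro exI[of _ "C + D"]) auto
  then show ?thesis using assms unfolding controlled_def by (simp add: algebra_simps)
qed

lemma controlled_current:
  assumes T: "controlled m K vs T" and K: "compact K"
  shows "current m T"
proof -
  have add: "T (\<lambda>x vs. \<omega> x vs + \<eta> x vs) = T \<omega> + T \<eta>"
    if "\<omega> \<in> smooth_forms m" "\<eta> \<in> smooth_forms m" for \<omega> \<eta>
    using T that unfolding controlled_def by blast
  have hom: "T (\<lambda>x vs. c * \<omega> x vs) = c * T \<omega>" if "\<omega> \<in> smooth_forms m" for c \<omega>
    using T that unfolding controlled_def by blast
  obtain C where C0: "0 \<le> C"
    and C: "\<And>\<omega> B. \<omega> \<in> smooth_forms m \<Longrightarrow> \<forall>x\<in>K. \<bar>\<omega> x vs\<bar> \<le> B \<Longrightarrow> \<bar>T \<omega>\<bar> \<le> B * C"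
    using controlledE[OF T] by metis
  have "continuous_map (form_topology m) euclideanreal T"
    unfolding continuous_map_def
  proof (intro conjI allI impI)
    fix U :: "real set" assume "openin euclideanreal U"
    then have U: "open U" by simp
    show "openin (form_topology m) {\<omega> \<in> topspace (form_topology m). T \<omega> \<in> U}"
    proof (subst openin_subopen, intro ballI)
      fix \<omega> assume "\<omega> \<in> {\<omega> \<in> topspace (form_topology m). T \<omega> \<in> U}"
      then have w: "\<omega> \<in> smooth_forms m" and "T \<omega> \<in> U"
        unfolding form_topology_def topology_generated_by_topspace by auto
      then obtain e where e: "0 < e" "ball (T \<omega>) e \<subseteq> U" using U open_contains_ball by blast
      \<comment> \<open>A basic neighbourhood that involves no derivative. The summand 1 in the
        denominator admits \<open>C = 0\<close> and makes the final inequality strict.\<close>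
      define W where "W = {\<eta> \<in> smooth_forms m. \<forall>x\<in>K.
         \<bar>iter_deriv [] (\<lambda>y. \<eta> y vs) x - iter_deriv [] (\<lambda>y. \<omega> y vs) x\<bar> < e / (C + 1)}"
      have "openin (form_topology m) W"
        unfolding form_topology_def
      proof (rule topology_generated_by_Basis, unfold W_def mem_Collect_eq)
        show "\<exists>\<omega>' K' us vs' \<epsilon>. {\<eta> \<in> smooth_forms m. \<forall>x\<in>K.
             \<bar>iter_deriv [] (\<lambda>y. \<eta> y vs) x - iter_deriv [] (\<lambda>y. \<omega> y vs) x\<bar> < e / (C + 1)} =
           {\<eta> \<in> smooth_forms m. \<forall>x\<in>K'.
             \<bar>iter_deriv us (\<lambda>y. \<eta> y vs') x - iter_deriv us (\<lambda>y. \<omega>' y vs') x\<bar> < \<epsilon>} \<and>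
           \<omega>' \<in> smooth_forms m \<and> compact K' \<and> 0 < \<epsilon>"
          by (rule exI[of _ \<omega>], rule exI[of _ K], rule exI[of _ "[]"], rule exI[of _ vs],
              rule exI[of _ "e / (C + 1)"]) (use w K e C0 in simp)
      qed
      moreover have "\<omega> \<in> W" using w e C0 by (simp add: W_def)
      moreover have "T \<eta> \<in> U" if eta: "\<eta> \<in> W" for \<eta>
      proof -
        have es: "\<eta> \<in> smooth_forms m" using eta by (simp add: W_def)
        have "T \<eta> - T \<omega> = T (\<lambda>x vs. \<eta> x vs + (-1) * \<omega> x vs)"
          unfolding add[OF es smooth_forms_scale[OF w, of "-1"]] hom[OF w, of "-1"] by simp
        also have "\<bar>\<dots>\<bar> \<le> e / (C + 1) * C"
          by (rule C[OF smooth_forms_add[OF es smooth_forms_scale[OF w]]])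
             (use eta in \<open>auto simp: W_def less_imp_le\<close>)
        also have "\<dots> < e" using e C0 by (simp add: field_simps)
        finally show ?thesis using e(2) by (auto simp: dist_real_def abs_minus_commute)
      qed
      ultimately show "\<exists>W. openin (form_topology m) W \<and> \<omega> \<in> W \<and> W \<subseteq> {\<omega> \<in> topspace (form_topology m). T \<omega> \<in> U}"
        using openin_subset by blast
    qed
  qed simp
  then show ?thesis unfolding current_def using add hom by blast
qed

text \<open>A form supported off \<open>K\<close> has zero coefficient on \<open>K\<close>, so the
  bound applies with \<open>B = 0\<close>.\<close>

lemma controlled_support:
  assumes T: "controlled m K vs T" and K: "compact K"
  shows "current_support m T \<subseteq> K"
proof -
  obtain C where C: "\<And>\<omega> B. \<omega> \<in> smooth_forms m \<Longrightarrow> \<forall>x\<in>K. \<bar>\<omega> x vs\<bar> \<le> B \<Longrightarrow> \<bar>T \<omega>\<bar> \<le> B * C"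
    using controlledE[OF T] by metis
  have "T \<omega> = 0" if w: "\<omega> \<in> smooth_forms m" "form_support \<omega> \<subseteq> - K" for \<omega>
  proof -
    have "\<omega> x vs = 0" if "x \<in> K" for x
      using w(2) that closure_subset[of "{x. \<exists>vs. \<omega> x vs \<noteq> 0}"] unfolding form_support_def by auto
    then show ?thesis using C[OF w(1), of 0] by simp
  qed
  moreover have "open (- K)" using K by (simp add: compact_imp_closed open_Compl)
  ultimately have "- K \<subseteq> \<Union>{U. open U \<and> (\<forall>\<omega>\<in>smooth_forms m. form_support \<omega> \<subseteq> U \<longrightarrow> T \<omega> = 0)}"
    by blast
  then show ?thesis unfolding current_support_def by blast
qed

lemma enn2real_le: "x \<le> ennreal c \<Longrightarrow> 0 \<le> c \<Longrightarrow> enn2real x \<le> c"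
  by (metis enn2real_ennreal enn2real_mono ennreal_less_top)

text \<open>In the applications \<open>y\<close> bounds the mass and \<open>q\<close> is a multiple
  of the inverse scale. The exponents of \<open>y\<close> add up to 1, so the product is linear in
  the oscillation.\<close>

lemma powr_interpolation:
  fixes M B y q \<alpha> :: real
  assumes "0 < \<alpha>" "\<alpha> < 1" "0 \<le> M" "M \<le> y" "0 \<le> B" "B \<le> y * q" "0 \<le> q"
  shows "B powr (1 - \<alpha>) * M powr \<alpha> \<le> y * q powr (1 - \<alpha>)"
proof -
  have "B powr (1 - \<alpha>) * M powr \<alpha> \<le> (y * q) powr (1 - \<alpha>) * y powr \<alpha>"
    using assms by (intro mult_mono powr_mono2) auto
  also have "\<dots> = (y powr (1 - \<alpha>) * y powr \<alpha>) * q powr (1 - \<alpha>)"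
    using assms by (simp add: powr_mult)
  also have "y powr (1 - \<alpha>) * y powr \<alpha> = y"
    using assms by (simp add: powr_add[symmetric])
  finally show ?thesis .
qed

text \<open>One constant for two estimates: \<open>1 / bump_mass\<close> for the error of
  mollification, and for the boundary one directional derivative per coordinate, each with kernel
  bound 4.\<close>

definition bump_constant :: "'n::finite itself \<Rightarrow> real" where
  "bump_constant _ = 4 * real CARD('n) / bump_mass TYPE((real, 'n) vec)"

section \<open>Mass and boundary mass of the mollified currents\<close>

locale compact_integrable_cart = compact_integrable v K
  for v :: "(real, 'n::{finite,linorder}) vec \<Rightarrow> real" and K
begin

definition smear_current :: "real \<Rightarrow> (real, 'n) vec current" where
  "smear_current r \<omega> = smear r (\<lambda>x. \<omega> x std_basis)"

definition enlarged :: "real \<Rightarrow> (real, 'n) vec set" where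
  "enlarged R = {y + z | y z. y \<in> K \<and> z \<in> cball 0 R}"

lemma compact_enlarged: "compact (enlarged R)"
  unfolding enlarged_def by (rule compact_sums[OF K compact_cball])

lemma coeff_continuous: "\<omega> \<in> smooth_forms m \<Longrightarrow> continuous_on UNIV (\<lambda>x. \<omega> x vs)"
  by (intro smooth_continuous_on smooth_formsD(2))

lemma smear_current_controlled:
  assumes "\<bar>r\<bar> \<le> R"
  shows "controlled CARD('n) (enlarged R) std_basis (smear_current r)"
proof -
  have bound: "\<bar>smear_current r \<omega>\<bar> \<le> B * L1"
    if w: "\<omega> \<in> smooth_forms CARD('n)" and B: "\<forall>x\<in>enlarged R. \<bar>\<omega> x std_basis\<bar> \<le> B" for \<omega> B
    unfolding smear_current_def
  proof (rule smear_bound[OF coeff_continuous[OF w]])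
    fix y z :: "(real, 'n) vec" assume "y \<in> K" "norm z \<le> \<bar>r\<bar>"
    then have "y + z \<in> enlarged R" unfolding enlarged_def
      by (intro CollectI exI[of _ y] exI[of _ z]) (use assms in auto)
    then show "\<bar>\<omega> (y + z) std_basis\<bar> \<le> B" using B by blast
  qed
  then show ?thesis
    unfolding controlled_def
    using L1_nonneg smear_add[OF coeff_continuous coeff_continuous] smear_cmult
    by (auto simp: smear_current_def)
qed

text \<open>On the standard basis the exterior derivative is a signed sum of one directional
  derivative per coordinate. Each differentiated coefficient is bounded by 1, because the basis with
  one vector removed is still orthonormal.\<close>

lemma boundary_smear_current_le:
  assumes r: "0 < r" and w: "\<eta> \<in> smooth_forms (CARD('n) - 1)"
    and w1: "\<And>x vs. orthonormal_list vs \<Longrightarrow> \<bar>\<eta> x vs\<bar> \<le> 1"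
  shows "\<bar>boundary (smear_current r) \<eta>\<bar> \<le> bump_constant TYPE('n) * (avg_osc r / r)"
proof -
  define f where "f i y = \<eta> y (take i std_basis @ drop (Suc i) std_basis)" for i y
  have f: "smooth (f i)" for i unfolding f_def by (rule smooth_formsD(2)[OF w])
  have f1: "\<bar>f i x\<bar> \<le> 1" for i x
    unfolding f_def by (intro w1 orthonormal_list_remove orthonormal_std_basis)
  define D where "D i x = frechet_derivative (f i) (at x) (std_basis ! i)" for i x
  have D: "continuous_on UNIV (\<lambda>x. (-1) ^ i * D i x)" for i
    unfolding D_def by (intro continuous_intros smooth_continuous_on smooth_frechet_derivative f)
  have "boundary (smear_current r) \<eta> = smear r (\<lambda>x. \<Sum>i<CARD('n). (-1) ^ i * D i x)"
    unfolding boundary_def smear_current_def ext_deriv_def D_def f_def by simp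
  also have "\<dots> = (\<Sum>i<CARD('n). (-1) ^ i * smear r (D i))"
    by (simp add: smear_sum[OF _ D] smear_cmult)
  also have "\<bar>\<dots>\<bar> \<le> (\<Sum>i<CARD('n). 4 * (avg_osc r / r) / bump_mass TYPE((real, 'n) vec))"
  proof (rule order_trans[OF sum_abs], rule sum_mono)
    fix i assume i: "i \<in> {..<CARD('n)}"
    then have "norm (std_basis ! i :: (real, 'n) vec) = 1"
      by (intro orthonormal_list_norm[OF orthonormal_std_basis]) simp
    then show "\<bar>(-1) ^ i * smear r (D i)\<bar> \<le> 4 * (avg_osc r / r) / bump_mass TYPE((real, 'n) vec)"
      using smear_deriv_le[OF f f1 r, of i "std_basis ! i"] by (simp add: D_def[abs_def] abs_mult)
  qed
  finally show ?thesis by (simp add: bump_constant_def mult_ac)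
qed

lemma bump_constant_bounds:
  "0 < bump_constant TYPE('n)" "1 / bump_mass TYPE((real, 'n) vec) \<le> bump_constant TYPE('n)"
proof -
  let ?b = "bump_mass TYPE((real, 'n) vec)"
  have b: "0 < ?b" by (rule bump_mass_pos)
  have "0 < CARD('n)" by simp
  then have d: "1 \<le> 4 * real CARD('n)" by linarith
  then show "0 < bump_constant TYPE('n)"
    unfolding bump_constant_def using b by (intro divide_pos_pos) linarith+
  show "1 / ?b \<le> bump_constant TYPE('n)" unfolding bump_constant_def by (rule divide_right_mono[OF d less_imp_le[OF b]])
qed

lemma smear_current_diff_le:
  assumes w: "\<omega> \<in> smooth_forms CARD('n)" and w1: "\<And>x vs. orthonormal_list vs \<Longrightarrow> \<bar>\<omega> x vs\<bar> \<le> 1"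
  shows "\<bar>smear_current r \<omega> - pairing (\<lambda>x. \<omega> x std_basis) 0\<bar> \<le> bump_constant TYPE('n) * avg_osc r"
proof -
  have c: "\<bar>\<omega> x std_basis\<bar> \<le> 1" for x by (rule w1[OF orthonormal_std_basis])
  have "\<bar>smear_current r \<omega> - pairing (\<lambda>x. \<omega> x std_basis) 0\<bar> \<le> 1 / bump_mass TYPE((real, 'n) vec) * avg_osc r"
    using smear_diff_le[OF coeff_continuous[OF w, of std_basis] c, of r]
    by (simp add: smear_current_def)
  also have "\<dots> \<le> bump_constant TYPE('n) * avg_osc r"
    by (rule mult_right_mono[OF bump_constant_bounds(2) avg_osc_nonneg])
  finally show ?thesis .
qed

lemma smear_current_le_L1:
  assumes w: "\<omega> \<in> smooth_forms CARD('n)" and w1: "\<And>x vs. orthonormal_list vs \<Longrightarrow> \<bar>\<omega> x vs\<bar> \<le> 1"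
  shows "\<bar>smear_current r \<omega>\<bar> \<le> L1"
  using smear_bound[OF coeff_continuous[OF w, of std_basis], of r 1] w1[OF orthonormal_std_basis]
  by (simp add: smear_current_def)

lemma normal_currentI:
  assumes S: "controlled CARD('n) K' std_basis S" and K': "compact K'"
    and M: "mass CARD('n) S \<le> ennreal M" and B: "mass (CARD('n) - 1) (boundary S) \<le> ennreal B"
  shows "normal_current CARD('n) S"
  using controlled_current[OF S K'] le_less_trans[OF M] le_less_trans[OF B]
  unfolding normal_current_def normal_mass_def by simp

section \<open>The telescoping decomposition\<close>

definition dyadic_piece :: "real \<Rightarrow> nat \<Rightarrow> (real, 'n) vec current" where
  "dyadic_piece R k = (case k of 0 \<Rightarrow> smear_current R
     | Suc j \<Rightarrow> (\<lambda>\<omega>. smear_current (R / 2 ^ Suc j) \<omega> - smear_current (R / 2 ^ j) \<omega>))"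

lemma dyadic_piece_sum: "(\<Sum>k<Suc n. dyadic_piece R k \<omega>) = smear_current (R / 2 ^ n) \<omega>"
  by (induction n) (simp_all add: dyadic_piece_def)

text \<open>Mass bound for the piece with index \<open>Suc k\<close>: the sum of the errors of the
  two mollifications whose difference it is.\<close>

definition dyadic_osc :: "real \<Rightarrow> nat \<Rightarrow> real" where
  "dyadic_osc R k = bump_constant TYPE('n) * (avg_osc (R / 2 ^ Suc k) + avg_osc (R / 2 ^ k))"

lemma dyadic_osc_nonneg: "0 \<le> dyadic_osc R k"
  unfolding dyadic_osc_def by (intro mult_nonneg_nonneg add_nonneg_nonneg avg_osc_nonneg)
    (use bump_constant_bounds in simp)

lemma dyadic_piece_controlled:
  assumes R: "0 < R"
  shows "controlled CARD('n) (enlarged R) std_basis (dyadic_piece R k)"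
proof -
  have "\<bar>R / 2 ^ j\<bar> \<le> R" for j
    using R by (simp add: divide_le_eq mult_le_cancel_left1)
  then have "controlled CARD('n) (enlarged R) std_basis (smear_current (R / 2 ^ j))" for j
    by (rule smear_current_controlled)
  from this[of 0] this show ?thesis
    unfolding dyadic_piece_def by (cases k) (simp_all del: power_Suc add: controlled_diff)
qed

lemma dyadic_piece_mass:
  "mass CARD('n) (dyadic_piece R 0) \<le> ennreal L1"
  "mass CARD('n) (dyadic_piece R (Suc k)) \<le> ennreal (dyadic_osc R k)"
proof -
  show "mass CARD('n) (dyadic_piece R 0) \<le> ennreal L1"
    by (rule mass_leI) (use smear_current_le_L1 in \<open>auto simp: dyadic_piece_def abs_le_iff\<close>)
  show "mass CARD('n) (dyadic_piece R (Suc k)) \<le> ennreal (dyadic_osc R k)"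
  proof (rule mass_leI)
    fix \<omega> :: "(real, 'n) vec form"
    assume w: "\<omega> \<in> smooth_forms CARD('n)" "\<And>x vs. orthonormal_list vs \<Longrightarrow> \<bar>\<omega> x vs\<bar> \<le> 1"
    show "dyadic_piece R (Suc k) \<omega> \<le> dyadic_osc R k"
      using smear_current_diff_le[OF w, of "R / 2 ^ Suc k"] smear_current_diff_le[OF w, of "R / 2 ^ k"]
      unfolding dyadic_piece_def dyadic_osc_def distrib_left nat.case by linarith
  qed
qed

lemma dyadic_piece_boundary_mass:
  assumes R: "0 < R"
  shows "mass (CARD('n) - 1) (boundary (dyadic_piece R 0)) \<le> ennreal (bump_constant TYPE('n) * (avg_osc R / R))"
    "mass (CARD('n) - 1) (boundary (dyadic_piece R (Suc k))) \<le> ennreal (dyadic_osc R k * (1 / (R / 2 ^ Suc k)))"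
proof -
  show "mass (CARD('n) - 1) (boundary (dyadic_piece R 0)) \<le> ennreal (bump_constant TYPE('n) * (avg_osc R / R))"
    by (rule mass_leI) (use boundary_smear_current_le[OF R] in \<open>auto simp: dyadic_piece_def abs_le_iff\<close>)
  show "mass (CARD('n) - 1) (boundary (dyadic_piece R (Suc k))) \<le> ennreal (dyadic_osc R k * (1 / (R / 2 ^ Suc k)))"
  proof (rule mass_leI)
    fix \<eta> :: "(real, 'n) vec form"
    assume w: "\<eta> \<in> smooth_forms (CARD('n) - 1)" "\<And>x vs. orthonormal_list vs \<Longrightarrow> \<bar>\<eta> x vs\<bar> \<le> 1"
    have "boundary (dyadic_piece R (Suc k)) \<eta> =
        boundary (smear_current (R / 2 ^ Suc k)) \<eta> - boundary (smear_current (R / 2 ^ k)) \<eta>"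
      by (simp add: boundary_def dyadic_piece_def)
    also have "\<dots> \<le> bump_constant TYPE('n) * (avg_osc (R / 2 ^ Suc k) / (R / 2 ^ Suc k)) +
        bump_constant TYPE('n) * (avg_osc (R / 2 ^ k) / (R / 2 ^ k))"
      using boundary_smear_current_le[OF _ w, of "R / 2 ^ Suc k"] boundary_smear_current_le[OF _ w, of "R / 2 ^ k"] R
      by (simp add: abs_le_iff)
    \<comment> \<open>Putting both terms over the finer scale only enlarges the bound, and brings it
      to the shape mass bound times inverse scale that \<open>powr_interpolation\<close>
      expects.\<close>
    also have "\<dots> \<le> bump_constant TYPE('n) * (avg_osc (R / 2 ^ Suc k) / (R / 2 ^ Suc k)) +
        bump_constant TYPE('n) * (avg_osc (R / 2 ^ k) / (R / 2 ^ Suc k))"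
      using R avg_osc_nonneg bump_constant_bounds(1)
      by (intro add_left_mono mult_left_mono divide_left_mono mult_pos_pos) (auto simp: divide_simps)
    also have "\<dots> = dyadic_osc R k * (1 / (R / 2 ^ Suc k))"
    proof -
      have "c * (a / r) + c * (b / r) = c * (a + b) * (1 / r)" for a b c r :: real
        by (simp add: add_divide_distrib distrib_left)
      then show ?thesis unfolding dyadic_osc_def .
    qed
    finally show "boundary (dyadic_piece R (Suc k)) \<eta> \<le> dyadic_osc R k * (1 / (R / 2 ^ Suc k))" .
  qed
qed

lemma dyadic_piece_normal:
  assumes "0 < R"
  shows "normal_current CARD('n) (dyadic_piece R k)"
  using normal_currentI[OF dyadic_piece_controlled[OF assms] compact_enlarged]
    dyadic_piece_mass dyadic_piece_boundary_mass[OF assms] by (cases k) blast+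

definition weighted_osc :: "real \<Rightarrow> real \<Rightarrow> nat \<Rightarrow> real" where
  "weighted_osc \<alpha> R k = avg_osc (R / 2 ^ k) * (R / 2 ^ k) powr (\<alpha> - 1)"

lemma weighted_osc_nonneg: "0 \<le> weighted_osc \<alpha> R k"
  unfolding weighted_osc_def by (simp add: avg_osc_nonneg)

text \<open>The weight belongs exactly to the finer scale. For the coarser one it is too large by
  \<open>2 powr (1 - \<alpha>)\<close>, which is at most the 2 on the right.\<close>

lemma dyadic_osc_weighted:
  assumes \<alpha>: "0 < \<alpha>" "\<alpha> < 1" and R: "0 < R"
  shows "dyadic_osc R k * (1 / (R / 2 ^ Suc k)) powr (1 - \<alpha>)
    \<le> bump_constant TYPE('n) * (weighted_osc \<alpha> R (Suc k) + 2 * weighted_osc \<alpha> R k)"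
proof -
  define r where "r = R / 2 ^ k"
  have r: "0 < r" using R by (simp add: r_def)
  have r2: "R / 2 ^ Suc k = r / 2" by (simp add: r_def)
  have p: "(1 / (r / 2)) powr (1 - \<alpha>) = (r / 2) powr (\<alpha> - 1)"
    using r powr_minus_divide[of "r / 2" "1 - \<alpha>"] by (simp add: powr_divide)
  have "(r / 2) powr (\<alpha> - 1) = r powr (\<alpha> - 1) * 2 powr (1 - \<alpha>)"
    using r powr_minus_divide[of 2 "\<alpha> - 1"] by (simp add: powr_divide)
  also have "\<dots> \<le> r powr (\<alpha> - 1) * 2 powr 1"
    by (intro mult_left_mono powr_mono) (use \<alpha> in auto)
  finally have "avg_osc r * (r / 2) powr (\<alpha> - 1) \<le> avg_osc r * (2 * r powr (\<alpha> - 1))"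
    by (intro mult_left_mono avg_osc_nonneg) simp
  then have "(avg_osc (r / 2) + avg_osc r) * (r / 2) powr (\<alpha> - 1)
      \<le> weighted_osc \<alpha> R (Suc k) + 2 * weighted_osc \<alpha> R k"
    unfolding weighted_osc_def r2 r_def[symmetric] by (simp add: distrib_right)
  then have "bump_constant TYPE('n) * ((avg_osc (r / 2) + avg_osc r) * (r / 2) powr (\<alpha> - 1))
      \<le> bump_constant TYPE('n) * (weighted_osc \<alpha> R (Suc k) + 2 * weighted_osc \<alpha> R k)"
    by (intro mult_left_mono) (use bump_constant_bounds in auto)
  then show ?thesis unfolding dyadic_osc_def r2 r_def[symmetric] p by (simp only: mult.assoc)
qed

lemma weighted_osc_summable:
  assumes \<alpha>: "0 < \<alpha>" "\<alpha> < 1" and R: "0 < R"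
    and fin: "(\<integral>\<^sup>+h. shift_diff v h * ennreal (1 / norm h powr (real CARD('n) + 1 - \<alpha>)) \<partial>lborel) < \<infinity>"
  shows "summable (weighted_osc \<alpha> R)"
    "ennreal (suminf (weighted_osc \<alpha> R)) \<le>
      2 * (\<integral>\<^sup>+h. shift_diff v h * ennreal (1 / norm h powr (real CARD('n) + 1 - \<alpha>)) \<partial>lborel)"
proof -
  have le: "(\<Sum>k. ennreal (weighted_osc \<alpha> R k)) \<le>
      2 * (\<integral>\<^sup>+h. shift_diff v h * ennreal (1 / norm h powr (real CARD('n) + 1 - \<alpha>)) \<partial>lborel)"
    using dyadic_avg_osc_sum[OF \<alpha> R] by (simp add: weighted_osc_def)
  also have "\<dots> < top" using fin by (simp add: ennreal_mult_less_top)
  finally have "(\<Sum>k. ennreal (weighted_osc \<alpha> R k)) \<noteq> top" by simp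
  then show sum: "summable (weighted_osc \<alpha> R)"
    using weighted_osc_nonneg summable_suminf_not_top by blast
  show "ennreal (suminf (weighted_osc \<alpha> R)) \<le>
      2 * (\<integral>\<^sup>+h. shift_diff v h * ennreal (1 / norm h powr (real CARD('n) + 1 - \<alpha>)) \<partial>lborel)"
    using le suminf_ennreal2[OF weighted_osc_nonneg sum] by simp
qed

text \<open>The exponent \<open>\<alpha> - 1\<close> is negative, so the weights at scales below
  \<open>R\<close> are at least \<open>R powr (\<alpha> - 1)\<close>, and the summands of the
  convergent series, which tend to 0, dominate a fixed multiple of the averages.\<close>

lemma avg_osc_tendsto:
  assumes \<alpha>: "0 < \<alpha>" "\<alpha> < 1" and R: "0 < R" and sum: "summable (weighted_osc \<alpha> R)"
  shows "(\<lambda>k. avg_osc (R / 2 ^ k)) \<longlonglongrightarrow> 0"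
proof (rule Lim_null_comparison)
  have "norm (avg_osc (R / 2 ^ k)) \<le> weighted_osc \<alpha> R k * R powr (1 - \<alpha>)" for k
  proof -
    have "R powr (\<alpha> - 1) \<le> (R / 2 ^ k) powr (\<alpha> - 1)"
      by (rule powr_mono2') (use \<alpha> R in \<open>auto simp: divide_le_eq mult_le_cancel_left1\<close>)
    then have "avg_osc (R / 2 ^ k) * R powr (\<alpha> - 1) \<le> weighted_osc \<alpha> R k"
      unfolding weighted_osc_def by (intro mult_left_mono avg_osc_nonneg)
    then have "avg_osc (R / 2 ^ k) * R powr (\<alpha> - 1) * R powr (1 - \<alpha>) \<le> weighted_osc \<alpha> R k * R powr (1 - \<alpha>)"
      by (rule mult_right_mono) simp
    then show ?thesis using R avg_osc_nonneg by (simp add: mult.assoc powr_add[symmetric])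
  qed
  then show "\<forall>\<^sub>F k in sequentially. norm (avg_osc (R / 2 ^ k)) \<le> weighted_osc \<alpha> R k * R powr (1 - \<alpha>)"
    by simp
  show "(\<lambda>k. weighted_osc \<alpha> R k * R powr (1 - \<alpha>)) \<longlonglongrightarrow> 0"
    using tendsto_mult_left_zero[OF summable_LIMSEQ_zero[OF sum]] by blast
qed

end

section \<open>The equivalence\<close>

lemma ennreal_le_add_vanishing:
  fixes x y :: ennreal and f :: "nat \<Rightarrow> real"
  assumes le: "\<And>n. x \<le> ennreal (f n) + y" and f: "f \<longlonglongrightarrow> 0"
  shows "x \<le> y"
proof (rule LIMSEQ_le_const)
  show "(\<lambda>n. ennreal (f n) + y) \<longlonglongrightarrow> y"
    using tendsto_add[OF tendsto_ennrealI[OF f] tendsto_const[of y]] by simp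
  show "\<exists>N. \<forall>n\<ge>N. x \<le> ennreal (f n) + y" using le by blast
qed

context compact_integrable_cart
begin

lemma flat_norm_cart: "flat_norm CARD('n) (T :: (real, 'n) vec current) = mass CARD('n) T"
  using flat_norm_top[of T] by simp

lemma pairing_controlled:
  fixes T :: "(real, 'n) vec current"
  assumes rep: "\<forall>\<omega>\<in>smooth_forms CARD('n). T \<omega> = pairing (\<lambda>x. \<omega> x std_basis) 0"
  shows "controlled CARD('n) K std_basis T"
proof -
  have "\<bar>T \<omega>\<bar> \<le> B * L1"
    if w: "\<omega> \<in> smooth_forms CARD('n)" and B: "\<forall>x\<in>K. \<bar>\<omega> x std_basis\<bar> \<le> B" for \<omega> B
    unfolding bspec[OF rep w] by (rule pairing_bound[OF coeff_continuous[OF w]]) (use B in simp)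
  then show ?thesis
    unfolding controlled_def
    using L1_nonneg pairing_add[OF coeff_continuous coeff_continuous] pairing_cmult
    by (auto simp: bspec[OF rep] smooth_forms_add smooth_forms_scale)
qed

lemma smear_current_approx:
  fixes T :: "(real, 'n) vec current"
  assumes rep: "\<forall>\<omega>\<in>smooth_forms CARD('n). T \<omega> = pairing (\<lambda>x. \<omega> x std_basis) 0"
  shows "mass CARD('n) (\<lambda>\<omega>. T \<omega> - smear_current r \<omega>) \<le> ennreal (bump_constant TYPE('n) * avg_osc r)"
proof (rule mass_leI)
  fix \<omega> :: "(real, 'n) vec form"
  assume w: "\<omega> \<in> smooth_forms CARD('n)" "\<And>x vs. orthonormal_list vs \<Longrightarrow> \<bar>\<omega> x vs\<bar> \<le> 1"
  show "T \<omega> - smear_current r \<omega> \<le> bump_constant TYPE('n) * avg_osc r"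
    using smear_current_diff_le[OF w, of r] unfolding bspec[OF rep w(1)] by linarith
qed

text \<open>All scales are at most 1, so \<open>enlarged 1\<close> contains every support. Two
  mollifications are compared through \<open>T\<close>, from which each is within half of the
  tolerance.\<close>

lemma smear_flat_approx:
  fixes T :: "(real, 'n) vec current"
  assumes rep: "\<forall>\<omega>\<in>smooth_forms CARD('n). T \<omega> = pairing (\<lambda>x. \<omega> x std_basis) 0"
    and lim: "(\<lambda>k. avg_osc (1 / 2 ^ k)) \<longlonglongrightarrow> 0"
  shows "flat_approx CARD('n) (\<lambda>n. smear_current (1 / 2 ^ n)) T"
  unfolding flat_approx_def
proof (intro conjI allI impI ballI)
  show "normal_current CARD('n) (smear_current (1 / 2 ^ n))" for n
    using dyadic_piece_normal[of "1 / 2 ^ n" 0] by (simp add: dyadic_piece_def)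
  have "current_support CARD('n) (smear_current (1 / 2 ^ n)) \<subseteq> enlarged 1" for n
    by (rule controlled_support[OF smear_current_controlled compact_enlarged]) simp
  then have "bounded (\<Union>n. current_support CARD('n) (smear_current (1 / 2 ^ n)))"
    by (intro bounded_subset[OF compact_imp_bounded[OF compact_enlarged[of 1]]]) auto
  then show "compact (closure (\<Union>n. current_support CARD('n) (smear_current (1 / 2 ^ n))))" by simp
next
  fix \<epsilon> :: ennreal assume "0 < \<epsilon>"
  \<comment> \<open>The tolerance may be infinite; a positive real below it suffices.\<close>
  then obtain e' where "0 < e'" "e' < \<epsilon>" using dense by blast
  then obtain e where e: "0 < e" "ennreal e < \<epsilon>"
    by (metis ennreal_cases ennreal_less_zero_iff order_less_imp_not_less top.extremum_strict)
  have "(\<lambda>k. bump_constant TYPE('n) * avg_osc (1 / 2 ^ k)) \<longlonglongrightarrow> 0"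
    using tendsto_mult_right_zero[OF lim] by blast
  then have "\<forall>\<^sub>F k in sequentially. bump_constant TYPE('n) * avg_osc (1 / 2 ^ k) < e / 2"
    by (rule order_tendstoD) (use e in simp)
  then obtain N where N: "\<And>k. k \<ge> N \<Longrightarrow> bump_constant TYPE('n) * avg_osc (1 / 2 ^ k) < e / 2"
    unfolding eventually_sequentially by blast
  have "flat_norm CARD('n) (\<lambda>\<omega>. smear_current (1 / 2 ^ n) \<omega> - smear_current (1 / 2 ^ k) \<omega>) < \<epsilon>"
    if "n \<ge> N" "k \<ge> N" for n k
  proof -
    have "mass CARD('n) (\<lambda>\<omega>. smear_current (1 / 2 ^ n) \<omega> - smear_current (1 / 2 ^ k) \<omega>) \<le> ennreal e"
    proof (rule mass_leI)
      fix \<omega> :: "(real, 'n) vec form"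
      assume w: "\<omega> \<in> smooth_forms CARD('n)" "\<And>x vs. orthonormal_list vs \<Longrightarrow> \<bar>\<omega> x vs\<bar> \<le> 1"
      show "smear_current (1 / 2 ^ n) \<omega> - smear_current (1 / 2 ^ k) \<omega> \<le> e"
        using smear_current_diff_le[OF w, of "1 / 2 ^ n"] smear_current_diff_le[OF w, of "1 / 2 ^ k"]
          N[OF that(1)] N[OF that(2)] by linarith
    qed
    then show ?thesis unfolding flat_norm_cart using e(2) by (rule order.strict_trans1)
  qed
  then show "\<exists>N. \<forall>n\<ge>N. \<forall>k\<ge>N. flat_norm CARD('n) (\<lambda>\<omega>. smear_current (1 / 2 ^ n) \<omega> - smear_current (1 / 2 ^ k) \<omega>) < \<epsilon>"
    by blast
next
  fix \<omega> :: "(real, 'n) vec form" assume w: "\<omega> \<in> smooth_forms CARD('n)"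
  have "(\<lambda>n. 1 / 2 ^ n :: real) \<longlonglongrightarrow> 0"
    using LIMSEQ_power_zero[of "1 / 2 :: real"] by (simp add: power_divide)
  then show "(\<lambda>n. smear_current (1 / 2 ^ n) \<omega>) \<longlonglongrightarrow> T \<omega>"
    unfolding smear_current_def bspec[OF rep w] by (rule smear_tendsto[OF coeff_continuous[OF w]])
qed

lemma dyadic_decomposition:
  fixes T :: "(real, 'n) vec current"
  assumes \<alpha>: "0 < \<alpha>" "\<alpha> < 1" and R: "0 < R"
    and rep: "\<forall>\<omega>\<in>smooth_forms CARD('n). T \<omega> = pairing (\<lambda>x. \<omega> x std_basis) 0"
    and sum: "summable (weighted_osc \<alpha> R)"
  shows "fractional_decomposition CARD('n) \<alpha> T (dyadic_piece R)"
  unfolding fractional_decomposition_def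
proof (intro conjI allI)
  show normal: "normal_current CARD('n) (dyadic_piece R k)" for k by (rule dyadic_piece_normal[OF R])
  show "\<exists>K. compact K \<and> (\<forall>k. current_support CARD('n) (dyadic_piece R k) \<subseteq> K)"
    using controlled_support[OF dyadic_piece_controlled[OF R] compact_enlarged] compact_enlarged by blast
  let ?t = "\<lambda>k. enn2real (normal_mass CARD('n) (dyadic_piece R k)) powr (1 - \<alpha>) *
      enn2real (flat_norm CARD('n) (dyadic_piece R k)) powr \<alpha>"
  have le: "?t (Suc k) \<le> (1 + R) powr (1 - \<alpha>) *
      (bump_constant TYPE('n) * (weighted_osc \<alpha> R (Suc k) + 2 * weighted_osc \<alpha> R k))" for k
  proof -
    define \<rho> where "\<rho> = R / 2 ^ Suc k"
    have "(1 :: real) \<le> 2 ^ Suc k" by (rule one_le_power) simp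
    then have \<rho>: "0 < \<rho>" "\<rho> \<le> R" using R by (simp_all add: \<rho>_def divide_le_eq mult_le_cancel_left1)
    let ?y = "dyadic_osc R k"
    have y: "0 \<le> ?y" by (rule dyadic_osc_nonneg)
    have "normal_mass CARD('n) (dyadic_piece R (Suc k)) \<le> ennreal ?y + ennreal (?y * (1 / \<rho>))"
      unfolding normal_mass_def \<rho>_def
      using add_mono[OF dyadic_piece_mass(2) dyadic_piece_boundary_mass(2)[OF R]] by simp
    also have "\<dots> = ennreal (?y + ?y * (1 / \<rho>))" using y \<rho> by (simp add: ennreal_plus)
    also have "\<dots> \<le> ennreal (?y * ((1 + R) * (1 / \<rho>)))"
    proof (rule ennreal_leI)
      \<comment> \<open>This is where \<open>\<rho> \<le> R\<close> enters: it absorbs the mass into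
        the boundary term. The factor \<open>1 + R\<close> is harmless for summability at a fixed
        \<open>R\<close>.\<close>
      have "1 + 1 / \<rho> \<le> (1 + R) * (1 / \<rho>)" using \<rho> by (simp add: field_simps)
      then show "?y + ?y * (1 / \<rho>) \<le> ?y * ((1 + R) * (1 / \<rho>))"
        using mult_left_mono[OF _ y, of "1 + 1 / \<rho>" "(1 + R) * (1 / \<rho>)"] by (simp add: distrib_left)
    qed
    finally have N: "enn2real (normal_mass CARD('n) (dyadic_piece R (Suc k))) \<le> ?y * ((1 + R) * (1 / \<rho>))"
      by (rule enn2real_le) (use y \<rho> R in simp)
    have M: "enn2real (mass CARD('n) (dyadic_piece R (Suc k))) \<le> ?y"
      by (rule enn2real_le[OF dyadic_piece_mass(2) y])
    have "?t (Suc k) \<le> ?y * ((1 + R) * (1 / \<rho>)) powr (1 - \<alpha>)"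
      unfolding flat_norm_cart by (rule powr_interpolation[OF \<alpha> _ M _ N]) (use \<rho> R in auto)
    also have "\<dots> = (1 + R) powr (1 - \<alpha>) * (?y * (1 / \<rho>) powr (1 - \<alpha>))"
      using \<rho> R by (simp add: powr_mult powr_divide)
    also have "\<dots> \<le> (1 + R) powr (1 - \<alpha>) *
      (bump_constant TYPE('n) * (weighted_osc \<alpha> R (Suc k) + 2 * weighted_osc \<alpha> R k))"
      unfolding \<rho>_def by (intro mult_left_mono dyadic_osc_weighted[OF \<alpha> R]) simp
    finally show ?thesis .
  qed
  have "summable (\<lambda>k. ?t (Suc k))"
  proof (rule summable_comparison_test')
    show "summable (\<lambda>k. (1 + R) powr (1 - \<alpha>) *
      (bump_constant TYPE('n) * (weighted_osc \<alpha> R (Suc k) + 2 * weighted_osc \<alpha> R k)))"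
      using sum by (intro summable_mult summable_add) (simp add: summable_Suc_iff)
    show "norm (?t (Suc k)) \<le> (1 + R) powr (1 - \<alpha>) *
      (bump_constant TYPE('n) * (weighted_osc \<alpha> R (Suc k) + 2 * weighted_osc \<alpha> R k))" if "0 \<le> k" for k
      using le[of k] by simp
  qed
  then show "summable ?t" by (subst (asm) summable_Suc_iff)
  show "(\<lambda>n. flat_norm CARD('n) (\<lambda>\<omega>. T \<omega> - (\<Sum>k<n. dyadic_piece R k \<omega>))) \<longlonglongrightarrow> 0"
    unfolding flat_norm_cart
  \<comment> \<open>The first \<open>Suc n\<close> pieces add up to the mollification at scale
    \<open>R / 2 ^ n\<close>; the shift by one skips the empty sum.\<close>
  proof (rule LIMSEQ_imp_Suc, unfold dyadic_piece_sum,
      rule tendsto_sandwich[where f="\<lambda>_. 0" and h="\<lambda>n. ennreal (bump_constant TYPE('n) * avg_osc (R / 2 ^ n))"])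
    show "\<forall>\<^sub>F n in sequentially. mass CARD('n) (\<lambda>\<omega>. T \<omega> - smear_current (R / 2 ^ n) \<omega>)
        \<le> ennreal (bump_constant TYPE('n) * avg_osc (R / 2 ^ n))"
      by (intro always_eventually allI smear_current_approx rep)
    have "(\<lambda>n. bump_constant TYPE('n) * avg_osc (R / 2 ^ n)) \<longlonglongrightarrow> 0"
      using tendsto_mult_right_zero[OF avg_osc_tendsto[OF \<alpha> R sum]] by blast
    from tendsto_ennrealI[OF this]
    show "(\<lambda>n. ennreal (bump_constant TYPE('n) * avg_osc (R / 2 ^ n))) \<longlonglongrightarrow> 0" by simp
  qed auto
qed

text \<open>The first summand bounds the coarsest piece and decays like
  \<open>R powr (\<alpha> - 1)\<close>. The factor 6 is 3 times 2: each weighted oscillation is used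
  at most once as the finer and twice as the coarser scale, and \<open>dyadic_avg_osc_sum\<close>
  contributes the 2.\<close>

lemma frac_norm_le_at_scale:
  fixes T :: "(real, 'n) vec current"
  assumes \<alpha>: "0 < \<alpha>" "\<alpha> < 1" and R: "0 < R"
    and rep: "\<forall>\<omega>\<in>smooth_forms CARD('n). T \<omega> = pairing (\<lambda>x. \<omega> x std_basis) 0"
    and fin: "(\<integral>\<^sup>+h. shift_diff v h * ennreal (1 / norm h powr (real CARD('n) + 1 - \<alpha>)) \<partial>lborel) < \<infinity>"
  shows "frac_norm \<alpha> T \<le>
    ennreal ((bump_constant TYPE('n) * (2 * L1 * measure lborel (cball (0 :: (real, 'n) vec) 1))) powr (1 - \<alpha>) *
        L1 powr \<alpha> * R powr (\<alpha> - 1)) +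
    ennreal (6 * bump_constant TYPE('n)) *
      (\<integral>\<^sup>+h. shift_diff v h * ennreal (1 / norm h powr (real CARD('n) + 1 - \<alpha>)) \<partial>lborel)"
proof -
  let ?c = "bump_constant TYPE('n)"
  let ?I = "\<integral>\<^sup>+h. shift_diff v h * ennreal (1 / norm h powr (real CARD('n) + 1 - \<alpha>)) \<partial>lborel"
  let ?V = "measure lborel (cball (0 :: (real, 'n) vec) 1)"
  let ?w = "weighted_osc \<alpha> R"
  define t where "t k = enn2real (mass (CARD('n) - 1) (boundary (dyadic_piece R k))) powr (1 - \<alpha>) *
      enn2real (mass CARD('n) (dyadic_piece R k)) powr \<alpha>" for k
  have c: "0 < ?c" by (rule bump_constant_bounds)
  note w = weighted_osc_summable[OF \<alpha> R fin]
  have t0: "0 \<le> t k" for k by (simp add: t_def)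
  have tS: "t (Suc k) \<le> ?c * (?w (Suc k) + 2 * ?w k)" for k
  proof -
    have y: "0 \<le> dyadic_osc R k" by (rule dyadic_osc_nonneg)
    have "t (Suc k) \<le> dyadic_osc R k * (1 / (R / 2 ^ Suc k)) powr (1 - \<alpha>)"
      unfolding t_def
      by (intro powr_interpolation \<alpha> enn2real_nonneg enn2real_le dyadic_piece_mass
          dyadic_piece_boundary_mass R mult_nonneg_nonneg y) (use R in auto)
    also have "\<dots> \<le> ?c * (?w (Suc k) + 2 * ?w k)" by (rule dyadic_osc_weighted[OF \<alpha> R])
    finally show ?thesis .
  qed
  have wS: "summable (\<lambda>k. ?w (Suc k))" using w(1) by (simp add: summable_Suc_iff)
  have sumS: "summable (\<lambda>k. ?c * (?w (Suc k) + 2 * ?w k))"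
    using w(1) wS by (intro summable_mult summable_add)
  have tsumS: "summable (\<lambda>k. t (Suc k))"
    by (rule summable_comparison_test'[OF sumS, of 0]) (use tS t0 in simp)
  then have tsum: "summable t" by (simp add: summable_Suc_iff)
  \<comment> \<open>For the coarsest piece the average oscillation is replaced by its trivial bound
    \<open>2 * L1 * ?V\<close>; the gain is the factor \<open>1 / R\<close> in the boundary
    mass.\<close>
  have "t 0 \<le> (?c * (2 * L1 * ?V) * (1 / R)) powr (1 - \<alpha>) * L1 powr \<alpha>"
    unfolding t_def
  proof (intro mult_mono powr_mono2)
    have "?c * (avg_osc R / R) \<le> ?c * (2 * L1 * ?V) * (1 / R)"
      using mult_left_mono[OF divide_right_mono[OF avg_osc_le[of R], of R], of ?c] c R by simp
    then show "enn2real (mass (CARD('n) - 1) (boundary (dyadic_piece R 0))) \<le> ?c * (2 * L1 * ?V) * (1 / R)"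
      by (intro order_trans[OF enn2real_le[OF dyadic_piece_boundary_mass(1)[OF R]]])
         (use c R avg_osc_nonneg in auto)
    show "enn2real (mass CARD('n) (dyadic_piece R 0)) \<le> L1"
      by (rule enn2real_le[OF dyadic_piece_mass(1) L1_nonneg])
  qed (use \<alpha> in auto)
  also have "\<dots> = (?c * (2 * L1 * ?V)) powr (1 - \<alpha>) * L1 powr \<alpha> * R powr (\<alpha> - 1)"
  proof -
    have "(1 / R) powr (1 - \<alpha>) = R powr (\<alpha> - 1)"
      using R powr_minus_divide[of R "1 - \<alpha>"] by (simp add: powr_divide)
    then show ?thesis using c R L1_nonneg by (subst powr_mult) (auto simp: mult_ac)
  qed
  finally have first: "t 0 \<le> (?c * (2 * L1 * ?V)) powr (1 - \<alpha>) * L1 powr \<alpha> * R powr (\<alpha> - 1)" .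
  have "suminf t = t 0 + (\<Sum>k. t (Suc k))" using suminf_split_head[OF tsum] by simp
  also have "(\<Sum>k. t (Suc k)) \<le> (\<Sum>k. ?c * (?w (Suc k) + 2 * ?w k))"
    by (rule suminf_le[OF tS tsumS sumS])
  also have "(\<Sum>k. ?c * (?w (Suc k) + 2 * ?w k)) = ?c * ((\<Sum>k. ?w (Suc k)) + 2 * suminf ?w)"
    using w(1) wS by (simp add: suminf_mult summable_add suminf_add[symmetric] del: times_divide_eq_left)
  \<comment> \<open>The shifted sum omits a nonnegative first term, hence is at most the full
    one.\<close>
  also have "\<dots> \<le> ?c * (3 * suminf ?w)"
    using suminf_split_head[OF w(1)] weighted_osc_nonneg[of \<alpha> R 0] c by (intro mult_left_mono) auto
  finally have "suminf t \<le> t 0 + 3 * ?c * suminf ?w" by simp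
  then have "ennreal (suminf t) \<le> ennreal (t 0 + 3 * ?c * suminf ?w)" by (rule ennreal_leI)
  also have "\<dots> = ennreal (t 0) + ennreal (3 * ?c * suminf ?w)"
    by (rule ennreal_plus) (use t0 c suminf_nonneg[OF w(1) weighted_osc_nonneg] in auto)
  also have "\<dots> \<le> ennreal ((?c * (2 * L1 * ?V)) powr (1 - \<alpha>) * L1 powr \<alpha> * R powr (\<alpha> - 1)) +
      ennreal (6 * ?c) * ?I"
  proof (rule add_mono[OF ennreal_leI[OF first]])
    have "ennreal (3 * ?c * suminf ?w) = ennreal (3 * ?c) * ennreal (suminf ?w)"
      by (rule ennreal_mult) (use c suminf_nonneg[OF w(1) weighted_osc_nonneg] in auto)
    also have "\<dots> \<le> ennreal (3 * ?c) * (2 * ?I)" by (intro mult_left_mono w(2)) simp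
    also have "\<dots> = ennreal (3 * ?c) * ennreal 2 * ?I" by (simp add: mult.assoc)
    also have "ennreal (3 * ?c) * ennreal 2 = ennreal (6 * ?c)"
      by (subst ennreal_mult[symmetric]) (use c in auto)
    finally show "ennreal (3 * ?c * suminf ?w) \<le> ennreal (6 * ?c) * ?I" .
  qed
  finally have "ennreal (suminf t) \<le> ennreal ((?c * (2 * L1 * ?V)) powr (1 - \<alpha>) * L1 powr \<alpha> * R powr (\<alpha> - 1)) +
      ennreal (6 * ?c) * ?I" .
  moreover have "frac_norm \<alpha> T \<le> ennreal (suminf t)"
  proof -
    have "frac_norm \<alpha> T \<le> (\<Sum>k. ennreal (t k))"
      unfolding frac_norm_def t_def DIM_cart DIM_real mult_1_right
      by (rule INF_lower) (use dyadic_decomposition[OF \<alpha> R rep w(1)] in simp)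
    also have "\<dots> = ennreal (suminf t)" by (rule suminf_ennreal2[OF t0 tsum])
    finally show ?thesis .
  qed
  ultimately show ?thesis by (rule order_trans[rotated])
qed

lemma frac_norm_le:
  fixes T :: "(real, 'n) vec current"
  assumes \<alpha>: "0 < \<alpha>" "\<alpha> < 1"
    and rep: "\<forall>\<omega>\<in>smooth_forms CARD('n). T \<omega> = pairing (\<lambda>x. \<omega> x std_basis) 0"
    and fin: "(\<integral>\<^sup>+h. shift_diff v h * ennreal (1 / norm h powr (real CARD('n) + 1 - \<alpha>)) \<partial>lborel) < \<infinity>"
  shows "frac_norm \<alpha> T \<le> ennreal (6 * bump_constant TYPE('n)) *
      (\<integral>\<^sup>+h. shift_diff v h * ennreal (1 / norm h powr (real CARD('n) + 1 - \<alpha>)) \<partial>lborel)"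
proof (rule ennreal_le_add_vanishing)
  show "frac_norm \<alpha> T \<le>
    ennreal ((bump_constant TYPE('n) * (2 * L1 * measure lborel (cball (0 :: (real, 'n) vec) 1))) powr (1 - \<alpha>) *
        L1 powr \<alpha> * real (Suc n) powr (\<alpha> - 1)) +
    ennreal (6 * bump_constant TYPE('n)) *
      (\<integral>\<^sup>+h. shift_diff v h * ennreal (1 / norm h powr (real CARD('n) + 1 - \<alpha>)) \<partial>lborel)" for n
    by (rule frac_norm_le_at_scale[OF \<alpha> _ rep fin]) simp
  have "(\<lambda>n. real (Suc n) powr (\<alpha> - 1)) \<longlonglongrightarrow> 0"
    by (rule tendsto_neg_powr[OF _ filterlim_compose[OF filterlim_real_sequentially filterlim_Suc]])
       (use \<alpha> in simp)
  then show "(\<lambda>n. (bump_constant TYPE('n) * (2 * L1 * measure lborel (cball (0 :: (real, 'n) vec) 1))) powr (1 - \<alpha>) *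
        L1 powr \<alpha> * real (Suc n) powr (\<alpha> - 1)) \<longlonglongrightarrow> 0"
    by (rule tendsto_mult_right_zero)
qed

lemma fractional_current_representation:
  fixes T :: "(real, 'n) vec current"
  assumes \<alpha>: "0 < \<alpha>" "\<alpha> < 1"
    and rep: "\<forall>\<omega>\<in>smooth_forms CARD('n). T \<omega> = pairing (\<lambda>x. \<omega> x std_basis) 0"
    and fin: "(\<integral>\<^sup>+h. shift_diff v h * ennreal (1 / norm h powr (real CARD('n) + 1 - \<alpha>)) \<partial>lborel) < \<infinity>"
  shows "fractional_current CARD('n) \<alpha> T"
proof -
  have w: "summable (weighted_osc \<alpha> 1)" by (rule weighted_osc_summable[OF \<alpha> _ fin]) simp
  have "flat_approx CARD('n) (\<lambda>n. smear_current (1 / 2 ^ n)) T"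
    by (rule smear_flat_approx[OF rep avg_osc_tendsto[OF \<alpha> _ w]]) simp_all
  moreover have "current CARD('n) T" by (rule controlled_current[OF pairing_controlled[OF rep] K])
  moreover have "fractional_decomposition CARD('n) \<alpha> T (dyadic_piece 1)"
    by (rule dyadic_decomposition[OF \<alpha> _ rep w]) simp_all
  ultimately show ?thesis unfolding fractional_current_def flat_current_def by blast
qed

end

text \<open>A Borel version is cut off by the indicator of \<open>K\<close>, because the locale asks
  for vanishing at every point off \<open>K\<close> and not just almost everywhere.\<close>

lemma fun_current_representative:
  fixes u :: "(real, 'n::{finite,linorder}) vec \<Rightarrow> real"
  assumes int: "integrable lebesgue u" and supp: "compactly_supported u"
  obtains v K where "compact_integrable_cart v K" "AE x in lebesgue. u x = v x"
    "\<forall>\<omega>\<in>smooth_forms CARD('n). fun_current u \<omega> = compact_integrable.pairing v (\<lambda>x. \<omega> x std_basis) 0"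
proof -
  obtain K where K: "compact K" "AE x in lebesgue. x \<notin> K \<longrightarrow> u x = 0"
    using supp unfolding compactly_supported_def by blast
  obtain v0 where v0 [measurable]: "v0 \<in> borel_measurable lborel" and uv0: "AE x in lborel. u x = v0 x"
    using completion_ex_borel_measurable_real[of u lborel] int by auto
  define v where "v x = indicator K x * v0 x" for x
  have [measurable]: "K \<in> sets borel" using K(1) by (simp add: compact_imp_closed)
  have v [measurable]: "v \<in> borel_measurable borel" unfolding v_def[abs_def] by measurable
  have uv: "AE x in lebesgue. u x = v x"
    using K(2) AE_completion[OF uv0] by eventually_elim (auto simp: v_def indicator_def)
  have v': "v \<in> borel_measurable lebesgue" by (rule measurable_completion) simp
  have "integrable lebesgue v"
    by (rule integrable_cong_AE_imp[OF int v' uv])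
  then have vint: "integrable lborel v" by (simp add: integrable_completion)
  have ci: "compact_integrable_cart v K"
    unfolding compact_integrable_cart_def compact_integrable_def
    using v vint K(1) by (auto simp: v_def)
  have "fun_current u \<omega> = compact_integrable.pairing v (\<lambda>x. \<omega> x std_basis) 0"
    if w: "\<omega> \<in> smooth_forms CARD('n)" for \<omega>
  proof -
    have [measurable]: "(\<lambda>x. \<omega> x std_basis) \<in> borel_measurable borel"
      by (rule smooth_borel_measurable[OF smooth_formsD(2)[OF w]])
    have ml: "(\<lambda>x. \<omega> x std_basis) \<in> borel_measurable lebesgue"
      by (rule measurable_completion) simp
    have "fun_current u \<omega> = (LINT x|lebesgue. v x * \<omega> x std_basis)"
      unfolding fun_current_def
      by (rule integral_cong_AE)
         (use uv in \<open>auto intro: borel_measurable_times borel_measurable_integrable[OF int] v' ml\<close>)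
    also have "\<dots> = (\<integral>x. v x * \<omega> x std_basis \<partial>lborel)"
      by (rule integral_completion) measurable
    finally show ?thesis
      unfolding compact_integrable.pairing_def[OF ci[unfolded compact_integrable_cart_def]] add_0_right .
  qed
  then show thesis using that ci uv by blast
qed

theorem theorem4p1:
  fixes \<alpha> :: real
  assumes "0 < \<alpha>" and "\<alpha> < 1"
  shows "\<exists>C>0. \<forall>u :: real ^ 'n::{finite,linorder} \<Rightarrow> real.
    integrable lebesgue u \<longrightarrow> compactly_supported u \<longrightarrow>
      (fractional_current CARD('n::{finite,linorder}) \<alpha> (fun_current u) \<longleftrightarrow> u \<in> sobolev_c \<alpha>) \<and>
      (u \<in> sobolev_c \<alpha> \<longrightarrow>
         ennreal (1 / C) * frac_norm \<alpha> (fun_current u) \<le> sobolev_norm \<alpha> u \<and>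
         sobolev_norm \<alpha> u \<le> ennreal C * frac_norm \<alpha> (fun_current u))"
proof -
  note \<alpha> = assms
  let ?s = "real CARD('n) + 1 - \<alpha>"
  define k where "k = enn2real (\<integral>\<^sup>+h. ennreal (min 2 (norm h) / norm h powr ?s) \<partial>(lborel :: (real, 'n) vec measure))"
  have k: "ennreal k = (\<integral>\<^sup>+h. ennreal (min 2 (norm h) / norm h powr ?s) \<partial>(lborel :: (real, 'n) vec measure))"
    using kernel_integral_finite[OF \<alpha>, where 'a="(real, 'n) vec"] by (simp add: k_def)
  have k0: "0 \<le> k" by (simp add: k_def)
  let ?c = "bump_constant TYPE('n)"
  have c: "0 < ?c"
    unfolding bump_constant_def by (intro divide_pos_pos bump_mass_pos) simp
  \<comment> \<open>The two inequalities need \<open>6 * ?c\<close> and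
    \<open>fact CARD('n) * k\<close>; the sum dominates both and is positive thanks to
    \<open>?c\<close>.\<close>
  define C where "C = 6 * ?c + fact CARD('n) * k"
  have C: "0 < C" "6 * ?c \<le> C" "fact CARD('n) * k \<le> C" using c k0 by (auto simp: C_def add_pos_nonneg)
  show ?thesis
  proof (intro exI[of _ C] conjI allI impI)
    show "0 < C" by (rule C)
    fix u :: "(real, 'n) vec \<Rightarrow> real"
    assume int: "integrable lebesgue u" and supp: "compactly_supported u"
    obtain v K where ci: "compact_integrable_cart v K" and uv: "AE x in lebesgue. u x = v x"
      and rep: "\<forall>\<omega>\<in>smooth_forms CARD('n). fun_current u \<omega> = compact_integrable.pairing v (\<lambda>x. \<omega> x std_basis) 0"
      using fun_current_representative[OF int supp] by blast
    interpret compact_integrable_cart v K by (rule ci)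
    let ?I = "\<integral>\<^sup>+h. shift_diff v h * ennreal (1 / norm h powr ?s) \<partial>lborel"
    have sob: "sobolev_norm \<alpha> u = ?I"
      using sobolev_norm_eq_shift_diff[OF v_measurable uv, of \<alpha>] by simp
    have mem: "u \<in> sobolev_c \<alpha> \<longleftrightarrow> ?I < \<infinity>"
      using int supp by (simp add: sobolev_c_def sob)
    have hom: "fun_current u (\<lambda>x vs. r * \<omega> x vs) = r * fun_current u \<omega>" for r \<omega>
    proof -
      have "(\<lambda>x. u x * (r * \<omega> x std_basis)) = (\<lambda>x. r * (u x * \<omega> x std_basis))" by (simp add: mult.left_commute)
      then show ?thesis by (simp add: fun_current_def)
    qed
    have test: "fun_current u (\<lambda>x vs. f x * det_form vs) = (\<integral>x. v x * f x \<partial>lborel)" if "smooth f" for f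
      using bspec[OF rep smooth_forms_product[OF that covector_det_form]] by (simp add: pairing_def)
    \<comment> \<open>Valid for every decomposition: a single one gives finiteness of the Sobolev
      norm, and all of them together give the bound by the infimum.\<close>
    have upper: "sobolev_norm \<alpha> u \<le> ennreal (fact CARD('n)) * ennreal k *
        (\<Sum>j. ennreal (enn2real (mass (CARD('n) - 1) (boundary (S j))) powr (1 - \<alpha>) *
                     enn2real (mass CARD('n) (S j)) powr \<alpha>))"
      if "fractional_decomposition CARD('n) \<alpha> (fun_current u) S" for S
      unfolding k by (rule sobolev_norm_le_decomposition[OF \<alpha> v_measurable v_integrable uv hom test that])
    show "fractional_current CARD('n) \<alpha> (fun_current u) \<longleftrightarrow> u \<in> sobolev_c \<alpha>"
    proof
      assume "fractional_current CARD('n) \<alpha> (fun_current u)"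
      then obtain S where S: "fractional_decomposition CARD('n) \<alpha> (fun_current u) S"
        unfolding fractional_current_def by blast
      have "sobolev_norm \<alpha> u < \<infinity>"
        by (rule le_less_trans[OF upper[OF S]])
           (use decomposition_sum_finite[OF \<alpha> S] in \<open>simp add: ennreal_mult_less_top\<close>)
      then show "u \<in> sobolev_c \<alpha>" using int supp by (simp add: sobolev_c_def)
    qed (use fractional_current_representation[OF \<alpha> rep] mem in simp)
    assume "u \<in> sobolev_c \<alpha>"
    then have "frac_norm \<alpha> (fun_current u) \<le> ennreal (6 * ?c) * ?I"
      using frac_norm_le[OF \<alpha> rep] mem by simp
    then have "ennreal (1 / C) * frac_norm \<alpha> (fun_current u) \<le> ennreal (1 / C) * (ennreal (6 * ?c) * ?I)"
      by (rule mult_left_mono) simp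
    also have "\<dots> = ennreal (1 / C * (6 * ?c)) * ?I"
      using c C by (subst ennreal_mult) (auto simp: mult.assoc)
    also have "\<dots> \<le> ennreal 1 * ?I"
      by (intro mult_right_mono ennreal_leI) (use C in \<open>simp_all add: divide_le_eq\<close>)
    finally show "ennreal (1 / C) * frac_norm \<alpha> (fun_current u) \<le> sobolev_norm \<alpha> u" by (simp add: sob)
    \<comment> \<open>The constant is put on the left so that the infimum stands alone on the right;
      multiplying back by \<open>C\<close> is exact, as \<open>C\<close> is positive and
      finite.\<close>
    have "ennreal (1 / C) * sobolev_norm \<alpha> u \<le> frac_norm \<alpha> (fun_current u)"
      unfolding frac_norm_def
    proof (rule INF_greatest)
      fix S assume "S \<in> {S. fractional_decomposition DIM((real, 'n) vec) \<alpha> (fun_current u) S}"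
      then have S: "fractional_decomposition CARD('n) \<alpha> (fun_current u) S" by simp
      let ?S = "\<Sum>j. ennreal (enn2real (mass (CARD('n) - 1) (boundary (S j))) powr (1 - \<alpha>) *
                     enn2real (mass CARD('n) (S j)) powr \<alpha>)"
      have "ennreal (1 / C) * sobolev_norm \<alpha> u \<le> ennreal (1 / C) * (ennreal (fact CARD('n)) * ennreal k * ?S)"
        by (intro mult_left_mono upper[OF S]) simp
      also have "\<dots> = ennreal (1 / C * (fact CARD('n) * k)) * ?S"
      proof -
        have "ennreal (1 / C * (fact CARD('n) * k)) = ennreal (1 / C) * (ennreal (fact CARD('n)) * ennreal k)"
          using C k0 by (subst ennreal_mult) (auto simp: ennreal_mult)
        then show ?thesis by (simp only: mult.assoc)
      qed
      also have "\<dots> \<le> ennreal 1 * ?S"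
        by (intro mult_right_mono ennreal_leI) (use C in \<open>simp_all add: divide_le_eq\<close>)
      finally show "ennreal (1 / C) * sobolev_norm \<alpha> u \<le>
          (\<Sum>j. ennreal (enn2real (mass (DIM((real, 'n) vec) - 1) (boundary (S j))) powr (1 - \<alpha>) *
                     enn2real (mass DIM((real, 'n) vec) (S j)) powr \<alpha>))" by simp
    qed
    then have "ennreal C * (ennreal (1 / C) * sobolev_norm \<alpha> u) \<le> ennreal C * frac_norm \<alpha> (fun_current u)"
      by (rule mult_left_mono) simp
    moreover have "ennreal C * (ennreal (1 / C) * sobolev_norm \<alpha> u) = sobolev_norm \<alpha> u"
    proof -
      have "ennreal C * ennreal (1 / C) = 1" using C by (subst ennreal_mult[symmetric]) auto
      then show ?thesis by (simp add: mult.assoc[symmetric])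
    qed
    ultimately show "sobolev_norm \<alpha> u \<le> ennreal C * frac_norm \<alpha> (fun_current u)" by simp
  qed
qed

end
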